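(* Let $K$ be a field of characteristic $0$, and let $I$ be a complete intersection of type $(d_1, \dots, d_r)$ in $K[x_1, \dots, x_r]$, where $d_1 \leq \cdots \leq d_r$. Then the limiting polytope of the reverse lexicographic generic initial system $\{\mathrm{gin}(I^n)\}_{n \geq 1}$ is the closure of the complement in $\mathbb{R}_{\geq 0}^r$ of the $r$-simplex with vertices at the points $$(0, 0, \dots, 0),\ (d_1, 0, \dots, 0),\ (0, d_2, 0, \dots, 0),\ \dots,\ (0, \dots, 0, d_r).$$
   Context: Polynomial rings carry the standard grading, and $\mathbb{N}$ includes $0$. A homogeneous ideal $I=(f_1,\dots,f_r)$ of a polynomial ring is a complete intersection of type $(d_1,\dots,d_r)$ if $f_1,\dots,f_r$ is a regular sequence of homogeneous elements with $\deg(f_i)=d_i$. Reverse lexicographic order on monomials of $K[x_1,\dots,x_m]$: $x^a > x^b$ if $|a|>|b|$, or if $|a|=|b|$ and there is $k$ with $a_l=b_l$ for all $l>k$ and $a_k<b_k$ (here $|a|=a_1+\cdots+a_m$). Generic initial ideal: a matrix $g=(g_{ij})\in \mathrm{GL}_m(K)$ acts on $K[x_1,\dots,x_m]$ by $x_i\mapsto \sum_j g_{ij}x_j$. For a homogeneous ideal $J$ there is (Galligo's theorem) a nonempty Zariski open $U\subset \mathrm{GL}_m(K)$ on which the initial ideal $\mathrm{In}_>(g(J))$, with respect to the reverse lexicographic order, is constant; $\mathrm{gin}(J)$ denotes this constant value. The generic initial system of $I$ is the family $\{\mathrm{gin}(I^n)\}_{n\ge 1}$; it is a graded system of monomial ideals,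 where a graded system is a family of ideals $\{\mathrm{a}_q\}_{q\ge1}$ with $\mathrm{a}_i\mathrm{a}_j\subseteq \mathrm{a}_{i+j}$ for all $i,j\ge1$. For a monomial ideal $J\subset K[x_1,\dots,x_m]$, its Newton polytope $P_J$ is the convex hull in $\mathbb{R}^m$ of $\{\lambda\in\mathbb{N}^m : x^\lambda\in J\}$, and $cP_J$ denotes its scaling by a factor of $c$. The limiting polytope $P$ of a graded system of monomial ideals $\{\mathrm{a}_q\}_{q\ge1}$ is the limit of the polytopes $\frac1q P_{\mathrm{a}_q}$, namely $$P=\bigcup_{q\ge 1}\frac1q P_{\mathrm{a}_q}.$$
   Formalization: The limiting polytope is taken to be the closure of the union of the polytopes (1/q)P_{gin(I^q)}; with the bare union the claim fails, e.g. for I=(x^2,y^2) the point (0,2) lies in no (1/q)P_{gin(I^q)}. *)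

theory Defs
  imports "HOL-Analysis.Analysis" "HOL-Library.Poly_Mapping"
begin

section \<open>Polynomial rings\<close>

text \<open>
  The type \<open>('k, 'n) mpoly\<close> is the polynomial ring over \<open>'k\<close> in the variables \<open>x\<^sub>i\<close>, \<open>i :: 'n\<close>: finitely
  supported maps from exponent vectors to coefficients, with the convolution product of
  \<open>Poly_Mapping\<close>. For finite linearly ordered \<open>'n\<close> the variables are \<open>x\<^sub>1, \<dots>, x\<^sub>m\<close> with
  \<open>m = CARD('n)\<close>, listed in increasing order of their index.
\<close>

type_synonym 'n monom = "'n \<Rightarrow>\<^sub>0 nat"
type_synonym ('k, 'n) mpoly = "'n monom \<Rightarrow>\<^sub>0 'k"

definition mon :: "'n monom \<Rightarrow> ('k::comm_ring_1, 'n) mpoly" where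
  "mon a = Poly_Mapping.single a 1"

definition const :: "'k \<Rightarrow> ('k::comm_ring_1, 'n) mpoly" where
  "const c = Poly_Mapping.single 0 c"

definition var :: "'n \<Rightarrow> ('k::comm_ring_1, 'n) mpoly" where
  "var i = mon (Poly_Mapping.single i 1)"

definition mdeg :: "'n::finite monom \<Rightarrow> nat" where
  "mdeg a = (\<Sum>i\<in>UNIV. Poly_Mapping.lookup a i)"

text \<open>As usual, 0 is homogeneous of every degree.\<close>

definition homogeneous :: "nat \<Rightarrow> ('k::comm_ring_1, 'n::finite) mpoly \<Rightarrow> bool" where
  "homogeneous e f \<longleftrightarrow> (\<forall>a\<in>Poly_Mapping.keys f. mdeg a = e)"

text \<open>The value of a polynomial at \<open>v\<close>, its coefficients being mapped by \<open>\<phi>\<close>.\<close>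

definition eval_with ::
  "('k \<Rightarrow> 'b) \<Rightarrow> ('n \<Rightarrow> 'b) \<Rightarrow> ('k::comm_ring_1, 'n::finite) mpoly \<Rightarrow> 'b::comm_ring_1" where
  "eval_with \<phi> v f = (\<Sum>a\<in>Poly_Mapping.keys f.
     \<phi> (Poly_Mapping.lookup f a) * (\<Prod>i\<in>UNIV. v i ^ Poly_Mapping.lookup a i))"


section \<open>Ideals and complete intersections\<close>

text \<open>Ideals are the submodules of the ring over itself.\<close>

definition ideal_gen :: "'a::comm_ring_1 set \<Rightarrow> 'a set" where
  "ideal_gen = module.span (*)"

definition ideal_mult :: "'a::comm_ring_1 set \<Rightarrow> 'a set \<Rightarrow> 'a set" where
  "ideal_mult I J = ideal_gen {x * y |x y. x \<in> I \<and> y \<in> J}"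

primrec ideal_power :: "'a::comm_ring_1 set \<Rightarrow> nat \<Rightarrow> 'a set" where
  "ideal_power I 0 = UNIV"
| "ideal_power I (Suc n) = ideal_mult I (ideal_power I n)"

text \<open>
  Each \<open>f i\<close> is a nonzerodivisor modulo its predecessors, and the sequence does not generate the
  unit ideal. In particular no \<open>f i\<close> is 0.
\<close>

definition regular_sequence :: "('i::linorder \<Rightarrow> 'a::comm_ring_1) \<Rightarrow> bool" where
  "regular_sequence f \<longleftrightarrow>
     (\<forall>i h. f i * h \<in> ideal_gen (f ` {..<i}) \<longrightarrow> h \<in> ideal_gen (f ` {..<i})) \<and>
     ideal_gen (range f) \<noteq> UNIV"

definition complete_intersection ::
  "('i::{finite,linorder} \<Rightarrow> nat) \<Rightarrow> ('k::field, 'n::finite) mpoly set \<Rightarrow> bool" where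
  "complete_intersection d I \<longleftrightarrow>
     (\<exists>f. I = ideal_gen (range f) \<and> regular_sequence f \<and> (\<forall>i. homogeneous (d i) (f i)))"


section \<open>Generic initial ideals\<close>

definition revlex_gt :: "'n::{finite,linorder} monom \<Rightarrow> 'n monom \<Rightarrow> bool" where
  "revlex_gt a b \<longleftrightarrow> mdeg a > mdeg b \<or>
     (mdeg a = mdeg b \<and>
      (\<exists>k. (\<forall>l>k. Poly_Mapping.lookup a l = Poly_Mapping.lookup b l) \<and>
           Poly_Mapping.lookup a k < Poly_Mapping.lookup b k))"

definition lead_monom :: "('k::field, 'n::{finite,linorder}) mpoly \<Rightarrow> 'n monom" where
  "lead_monom f = (THE a. a \<in> Poly_Mapping.keys f \<and>
     (\<forall>b\<in>Poly_Mapping.keys f. b \<noteq> a \<longrightarrow> revlex_gt a b))"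

definition initial_ideal ::
  "('k::field, 'n::{finite,linorder}) mpoly set \<Rightarrow> ('k, 'n) mpoly set" where
  "initial_ideal J = ideal_gen {mon (lead_monom f) |f. f \<in> J \<and> f \<noteq> 0}"

text \<open>The action of a matrix \<open>g\<close>, that is, \<open>x\<^sub>i \<mapsto> \<Sum>\<^sub>j g\<^sub>i\<^sub>j x\<^sub>j\<close>.\<close>

definition mat_act ::
  "'k::field^'n^'n \<Rightarrow> ('k, 'n::finite) mpoly \<Rightarrow> ('k, 'n) mpoly" where
  "mat_act g = eval_with const (\<lambda>i. \<Sum>j\<in>UNIV. const (g $ i $ j) * var j)"

text \<open>
  Zariski open subsets of the general linear group: the invertible matrices at which some member
  of a family of polynomials in the matrix entries does not vanish.
\<close>

definition zariski_open_GL :: "('k::field^'n^'n) set \<Rightarrow> bool" where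
  "zariski_open_GL U \<longleftrightarrow> (\<exists>S :: ('k, 'n::finite \<times> 'n) mpoly set.
     U = {g. invertible g \<and> (\<exists>p\<in>S. eval_with id (\<lambda>(i, j). g $ i $ j) p \<noteq> 0)})"

definition gin :: "('k::field, 'n::{finite,linorder}) mpoly set \<Rightarrow> ('k, 'n) mpoly set" where
  "gin J = (THE G. \<exists>U. zariski_open_GL U \<and> U \<noteq> {} \<and>
     (\<forall>g\<in>U. initial_ideal (mat_act g ` J) = G))"


section \<open>Limiting polytopes\<close>

definition newton_polytope :: "('k::field, 'n::finite) mpoly set \<Rightarrow> (real^'n) set" where
  "newton_polytope J =
     convex hull {\<chi> i. real (Poly_Mapping.lookup a i) |a. mon a \<in> J}"

text \<open>
  The limit of the polytopes \<open>(1/q) P\<^sub>q\<close> is taken in the sense of closed sets, i.e. as the closure of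
  their union. The bare union need not be closed, even for generic initial systems: for
  \<open>I = (x\<^sup>2, y\<^sup>2)\<close> the point \<open>(0, 2)\<close> is a limit of points of the polytopes \<open>(1/q) P\<^sub>q\<close> of \<open>gin (I\<^sup>q)\<close>, but
  belongs to none of them, since \<open>y\<close> to the power \<open>2q\<close> is not in \<open>gin (I\<^sup>q)\<close>.
\<close>

definition limiting_polytope ::
  "(nat \<Rightarrow> ('k::field, 'n::finite) mpoly set) \<Rightarrow> (real^'n) set" where
  "limiting_polytope A =
     closure (\<Union>q\<in>{1..}. (*\<^sub>R) (1 / real q) ` newton_polytope (A q))"

end

theory Submission
  imports Defs "HOL-Computational_Algebra.Polynomial"
begin

text \<open>
  Choosing forms \<open>b\<^sub>a\<close> (\<open>a\<^sub>i < d\<^sub>i\<close>) of degree \<open>|a|\<close> that span the polynomial ring \<open>S\<close> modulo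
  \<open>I = (f\<^sub>1, \<dots>, f\<^sub>r)\<close>, the products of a form \<open>b\<^sub>a\<close> and a
  monomial in the \<open>f\<^sub>i\<close> span \<open>S\<close>, and those with at least \<open>n\<close> factors \<open>f\<^sub>i\<close> span \<open>I\<^sup>n\<close>. As the Hilbert function
  of \<open>S / I\<close> counts the monomials \<open>x\<^sup>a\<close> with \<open>a\<^sub>i < d\<^sub>i\<close>, up to any degree \<open>gin (I\<^sup>n)\<close> has at most as many
  monomials \<open>x\<^sup>c\<close> as there are exponents with \<open>n \<le> (\<Sum>i. c\<^sub>i div d\<^sub>i)\<close>.

  On the other hand \<open>gin (I\<^sup>n)\<close> contains \<open>x\<^sub>i\<close> to the power \<open>n d\<^sub>i + s\<close> with \<open>s\<close> independent of \<open>n\<close>: by Noether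
  normalization \<open>f\<^sub>1, \<dots>, f\<^sub>i\<close> generate an ideal primary to the maximal ideal modulo suitable linear
  forms in the place of \<open>x\<^sub>j\<close>, \<open>j > i\<close>, and in the reverse lexicographic order the monomials divisible
  by some of these \<open>x\<^sub>j\<close> are the smallest of their degree. Hence the limiting polytope contains
  \<open>{x \<ge> 0. (\<Sum>i. x\<^sub>i / d\<^sub>i) \<ge> 1}\<close>; an exponent violating the inequality would, together with its multiples,
  give more monomials than the count allows.
\<close>

section \<open>Linear algebra modulo a subspace\<close>

text \<open>The bridge between dimensions and initial ideals is \<open>card_lead_monoms\<close>: if
  \<open>D\<close> contains with a monomial all revlex-smaller ones, the leading monomials of
  \<open>J\<close> in \<open>D\<close> are counted by the dimension of the space of polynomials in
  \<open>J\<close> supported in \<open>D\<close>. For the image of \<open>J\<close> under a matrix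
  \<open>g\<close> this dimension is upper semicontinuous in \<open>g\<close>, so its least value is
  the generic one. This yields the existence of the generic initial ideal, and it resolves an
  obstacle: Noether normalization produces one special matrix, not a generic one. At the special
  matrix the largest monomials of some degree are all leading; a generic matrix has at most as many
  leading monomials among the smaller ones and the same total, so the largest ones are leading there
  too.

  The order of the degrees enters with the pure powers: writing a form by means of
  \<open>f j\<close> with \<open>j \<le> i\<close> lowers the degree of the cofactors by at most
  \<open>d i\<close>, so \<open>n\<close> such steps cost \<open>n * d i\<close>, and the constant
  \<open>s\<close> is what Noether normalization requires at the end.\<close>

definition independent_mod ::
  "('a::zero \<Rightarrow> 'b \<Rightarrow> 'b::comm_monoid_add) \<Rightarrow> 'b set \<Rightarrow> 'c set \<Rightarrow> ('c \<Rightarrow> 'b) \<Rightarrow> bool" where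
  "independent_mod sc U K w \<longleftrightarrow> (\<forall>c. (\<Sum>k\<in>K. sc (c k) (w k)) \<in> U \<longrightarrow> (\<forall>k\<in>K. c k = 0))"

context vector_space
begin

lemma independent_modD:
  "independent_mod scale U K w \<Longrightarrow> (\<Sum>k\<in>K. c k *s w k) \<in> U \<Longrightarrow> k \<in> K \<Longrightarrow> c k = 0"
  by (auto simp: independent_mod_def)

lemma finite_basis_in_span:
  assumes "subspace U" "U \<subseteq> span T" "finite T"
  obtains X where "X \<subseteq> U" "finite X" "independent X" "span X = U" "card X = dim U"
proof -
  obtain X where X: "X \<subseteq> U" "independent X" "U \<subseteq> span X" "card X = dim U"
    by (rule basis_exists)
  have "finite X" using independent_span_bound[OF assms(3) X(2)] X(1) assms(2) by blast
  moreover have "span X = U" using X assms(1) span_subspace by blast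
  ultimately show ?thesis using X that by blast
qed

lemma independent_mod_Un:
  assumes X: "finite X" "independent X" and K: "finite K" and w: "independent_mod scale (span X) K w"
  shows "inj_on w K" "w ` K \<inter> X = {}" "independent (X \<union> w ` K)"
proof -
  show inj: "inj_on w K"
  proof (rule inj_onI, rule ccontr)
    fix k l assume kl: "k \<in> K" "l \<in> K" "w k = w l" "k \<noteq> l"
    define c where "c = (\<lambda>m. if m = k then 1 else if m = l then - 1 else (0::'a))"
    have "(\<Sum>m\<in>K. c m *s w m) = (\<Sum>m\<in>{k,l}. c m *s w m)"
      by (rule sum.mono_neutral_right) (use K kl in \<open>auto simp: c_def\<close>)
    also have "\<dots> = 0" using kl by (simp add: c_def)
    finally have "(\<Sum>m\<in>K. c m *s w m) \<in> span X" by (simp add: span_zero)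
    from independent_modD[OF w this kl(1)] show False by (simp add: c_def)
  qed
  show disj: "w ` K \<inter> X = {}"
  proof (rule ccontr)
    assume "w ` K \<inter> X \<noteq> {}"
    then obtain k where k: "k \<in> K" "w k \<in> X" by auto
    have "(\<Sum>m\<in>K. (if m = k then 1 else 0) *s w m) = (\<Sum>m\<in>{k}. (if m = k then 1 else 0) *s w m)"
      by (rule sum.mono_neutral_right) (use K k in auto)
    then have "(\<Sum>m\<in>K. (if m = k then 1 else 0) *s w m) \<in> span X"
      using k by (simp add: span_base)
    from independent_modD[OF w this k(1)] show False by simp
  qed
  show "independent (X \<union> w ` K)"
  proof (rule independent_if_scalars_zero)
    show "finite (X \<union> w ` K)" using X K by simp
    fix f x assume s: "(\<Sum>x\<in>X \<union> w ` K. f x *s x) = 0" and x: "x \<in> X \<union> w ` K"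
    have e: "(\<Sum>x\<in>X. f x *s x) + (\<Sum>k\<in>K. f (w k) *s w k) = 0"
      using s X K disj inj
      by (subst (asm) sum.union_disjoint) (auto simp: sum.reindex)
    then have "(\<Sum>k\<in>K. f (w k) *s w k) = - (\<Sum>x\<in>X. f x *s x)"
      by (simp add: eq_neg_iff_add_eq_0 add.commute)
    also have "\<dots> \<in> span X" by (intro span_neg span_sum span_scale span_base)
    finally have z: "\<forall>k\<in>K. f (w k) = 0" using independent_modD[OF w, of "\<lambda>k. f (w k)"] by blast
    then have "(\<Sum>x\<in>X. f x *s x) = 0" using e by simp
    then have "\<forall>x\<in>X. f x = 0" using X independent_explicit_finite_subsets by blast
    with z x show "f x = 0" by auto
  qed
qed

text \<open>The finite set \<open>T\<close> certifies finite dimension. The polynomial ring is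
  infinite-dimensional, and \<open>dim\<close> takes the default value 0 on infinite-dimensional
  subspaces.\<close>

lemma dim_add_card_le:
  assumes "subspace U" "U \<subseteq> W" "W \<subseteq> span T" "finite T" "finite K" "w ` K \<subseteq> W"
    and "independent_mod scale U K w"
  shows "dim U + card K \<le> dim W"
proof -
  obtain X where X: "X \<subseteq> U" "finite X" "independent X" "span X = U" "card X = dim U"
    using finite_basis_in_span[of U T] assms by blast
  note u = independent_mod_Un[OF X(2,3) assms(5), of w, unfolded X(4), OF assms(7)]
  obtain Y where Y: "Y \<subseteq> W" "independent Y" "W \<subseteq> span Y" "card Y = dim W"
    by (rule basis_exists)
  have fY: "finite Y"
    using independent_span_bound[OF assms(4) Y(2)] Y(1) assms(3) by blast
  have "card (X \<union> w ` K) \<le> card Y"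
    using independent_span_bound[OF fY u(3)] X(1) assms(2,6) Y(3) by blast
  moreover have "card (X \<union> w ` K) = card X + card K"
    using u X(2) assms(5) by (subst card_Un_disjoint) (auto simp: card_image)
  ultimately show ?thesis using X(5) Y(4) by simp
qed

lemma dim_le_add_card:
  assumes "subspace U" "U \<subseteq> span T" "finite T" "finite K" "W \<subseteq> span (U \<union> w ` K)"
  shows "dim W \<le> dim U + card K"
proof -
  obtain X where X: "X \<subseteq> U" "finite X" "independent X" "span X = U" "card X = dim U"
    using finite_basis_in_span[of U T] assms by blast
  have "U \<union> w ` K \<subseteq> span (X \<union> w ` K)"
    using X(4) span_mono[of X "X \<union> w ` K"] span_superset[of "X \<union> w ` K"] by blast
  then have "W \<subseteq> span (X \<union> w ` K)"
    using assms(5) span_minimal subspace_span by blast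
  then have "dim W \<le> card (X \<union> w ` K)"
    using X(2) assms(4) by (intro dim_le_card) auto
  also have "\<dots> \<le> card X + card K"
    by (meson add_left_mono assms(4) card_Un_le card_image_le le_trans)
  finally show ?thesis using X(5) by simp
qed

text \<open>\<open>K\<close> represents a basis of the quotient of \<open>W\<close> by
  \<open>U\<close>, so that Hilbert functions of quotient rings can be handled without quotient
  types.\<close>

lemma complement_exists:
  assumes "subspace U" "subspace W" "U \<subseteq> W" "W \<subseteq> span T" "finite T"
  obtains K where "finite K" "K \<subseteq> W" "independent_mod scale U K (\<lambda>k. k)" "W = span (U \<union> K)"
    "dim W = dim U + card K"
proof -
  obtain X where X: "X \<subseteq> U" "finite X" "independent X" "span X = U" "card X = dim U"
    using finite_basis_in_span[of U T] assms by blast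
  obtain Y where Y: "X \<subseteq> Y" "Y \<subseteq> W" "independent Y" "W \<subseteq> span Y"
    using maximal_independent_subset_extend[of X W] X assms(3) by blast
  have fY: "finite Y" using independent_span_bound[OF assms(5) Y(3)] Y(2) assms(4) by blast
  have sY: "span Y = W" using Y assms(2) span_subspace by blast
  have cY: "card Y = dim W" using basis_card_eq_dim Y by blast
  show ?thesis
  proof (rule that[of "Y - X"])
    show "finite (Y - X)" "Y - X \<subseteq> W" using fY Y by auto
    show "dim W = dim U + card (Y - X)"
      using cY X(5) Y(1) X(2) fY card_mono[OF fY Y(1)] by (simp add: card_Diff_subset)
    show "W = span (U \<union> (Y - X))"
    proof
      show "W \<subseteq> span (U \<union> (Y - X))"
        unfolding sY[symmetric] by (rule span_mono) (use X in auto)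
      show "span (U \<union> (Y - X)) \<subseteq> W"
        by (rule span_minimal) (use assms Y in auto)
    qed
    show "independent_mod scale U (Y - X) (\<lambda>k. k)"
      unfolding independent_mod_def
    proof (intro allI impI ballI)
      fix c k assume s: "(\<Sum>k\<in>Y - X. c k *s k) \<in> U" and k: "k \<in> Y - X"
      obtain d where d: "(\<Sum>k\<in>Y - X. c k *s k) = (\<Sum>x\<in>X. d x *s x)"
        using s X(2,4) span_finite[OF X(2)] by auto
      define e where "e = (\<lambda>y. if y \<in> X then - d y else c y)"
      have "(\<Sum>y\<in>Y. e y *s y) = (\<Sum>y\<in>Y - X. e y *s y) + (\<Sum>y\<in>X. e y *s y)"
        using fY Y(1) sum.subset_diff by blast
      also have "\<dots> = (\<Sum>y\<in>Y - X. c y *s y) - (\<Sum>x\<in>X. d x *s x)"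
        by (simp add: e_def sum_negf)
      finally have "(\<Sum>y\<in>Y. e y *s y) = 0" using d by simp
      then have "e k = 0" using independent_explicit_finite_subsets Y(3) fY k by blast
      then show "c k = 0" using k by (simp add: e_def)
    qed
  qed
qed

end

section \<open>The polynomial ring and the action of matrices\<close>

locale comm_ring_map =
  fixes \<phi> :: "'a::comm_ring_1 \<Rightarrow> 'b::comm_ring_1"
  assumes map_one: "\<phi> 1 = 1"
    and map_add: "\<phi> (x + y) = \<phi> x + \<phi> y"
    and map_mult: "\<phi> (x * y) = \<phi> x * \<phi> y"
begin

lemma map_zero: "\<phi> 0 = 0"
  using map_add[of 0 0] by simp

lemma map_minus: "\<phi> (x - y) = \<phi> x - \<phi> y"
  using map_add[of "x - y" y] by (simp add: algebra_simps)

lemma map_sum: "\<phi> (\<Sum>x\<in>A. f x) = (\<Sum>x\<in>A. \<phi> (f x))"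
  by (induction A rule: infinite_finite_induct) (auto simp: map_zero map_add)

lemma map_prod: "\<phi> (\<Prod>x\<in>A. f x) = (\<Prod>x\<in>A. \<phi> (f x))"
  by (induction A rule: infinite_finite_induct) (auto simp: map_one map_mult)

lemma map_power: "\<phi> (x ^ n) = \<phi> x ^ n"
  by (induction n) (auto simp: map_one map_mult)

end

section \<open>Monomials and coefficients of products\<close>

lemma mdeg_zero [simp]: "mdeg 0 = 0"
  and mdeg_add [simp]: "mdeg (a + b) = mdeg a + mdeg b"
  and mdeg_single [simp]: "mdeg (Poly_Mapping.single i n) = n"
  by (simp_all add: mdeg_def lookup_add sum.distrib lookup_single when_def)

lemma lookup_le_mdeg: "Poly_Mapping.lookup a i \<le> mdeg a"
  unfolding mdeg_def by (rule member_le_sum) auto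

lemma finite_mdeg_le: "finite {a::'n::finite monom. mdeg a \<le> E}"
proof (rule finite_imageD)
  have "Poly_Mapping.lookup ` {a::'n monom. mdeg a \<le> E} \<subseteq> PiE UNIV (\<lambda>_. {..E})"
    using lookup_le_mdeg le_trans by (fastforce simp: PiE_def)
  then show "finite (Poly_Mapping.lookup ` {a::'n monom. mdeg a \<le> E})"
    by (rule finite_subset) (intro finite_PiE, auto)
  show "inj_on Poly_Mapping.lookup {a::'n monom. mdeg a \<le> E}"
    by (auto intro: inj_onI simp: lookup_inject)
qed

lemma finite_mdeg_eq: "finite {a::'n::finite monom. mdeg a = e}"
  by (rule finite_subset[OF _ finite_mdeg_le[of e]]) auto

lemma finite_splittings: "finite {(b, c). b + c = (a::'n::finite monom)}"
  by (rule finite_subset[of _ "{b. mdeg b \<le> mdeg a} \<times> {c. mdeg c \<le> mdeg a}"])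
    (auto simp: finite_mdeg_le)

lemma lookup_mult_finite:
  "Poly_Mapping.lookup (f * g) (a::'n::finite monom) =
    (\<Sum>(b, c)\<in>{(b, c). b + c = a}. Poly_Mapping.lookup f b * Poly_Mapping.lookup g c)"
proof -
  have "Poly_Mapping.lookup (f * g) a =
      (\<Sum>(b, c). Poly_Mapping.lookup f b * Poly_Mapping.lookup g c when a = b + c)"
    by (simp add: times_poly_mapping.rep_eq prod_fun_unfold_prod)
  also have "\<dots> = (\<Sum>(b, c)\<in>{(b, c). b + c = a}.
      Poly_Mapping.lookup f b * Poly_Mapping.lookup g c when a = b + c)"
    by (rule Sum_any.expand_superset) (auto simp: finite_splittings)
  also have "\<dots> = (\<Sum>(b, c)\<in>{(b, c). b + c = a}. Poly_Mapping.lookup f b * Poly_Mapping.lookup g c)"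
    by (rule sum.cong) auto
  finally show ?thesis .
qed

lemma sum_single_lookup:
  assumes "finite K" "Poly_Mapping.keys f \<subseteq> K"
  shows "f = (\<Sum>a\<in>K. Poly_Mapping.single a (Poly_Mapping.lookup f a))"
proof (rule poly_mapping_eqI)
  fix b
  show "Poly_Mapping.lookup f b =
      Poly_Mapping.lookup (\<Sum>a\<in>K. Poly_Mapping.single a (Poly_Mapping.lookup f a)) b"
    using assms by (auto simp: lookup_sum lookup_single when_def in_keys_iff)
qed

lemma single_eq_const_mon: "Poly_Mapping.single a c = const c * mon a"
  by (simp add: const_def mon_def mult_single)

lemma lookup_const_mult [simp]:
  "Poly_Mapping.lookup (const c * f) a = c * Poly_Mapping.lookup f a"
  for f :: "('k::comm_ring_1, 'n) mpoly"
proof -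
  have "Poly_Mapping.lookup (Poly_Mapping.map ((*) c) f) a = c * Poly_Mapping.lookup f a"
    by (simp add: Poly_Mapping.map.rep_eq when_def)
  then show ?thesis by (simp add: const_def mult_map_scale_conv_mult)
qed

lemma mpoly_eq_sum:
  assumes "finite K" "Poly_Mapping.keys f \<subseteq> K"
  shows "f = (\<Sum>a\<in>K. const (Poly_Mapping.lookup f a) * mon a)"
  using sum_single_lookup[OF assms] unfolding single_eq_const_mon .

lemma mon_add: "mon (a + b) = mon a * mon b"
  by (simp add: mon_def mult_single)

lemma mon_zero [simp]: "mon 0 = 1"
  by (simp add: mon_def)

lemma const_one [simp]: "const 1 = 1"
  by (simp add: const_def)

lemma const_zero [simp]: "const 0 = 0"
  by (simp add: const_def)

lemma comm_ring_map_const: "comm_ring_map const"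
  by unfold_locales (auto simp: const_def mult_single single_add)

lemma const_add: "const (a + b) = const a + const b"
  and const_mult: "const (a * b) = const a * const b"
  by (auto simp: const_def mult_single single_add)

lemma lookup_mon: "Poly_Mapping.lookup (mon a) b = (if a = b then 1 else 0)"
  by (simp add: mon_def lookup_single when_def)

lemma keys_mon [simp]: "Poly_Mapping.keys (mon a :: ('k::comm_ring_1, 'n) mpoly) = {a}"
  by (simp add: mon_def)

lemma keys_const_mult: "Poly_Mapping.keys (const c * f) \<subseteq> Poly_Mapping.keys f"
  for f :: "('k::comm_ring_1, 'n) mpoly"
  by (auto simp: in_keys_iff)

lemma mon_power: "mon (Poly_Mapping.single i n) = var i ^ n"
proof (induction n)
  case (Suc n)
  have "Poly_Mapping.single i (Suc n) = Poly_Mapping.single i 1 + Poly_Mapping.single i n"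
    by (simp flip: single_add)
  then show ?case using Suc by (simp add: mon_add var_def)
qed simp

lemma mon_sum: "finite A \<Longrightarrow> mon (\<Sum>x\<in>A. f x) = (\<Prod>x\<in>A. mon (f x))"
  by (induction A rule: finite_induct) (auto simp: mon_add)

lemma monom_eq_sum: "a = (\<Sum>i\<in>UNIV. Poly_Mapping.single i (Poly_Mapping.lookup a i))"
  for a :: "'n::finite monom"
  by (rule poly_mapping_eqI) (simp add: lookup_sum lookup_single when_def)

lemma mon_eq_prod: "mon a = (\<Prod>i\<in>UNIV. var i ^ Poly_Mapping.lookup a i)"
  for a :: "'n::finite monom"
proof -
  have "mon a = mon (\<Sum>i\<in>UNIV. Poly_Mapping.single i (Poly_Mapping.lookup a i))"
    using arg_cong[OF monom_eq_sum[of a], of mon] .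
  also have "\<dots> = (\<Prod>i\<in>UNIV. var i ^ Poly_Mapping.lookup a i)"
    by (simp add: mon_sum mon_power)
  finally show ?thesis .
qed

context comm_ring_map
begin

lemma eval_with_superset:
  assumes "finite K" "Poly_Mapping.keys f \<subseteq> K"
  shows "eval_with \<phi> v f =
    (\<Sum>a\<in>K. \<phi> (Poly_Mapping.lookup f a) * (\<Prod>i\<in>UNIV. v i ^ Poly_Mapping.lookup a i))"
  unfolding eval_with_def
  by (rule sum.mono_neutral_left) (use assms in \<open>auto simp: in_keys_iff map_zero\<close>)

lemma eval_with_add: "eval_with \<phi> v (f + g) = eval_with \<phi> v f + eval_with \<phi> v g"
proof -
  let ?K = "Poly_Mapping.keys f \<union> Poly_Mapping.keys g"
  have "finite ?K" "Poly_Mapping.keys f \<subseteq> ?K" "Poly_Mapping.keys g \<subseteq> ?K"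
    "Poly_Mapping.keys (f + g) \<subseteq> ?K" using keys_add[of f g] by auto
  then show ?thesis
    by (simp add: eval_with_superset[of ?K] lookup_add map_add sum.distrib algebra_simps)
qed

lemma eval_with_single:
  "eval_with \<phi> v (Poly_Mapping.single a c) = \<phi> c * (\<Prod>i\<in>UNIV. v i ^ Poly_Mapping.lookup a i)"
  by (subst eval_with_superset[of "{a}"]) (auto simp: map_zero)

lemma eval_with_zero: "eval_with \<phi> v 0 = 0"
  by (simp add: eval_with_def)

lemma eval_with_sum: "eval_with \<phi> v (\<Sum>x\<in>A. f x) = (\<Sum>x\<in>A. eval_with \<phi> v (f x))"
  by (induction A rule: infinite_finite_induct) (auto simp: eval_with_zero eval_with_add)

lemma eval_with_mult: "eval_with \<phi> v (f * g) = eval_with \<phi> v f * eval_with \<phi> v g"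
proof -
  let ?s = "\<lambda>f a. Poly_Mapping.single a (Poly_Mapping.lookup f a)"
  have "f * g = (\<Sum>a\<in>Poly_Mapping.keys f. ?s f a) * (\<Sum>b\<in>Poly_Mapping.keys g. ?s g b)"
    using sum_single_lookup[of "Poly_Mapping.keys f" f, OF _ order_refl]
      sum_single_lookup[of "Poly_Mapping.keys g" g, OF _ order_refl]
    by (metis finite_keys)
  then have "eval_with \<phi> v (f * g) =
      (\<Sum>a\<in>Poly_Mapping.keys f. \<Sum>b\<in>Poly_Mapping.keys g. eval_with \<phi> v (?s f a * ?s g b))"
    by (simp add: sum_product eval_with_sum)
  also have "\<dots> = (\<Sum>a\<in>Poly_Mapping.keys f. \<Sum>b\<in>Poly_Mapping.keys g.
      eval_with \<phi> v (?s f a) * eval_with \<phi> v (?s g b))"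
    by (simp add: mult_single eval_with_single map_mult lookup_add power_add prod.distrib mult_ac)
  also have "\<dots> = eval_with \<phi> v f * eval_with \<phi> v g"
    by (simp add: eval_with_def[of \<phi> v f] eval_with_def[of \<phi> v g] eval_with_single sum_product)
  finally show ?thesis .
qed

lemma eval_with_const: "eval_with \<phi> v (const c) = \<phi> c"
  by (simp add: const_def eval_with_single)

lemma eval_with_var: "eval_with \<phi> v (var i) = v i"
proof -
  have "(\<Prod>j\<in>UNIV. v j ^ (if i = j then Suc 0 else 0)) = v i"
    by (subst prod.remove[of _ i]) auto
  then show ?thesis
    by (simp add: var_def mon_def eval_with_single map_one lookup_single when_def)
qed

lemma comm_ring_map_eval_with: "comm_ring_map (eval_with \<phi> v)"
proof
  show "eval_with \<phi> v 1 = 1"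
    using eval_with_const[of v 1] by (simp add: map_one)
qed (auto simp: eval_with_add eval_with_mult)

end

text \<open>Universal property of the polynomial ring; it reduces the composition law of the matrix
  action to a computation on variables.\<close>

lemma comm_ring_map_mpoly_eqI:
  fixes h k :: "('k::comm_ring_1, 'n::finite) mpoly \<Rightarrow> 'b::comm_ring_1"
  assumes "comm_ring_map h" "comm_ring_map k"
    and c: "\<And>c. h (const c) = k (const c)" and v: "\<And>i. h (var i) = k (var i)"
  shows "h f = k f"
proof -
  interpret h: comm_ring_map h by fact
  interpret k: comm_ring_map k by fact
  have "f = (\<Sum>a\<in>Poly_Mapping.keys f. const (Poly_Mapping.lookup f a) *
      (\<Prod>i\<in>UNIV. var i ^ Poly_Mapping.lookup a i))"
    (is "f = ?s") using mpoly_eq_sum[OF finite_keys order_refl, of f] unfolding mon_eq_prod .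
  moreover have "h ?s = k ?s"
    by (simp add: h.map_sum k.map_sum h.map_mult k.map_mult h.map_prod k.map_prod h.map_power
      k.map_power c v)
  ultimately show ?thesis by metis
qed

lemma comm_ring_map_mat_act: "comm_ring_map (mat_act g)"
  unfolding mat_act_def by (rule comm_ring_map.comm_ring_map_eval_with[OF comm_ring_map_const])

interpretation mat_act: comm_ring_map "mat_act g" for g
  by (rule comm_ring_map_mat_act)

lemma mat_act_const [simp]: "mat_act g (const c) = const c"
  unfolding mat_act_def by (rule comm_ring_map.eval_with_const[OF comm_ring_map_const])

lemma mat_act_var: "mat_act g (var i) = (\<Sum>j\<in>UNIV. const (g $ i $ j) * var j)"
  unfolding mat_act_def by (rule comm_ring_map.eval_with_var[OF comm_ring_map_const])

text \<open>The factors appear in reverse order: row \<open>i\<close> of \<open>h\<close> gives the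
  image of the variable \<open>i\<close>, and \<open>g\<close> is then substituted into that linear
  form.\<close>

lemma mat_act_mat_act: "mat_act g (mat_act h f) = mat_act (h ** g) f"
proof -
  have "comm_ring_map (\<lambda>f. mat_act g (mat_act h f))"
    by unfold_locales (auto simp: mat_act.map_one mat_act.map_add mat_act.map_mult)
  then show ?thesis
  proof (rule comm_ring_map_mpoly_eqI[OF _ comm_ring_map_mat_act])
    fix i
    have "mat_act g (mat_act h (var i)) =
        (\<Sum>j\<in>UNIV. \<Sum>k\<in>UNIV. const (h $ i $ j * g $ j $ k) * var k)"
      by (simp add: mat_act_var mat_act.map_sum mat_act.map_mult sum_distrib_left const_mult mult_ac)
    also have "\<dots> = (\<Sum>k\<in>UNIV. \<Sum>j\<in>UNIV. const (h $ i $ j * g $ j $ k) * var k)"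
      by (rule sum.swap)
    also have "\<dots> = mat_act (h ** g) (var i)"
      by (simp add: mat_act_var matrix_matrix_mult_def comm_ring_map.map_sum[OF comm_ring_map_const]
        sum_distrib_right)
    finally show "mat_act g (mat_act h (var i)) = mat_act (h ** g) (var i)" .
  qed simp
qed

lemma mat_act_mat_1: "mat_act (mat 1) f = f"
  for f :: "('k::field, 'n::finite) mpoly"
proof (rule comm_ring_map_mpoly_eqI[OF comm_ring_map_mat_act])
  show "comm_ring_map (\<lambda>f. f)" by unfold_locales auto
  fix i :: 'n
  have "mat_act (mat 1) (var i) = (\<Sum>j\<in>UNIV. if i = j then var j else 0)"
    unfolding mat_act_var by (rule sum.cong) (auto simp: mat_def)
  then show "mat_act (mat 1) (var i) = var i" by simp
qed simp

lemma invertible_mat_act: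
  assumes "invertible g"
  obtains h where "invertible h" "\<And>f. mat_act g (mat_act h f) = f" "\<And>f. mat_act h (mat_act g f) = f"
proof -
  obtain h where "g ** h = mat 1" "h ** g = mat 1" using assms by (auto simp: invertible_def)
  then show ?thesis using that[of h] by (auto simp: mat_act_mat_act mat_act_mat_1 invertible_def)
qed

lemma surj_mat_act: "invertible g \<Longrightarrow> surj (mat_act g)"
  by (metis invertible_mat_act surjI)

lemma inj_mat_act: "invertible g \<Longrightarrow> inj (mat_act g)"
  by (metis invertible_mat_act injI)

section \<open>Homogeneous polynomials and homogeneous components\<close>

lemma homogeneous_zero [simp]: "homogeneous e 0"
  by (simp add: homogeneous_def)

lemma homogeneous_add: "homogeneous e f \<Longrightarrow> homogeneous e g \<Longrightarrow> homogeneous e (f + g)"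
  using keys_add[of f g] by (auto simp: homogeneous_def)

lemma homogeneous_sum: "(\<And>x. x \<in> A \<Longrightarrow> homogeneous e (f x)) \<Longrightarrow> homogeneous e (\<Sum>x\<in>A. f x)"
  by (induction A rule: infinite_finite_induct) (auto intro: homogeneous_add)

lemma homogeneous_mult:
  "homogeneous d f \<Longrightarrow> homogeneous e g \<Longrightarrow> homogeneous (d + e) (f * g)"
  using keys_mult[of f g] by (force simp: homogeneous_def)

lemma homogeneous_const: "homogeneous 0 (const c)"
  by (auto simp: homogeneous_def const_def split: if_splits)

lemma homogeneous_const_mult: "homogeneous e f \<Longrightarrow> homogeneous e (const c * f)"
  using homogeneous_mult[OF homogeneous_const] by force

lemma homogeneous_mon: "homogeneous (mdeg a) (mon a)"
  by (simp add: homogeneous_def)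

lemma homogeneous_var: "homogeneous 1 (var i)"
  by (simp add: homogeneous_def var_def)

lemma homogeneous_power: "homogeneous d f \<Longrightarrow> homogeneous (n * d) (f ^ n)"
  using homogeneous_const[of 1] by (induction n) (auto intro: homogeneous_mult)

lemma homogeneous_prod:
  "(\<And>x. x \<in> A \<Longrightarrow> homogeneous (d x) (f x)) \<Longrightarrow> homogeneous (\<Sum>x\<in>A. d x) (\<Prod>x\<in>A. f x)"
  using homogeneous_const[of 1]
  by (induction A rule: infinite_finite_induct) (auto intro: homogeneous_mult)

lemma homogeneous_mat_act_mon: "homogeneous (mdeg a) (mat_act g (mon a))"
proof -
  have "homogeneous (\<Sum>i\<in>UNIV. Poly_Mapping.lookup a i * 1)
      (\<Prod>i\<in>UNIV. (mat_act g (var i)) ^ Poly_Mapping.lookup a i)"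
    by (intro homogeneous_prod homogeneous_power)
      (auto simp: mat_act_var intro!: homogeneous_sum homogeneous_const_mult homogeneous_var[simplified])
  then show ?thesis
    by (simp add: mon_eq_prod mat_act.map_prod mat_act.map_power mdeg_def)
qed

lemma homogeneous_mat_act:
  assumes "homogeneous e f" shows "homogeneous e (mat_act g f)"
proof -
  have "mat_act g f = (\<Sum>a\<in>Poly_Mapping.keys f. const (Poly_Mapping.lookup f a) * mat_act g (mon a))"
    by (subst mpoly_eq_sum[of "Poly_Mapping.keys f" f])
      (auto simp: mat_act.map_sum mat_act.map_mult)
  then show ?thesis
    using assms homogeneous_mat_act_mon[of _ g]
    by (auto simp: homogeneous_def[of _ f] intro!: homogeneous_sum homogeneous_const_mult)
qed

definition hcomp :: "nat \<Rightarrow> ('k::comm_ring_1, 'n::finite) mpoly \<Rightarrow> ('k, 'n) mpoly" where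
  "hcomp e f =
    (\<Sum>a\<in>{a \<in> Poly_Mapping.keys f. mdeg a = e}. Poly_Mapping.single a (Poly_Mapping.lookup f a))"

lemma lookup_hcomp:
  "Poly_Mapping.lookup (hcomp e f) a = (if mdeg a = e then Poly_Mapping.lookup f a else 0)"
  by (auto simp: hcomp_def lookup_sum lookup_single when_def in_keys_iff)

lemma homogeneous_hcomp: "homogeneous e (hcomp e f)"
  by (auto simp: homogeneous_def in_keys_iff lookup_hcomp split: if_splits)

lemma hcomp_homogeneous: "homogeneous e f \<Longrightarrow> hcomp e f = f"
  by (rule poly_mapping_eqI) (auto simp: lookup_hcomp homogeneous_def in_keys_iff)

lemma hcomp_add: "hcomp e (f + g) = hcomp e f + hcomp e g"
  by (rule poly_mapping_eqI) (auto simp: lookup_hcomp lookup_add)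

lemma hcomp_sum: "hcomp e (\<Sum>x\<in>A. f x) = (\<Sum>x\<in>A. hcomp e (f x))"
  by (rule poly_mapping_eqI) (auto simp: lookup_hcomp lookup_sum)

lemma hcomp_mult:
  assumes "homogeneous d f"
  shows "hcomp e (f * h) = (if d \<le> e then f * hcomp (e - d) h else 0)"
proof (rule poly_mapping_eqI)
  fix a
  have "Poly_Mapping.lookup (f * h) a =
      (\<Sum>(b, c)\<in>{(b, c). b + c = a}.
        if d \<le> e then Poly_Mapping.lookup f b * Poly_Mapping.lookup (hcomp (e - d) h) c else 0)"
    if e: "mdeg a = e"
    unfolding lookup_mult_finite
  proof (rule sum.cong)
    fix x assume "x \<in> {(b, c). b + c = a}"
    then obtain b c where x: "x = (b, c)" "a = b + c" by auto
    show "(case x of (b, c) \<Rightarrow> Poly_Mapping.lookup f b * Poly_Mapping.lookup h c) =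
      (case x of (b, c) \<Rightarrow> if d \<le> e then
        Poly_Mapping.lookup f b * Poly_Mapping.lookup (hcomp (e - d) h) c else 0)"
    proof (cases "mdeg b = d")
      case True
      then show ?thesis using x e by (simp add: lookup_hcomp)
    next
      case False
      then have "Poly_Mapping.lookup f b = 0"
        using assms by (auto simp: homogeneous_def in_keys_iff)
      then show ?thesis using x by simp
    qed
  qed simp
  moreover have "Poly_Mapping.lookup (f * hcomp (e - d) h) a = 0" if "mdeg a \<noteq> e" "d \<le> e"
    using homogeneous_mult[OF assms homogeneous_hcomp[of "e - d" h]] that
    by (auto simp: homogeneous_def in_keys_iff)
  ultimately show "Poly_Mapping.lookup (hcomp e (f * h)) a =
      Poly_Mapping.lookup (if d \<le> e then f * hcomp (e - d) h else 0) a"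
    by (auto simp: lookup_hcomp lookup_mult_finite case_prod_beta split: if_splits)
qed

section \<open>Ideals and initial monomials\<close>

lemma module_times: "module ((*) :: 'a::comm_ring_1 \<Rightarrow> 'a \<Rightarrow> 'a)"
  by unfold_locales (auto simp: algebra_simps)

abbreviation is_ideal :: "'a::comm_ring_1 set \<Rightarrow> bool" where
  "is_ideal \<equiv> module.subspace (*)"

lemma is_idealI:
  "0 \<in> J \<Longrightarrow> (\<And>x y. x \<in> J \<Longrightarrow> y \<in> J \<Longrightarrow> x + y \<in> J) \<Longrightarrow> (\<And>c x. x \<in> J \<Longrightarrow> c * x \<in> J) \<Longrightarrow> is_ideal J"
  by (auto simp: module.subspace_def[OF module_times])

lemmas ideal_zero = module.subspace_0[OF module_times]
  and ideal_add = module.subspace_add[OF module_times]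
  and ideal_diff = module.subspace_diff[OF module_times]
  and ideal_mult_left = module.subspace_scale[OF module_times]
  and ideal_sum = module.subspace_sum[OF module_times]

lemma ideal_mult_right: "is_ideal J \<Longrightarrow> x \<in> J \<Longrightarrow> x * c \<in> J"
  by (metis ideal_mult_left mult.commute)

lemma is_ideal_ideal_gen: "is_ideal (ideal_gen S)"
  by (simp add: ideal_gen_def module.subspace_span[OF module_times])

lemma ideal_gen_base: "x \<in> S \<Longrightarrow> x \<in> ideal_gen S"
  by (simp add: ideal_gen_def module.span_base[OF module_times])

lemma ideal_gen_minimal: "S \<subseteq> J \<Longrightarrow> is_ideal J \<Longrightarrow> ideal_gen S \<subseteq> J"
  by (simp add: ideal_gen_def module.span_minimal[OF module_times])

lemma ideal_gen_mono: "S \<subseteq> T \<Longrightarrow> ideal_gen S \<subseteq> ideal_gen T"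
  by (simp add: ideal_gen_def module.span_mono[OF module_times])

lemma ideal_gen_finite_image:
  assumes "finite A"
  shows "ideal_gen (p ` A) = {\<Sum>j\<in>A. p j * q j | q. True}" (is "_ = ?R")
proof
  show "ideal_gen (p ` A) \<subseteq> ?R"
  proof (rule ideal_gen_minimal)
    show "p ` A \<subseteq> ?R"
    proof
      fix x assume "x \<in> p ` A"
      then obtain i where i: "i \<in> A" "x = p i" by auto
      have "(\<Sum>j\<in>A. p j * (if j = i then 1 else 0)) = x"
        using i assms by (simp add: sum.remove[of A i] if_distrib)
      then show "x \<in> ?R"
        unfolding mem_Collect_eq by (intro exI[of _ "\<lambda>j. if j = i then 1 else 0"]) simp
    qed
    show "is_ideal ?R"
    proof (rule is_idealI)
      show "0 \<in> ?R" by (auto intro!: exI[of _ "\<lambda>_. 0"])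
    next
      fix x y assume "x \<in> ?R" "y \<in> ?R"
      then obtain q r where "x = (\<Sum>j\<in>A. p j * q j)" "y = (\<Sum>j\<in>A. p j * r j)" by auto
      then have "x + y = (\<Sum>j\<in>A. p j * (q j + r j))" by (simp add: sum.distrib algebra_simps)
      then show "x + y \<in> ?R" by (auto intro!: exI[of _ "\<lambda>j. q j + r j"])
    next
      fix c x assume "x \<in> ?R"
      then obtain q where "x = (\<Sum>j\<in>A. p j * q j)" by auto
      then have "c * x = (\<Sum>j\<in>A. p j * (c * q j))" by (simp only: sum_distrib_left mult.left_commute)
      then show "c * x \<in> ?R" by (auto intro!: exI[of _ "\<lambda>j. c * q j"])
    qed
  qed
  show "?R \<subseteq> ideal_gen (p ` A)"
  proof clarify
    fix q
    show "(\<Sum>j\<in>A. p j * q j) \<in> ideal_gen (p ` A)"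
      by (intro ideal_sum[OF is_ideal_ideal_gen] ideal_mult_right[OF is_ideal_ideal_gen] ideal_gen_base imageI)
  qed
qed

lemma ideal_gen_insert:
  "ideal_gen (insert x S) = {y + x * z |y z. y \<in> ideal_gen S}" (is "_ = ?R")
proof -
  have "ideal_gen (insert x S) = {y. \<exists>k. y - k * x \<in> ideal_gen S}"
    by (simp add: ideal_gen_def module.span_insert[OF module_times])
  also have "\<dots> = ?R"
  proof (intro set_eqI iffI)
    fix y assume "y \<in> {y. \<exists>k. y - k * x \<in> ideal_gen S}"
    then obtain k where k: "y - k * x \<in> ideal_gen S" by auto
    have "y = (y - k * x) + x * k" by (simp add: mult.commute)
    with k show "y \<in> ?R" by blast
  next
    fix y assume "y \<in> ?R"
    then obtain u z where "u \<in> ideal_gen S" "y = u + x * z" by auto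
    then have "y - z * x \<in> ideal_gen S" by (simp add: mult.commute)
    then show "y \<in> {y. \<exists>k. y - k * x \<in> ideal_gen S}" by blast
  qed
  finally show ?thesis .
qed

section \<open>The vector space structure and polynomials with prescribed support\<close>

definition scl :: "'k::field \<Rightarrow> ('k, 'n) mpoly \<Rightarrow> ('k, 'n) mpoly" where
  "scl c f = const c * f"

interpretation mpoly_space: vector_space "scl :: 'k::field \<Rightarrow> ('k, 'n) mpoly \<Rightarrow> ('k, 'n) mpoly"
  by unfold_locales (auto simp: scl_def const_add const_mult distrib_left distrib_right mult.assoc)

lemma lookup_scl [simp]: "Poly_Mapping.lookup (scl c f) a = c * Poly_Mapping.lookup f a"
  by (simp add: scl_def)

lemma subspace_ideal: "is_ideal J \<Longrightarrow> mpoly_space.subspace J"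
  by (simp add: mpoly_space.subspace_def module.subspace_def[OF module_times] scl_def)

lemma mat_act_scl: "mat_act g (scl c f) = scl c (mat_act g f)"
  by (simp add: scl_def mat_act.map_mult)

definition polys_on :: "'n monom set \<Rightarrow> ('k::field, 'n) mpoly set" where
  "polys_on D = {f. Poly_Mapping.keys f \<subseteq> D}"

lemma subspace_polys_on: "mpoly_space.subspace (polys_on D :: ('k::field, 'n) mpoly set)"
proof -
  have "f + g \<in> polys_on D" if "f \<in> polys_on D" "g \<in> polys_on D" for f g :: "('k, 'n) mpoly"
    using that keys_add[of f g] by (auto simp: polys_on_def)
  then show ?thesis
    by (auto simp: mpoly_space.subspace_def polys_on_def scl_def dest: subsetD[OF keys_const_mult])
qed

lemma polys_on_subset_span: "(polys_on D :: ('k::field, 'n) mpoly set) \<subseteq> mpoly_space.span (mon ` D)"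
proof
  fix f :: "('k, 'n) mpoly" assume f: "f \<in> polys_on D"
  have "(\<Sum>a\<in>Poly_Mapping.keys f. scl (Poly_Mapping.lookup f a) (mon a)) \<in> mpoly_space.span (mon ` D)"
    using f by (intro mpoly_space.span_sum mpoly_space.span_scale mpoly_space.span_base)
      (auto simp: polys_on_def)
  then show "f \<in> mpoly_space.span (mon ` D)"
    using mpoly_eq_sum[OF finite_keys order_refl, of f] by (simp add: scl_def)
qed

lemma mon_inj: "(mon a :: ('k::comm_ring_1, 'n) mpoly) = mon b \<longleftrightarrow> a = b"
  by (metis keys_mon singleton_inject)

lemma lookup_sum_mon:
  assumes "finite D" "b \<in> D"
  shows "Poly_Mapping.lookup (\<Sum>a\<in>D. scl (c a) (mon a)) b = c b"
  using assms by (simp add: lookup_sum lookup_mon if_distrib cong: if_cong)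

lemma dim_polys_on:
  assumes "finite D"
  shows "mpoly_space.dim (polys_on D :: ('k::field, 'n) mpoly set) = card D"
proof -
  let ?m = "mon :: 'n monom \<Rightarrow> ('k, 'n) mpoly"
  have i: "independent_mod scl (mpoly_space.span {}) D ?m"
    unfolding independent_mod_def
  proof (intro allI impI ballI)
    fix c b assume "(\<Sum>a\<in>D. scl (c a) (?m a)) \<in> mpoly_space.span {}" and b: "b \<in> D"
    then have "(\<Sum>a\<in>D. scl (c a) (?m a)) = 0" by simp
    then show "c b = 0" using lookup_sum_mon[OF assms b, of c] by simp
  qed
  have "mpoly_space.independent (?m ` D)"
    using mpoly_space.independent_mod_Un(3)[OF _ _ assms i]
    by (simp add: mpoly_space.independent_empty)
  moreover have "?m ` D \<subseteq> polys_on D" by (auto simp: polys_on_def)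
  ultimately have "card (?m ` D) = mpoly_space.dim (polys_on D :: ('k, 'n) mpoly set)"
    by (intro mpoly_space.basis_card_eq_dim polys_on_subset_span)
  moreover have "card (?m ` D) = card D"
    by (intro card_image inj_onI) (simp add: mon_inj)
  ultimately show ?thesis by simp
qed

text \<open>Linear substitutions preserve degrees. Truncation by degree is therefore compatible with
  matrices, while a general support condition is not.\<close>

lemma mat_act_polys_on_le:
  assumes "f \<in> polys_on {a. mdeg a \<le> E}"
  shows "mat_act g f \<in> polys_on {a. mdeg a \<le> E}"
proof -
  have "mat_act g f =
      (\<Sum>a\<in>Poly_Mapping.keys f. scl (Poly_Mapping.lookup f a) (mat_act g (mon a)))"
    by (subst mpoly_eq_sum[of "Poly_Mapping.keys f" f])
      (auto simp: mat_act.map_sum mat_act.map_mult scl_def)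
  also have "\<dots> \<in> polys_on {a. mdeg a \<le> E}"
    using assms homogeneous_mat_act_mon[of _ g]
    by (intro mpoly_space.subspace_sum subspace_polys_on mpoly_space.subspace_scale)
      (force simp: polys_on_def homogeneous_def)
  finally show ?thesis .
qed

section \<open>The reverse lexicographic order and leading monomials\<close>

lemma revlex_gt_irrefl: "\<not> revlex_gt a a"
  by (simp add: revlex_gt_def)

lemma revlex_gt_trans: "revlex_gt a b \<Longrightarrow> revlex_gt b c \<Longrightarrow> revlex_gt a c"
proof -
  assume ab: "revlex_gt a b" and bc: "revlex_gt b c"
  show ?thesis
  proof (cases "mdeg a > mdeg b \<or> mdeg b > mdeg c")
    case True
    then show ?thesis using ab bc by (auto simp: revlex_gt_def)
  next
    case False
    then obtain k l where e: "mdeg a = mdeg b" "mdeg b = mdeg c"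
      and k: "\<forall>m>k. Poly_Mapping.lookup a m = Poly_Mapping.lookup b m"
        "Poly_Mapping.lookup a k < Poly_Mapping.lookup b k"
      and l: "\<forall>m>l. Poly_Mapping.lookup b m = Poly_Mapping.lookup c m"
        "Poly_Mapping.lookup b l < Poly_Mapping.lookup c l"
      using ab bc by (auto simp: revlex_gt_def)
    have "Poly_Mapping.lookup a (max k l) < Poly_Mapping.lookup c (max k l)"
      using k l by (cases k l rule: linorder_cases) (auto simp: max_def)
    then show ?thesis using e k l by (auto simp: revlex_gt_def intro!: exI[of _ "max k l"])
  qed
qed

lemma revlex_gt_total: "a \<noteq> b \<Longrightarrow> revlex_gt a b \<or> revlex_gt b a"
proof -
  assume ne: "a \<noteq> b"
  define D where "D = {k. Poly_Mapping.lookup a k \<noteq> Poly_Mapping.lookup b k}"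
  have "D \<noteq> {}" using ne poly_mapping_eqI[of a b] by (auto simp: D_def)
  then have "Max D \<in> D" "\<forall>m\<in>D. m \<le> Max D" by auto
  then obtain M where "M \<in> D" "\<forall>m>M. m \<notin> D" by (metis leD)
  then have "Poly_Mapping.lookup a M < Poly_Mapping.lookup b M \<or>
      Poly_Mapping.lookup b M < Poly_Mapping.lookup a M"
    "\<forall>m>M. Poly_Mapping.lookup a m = Poly_Mapping.lookup b m"
    by (auto simp: D_def)
  then show ?thesis
    unfolding revlex_gt_def by (metis linorder_less_linear)
qed

lemma revlex_gt_add: "revlex_gt (a + c) (b + c) \<longleftrightarrow> revlex_gt a b"
  by (simp add: revlex_gt_def lookup_add)

interpretation revlex: linorder "\<lambda>a b. a = b \<or> revlex_gt b a" "\<lambda>a b. revlex_gt b a"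
  by unfold_locales (use revlex_gt_irrefl revlex_gt_trans revlex_gt_total in blast)+

lemma mdeg_le_of_revlex_gt: "revlex_gt a b \<Longrightarrow> mdeg b \<le> mdeg a"
  by (auto simp: revlex_gt_def)

text \<open>The order compares degrees first, so only finitely many monomials lie below a given one.
  This makes reduction by leading monomials terminate.\<close>

lemma finite_revlex_lt: "finite {b. revlex_gt a b}"
  by (rule finite_subset[OF _ finite_mdeg_le[of "mdeg a"]]) (auto dest: mdeg_le_of_revlex_gt)

lemma lead_monom_eqI:
  assumes "a \<in> Poly_Mapping.keys f" "\<And>b. b \<in> Poly_Mapping.keys f \<Longrightarrow> b \<noteq> a \<Longrightarrow> revlex_gt a b"
  shows "lead_monom f = a"
  unfolding lead_monom_def
proof (rule the_equality)
  fix c assume "c \<in> Poly_Mapping.keys f \<and> (\<forall>b\<in>Poly_Mapping.keys f. b \<noteq> c \<longrightarrow> revlex_gt c b)"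
  then show "c = a" using assms revlex.less_asym by metis
qed (use assms in auto)

lemma lead_monom:
  assumes "f \<noteq> 0"
  shows "lead_monom f \<in> Poly_Mapping.keys f"
    and "b \<in> Poly_Mapping.keys f \<Longrightarrow> b \<noteq> lead_monom f \<Longrightarrow> revlex_gt (lead_monom f) b"
proof -
  have k: "finite (Poly_Mapping.keys f)" "Poly_Mapping.keys f \<noteq> {}"
    using assms poly_mapping_eqI[of f 0] by (auto simp: in_keys_iff)
  have "\<exists>a\<in>Poly_Mapping.keys f. \<forall>b\<in>Poly_Mapping.keys f. b = a \<or> revlex_gt a b"
    by (rule bexI[OF ballI revlex.Max_in[OF k]]) (rule revlex.Max_ge[OF k(1)])
  then obtain a where a: "a \<in> Poly_Mapping.keys f"
    "\<And>b. b \<in> Poly_Mapping.keys f \<Longrightarrow> b \<noteq> a \<Longrightarrow> revlex_gt a b" by blast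
  have "lead_monom f = a" by (rule lead_monom_eqI) (use a in auto)
  with a show "lead_monom f \<in> Poly_Mapping.keys f"
    "b \<in> Poly_Mapping.keys f \<Longrightarrow> b \<noteq> lead_monom f \<Longrightarrow> revlex_gt (lead_monom f) b" by auto
qed

text \<open>The product of the two leading monomials cannot cancel, since every other pair of
  monomials has a strictly smaller product. In particular the ring has no zero divisors.\<close>

lemma lead_monom_mult:
  fixes f g :: "('k::field, 'n::{finite,linorder}) mpoly"
  assumes "f \<noteq> 0" "g \<noteq> 0"
  shows "f * g \<noteq> 0" "lead_monom (f * g) = lead_monom f + lead_monom g"
proof -
  let ?a = "lead_monom f" and ?b = "lead_monom g"
  note f = lead_monom[OF assms(1)] and g = lead_monom[OF assms(2)]
  have gt: "revlex_gt (?a + ?b) (c + d)"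
    if "c \<in> Poly_Mapping.keys f" "d \<in> Poly_Mapping.keys g" "c \<noteq> ?a \<or> d \<noteq> ?b" for c d
  proof -
    have "c = ?a \<or> revlex_gt (?a + ?b) (c + ?b)"
      using f(2)[OF that(1)] by (auto simp: revlex_gt_add)
    moreover have "d = ?b \<or> revlex_gt (c + ?b) (c + d)"
      using g(2)[OF that(2)] revlex_gt_add[of ?b c d] by (auto simp: add.commute)
    ultimately show ?thesis using that(3) revlex_gt_trans by metis
  qed
  have "Poly_Mapping.lookup (f * g) (?a + ?b) =
      (\<Sum>(c, d)\<in>{(?a, ?b)}. Poly_Mapping.lookup f c * Poly_Mapping.lookup g d)"
    unfolding lookup_mult_finite
  proof (rule sum.mono_neutral_right)
    show "\<forall>i\<in>{(b, c). b + c = ?a + ?b} - {(?a, ?b)}.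
        (case i of (c, d) \<Rightarrow> Poly_Mapping.lookup f c * Poly_Mapping.lookup g d) = 0"
      using gt revlex_gt_irrefl by (fastforce simp: in_keys_iff)
  qed (auto simp: finite_splittings)
  then have k: "?a + ?b \<in> Poly_Mapping.keys (f * g)"
    using f(1) g(1) by (simp add: in_keys_iff)
  then show "f * g \<noteq> 0" by auto
  show "lead_monom (f * g) = ?a + ?b"
  proof (rule lead_monom_eqI[OF k])
    fix e assume "e \<in> Poly_Mapping.keys (f * g)" "e \<noteq> ?a + ?b"
    then show "revlex_gt (?a + ?b) e" using keys_mult[of f g] gt by blast
  qed
qed

definition lead_monoms :: "('k::field, 'n::{finite,linorder}) mpoly set \<Rightarrow> 'n monom set" where
  "lead_monoms J = lead_monom ` (J - {0})"

lemma lead_monomsI: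
  "f \<in> J \<Longrightarrow> a \<in> Poly_Mapping.keys f \<Longrightarrow>
    (\<And>b. b \<in> Poly_Mapping.keys f \<Longrightarrow> b \<noteq> a \<Longrightarrow> revlex_gt a b) \<Longrightarrow> a \<in> lead_monoms J"
  unfolding lead_monoms_def by (rule image_eqI[of _ _ f]) (auto simp: lead_monom_eqI)

lemma lead_monom_mon [simp]: "lead_monom (mon a :: ('k::field, 'n::{finite,linorder}) mpoly) = a"
  by (rule lead_monom_eqI) auto

lemma mon_nonzero [simp]: "(mon a :: ('k::field, 'n) mpoly) \<noteq> 0"
  by (metis keys_mon keys_zero insert_not_empty)

lemma mon_in_lead_monoms: "mon a \<in> J \<Longrightarrow> a \<in> lead_monoms J"
  unfolding lead_monoms_def by (rule image_eqI[of _ _ "mon a"]) auto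

lemma lead_monoms_mult:
  assumes "a \<in> lead_monoms J" "b \<in> lead_monoms L" "\<And>f g. f \<in> J \<Longrightarrow> g \<in> L \<Longrightarrow> f * g \<in> M"
  shows "a + b \<in> lead_monoms M"
proof -
  obtain f g where "f \<in> J" "f \<noteq> 0" "a = lead_monom f" "g \<in> L" "g \<noteq> 0" "b = lead_monom g"
    using assms(1,2) by (auto simp: lead_monoms_def)
  then show ?thesis
    unfolding lead_monoms_def using assms(3) lead_monom_mult[of f g]
    by (intro image_eqI[of _ _ "f * g"]) auto
qed

lemma lead_monoms_upward: "is_ideal J \<Longrightarrow> a \<in> lead_monoms J \<Longrightarrow> a + b \<in> lead_monoms J"
  by (rule lead_monoms_mult[of a J b UNIV]) (auto intro: mon_in_lead_monoms ideal_mult_right)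

text \<open>\<open>lead_monoms J\<close> is closed under adding exponents, so the polynomials
  supported in it form an ideal that contains all generators of the initial ideal.\<close>

lemma mon_in_initial_ideal:
  fixes J :: "('k::field, 'n::{finite,linorder}) mpoly set"
  assumes "is_ideal J"
  shows "mon a \<in> initial_ideal J \<longleftrightarrow> a \<in> lead_monoms J"
proof
  show "a \<in> lead_monoms J \<Longrightarrow> mon a \<in> initial_ideal J"
    unfolding initial_ideal_def by (rule ideal_gen_base) (auto simp: lead_monoms_def)
  have "initial_ideal J \<subseteq> {f. Poly_Mapping.keys f \<subseteq> lead_monoms J}"
    unfolding initial_ideal_def
  proof (rule ideal_gen_minimal)
    show "is_ideal {f::('k, 'n) mpoly. Poly_Mapping.keys f \<subseteq> lead_monoms J}"
    proof (rule is_idealI)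
      fix c x :: "('k, 'n) mpoly"
      show "x \<in> {f. Poly_Mapping.keys f \<subseteq> lead_monoms J} \<Longrightarrow> c * x \<in> {f. Poly_Mapping.keys f \<subseteq> lead_monoms J}"
      proof -
        assume x: "x \<in> {f. Poly_Mapping.keys f \<subseteq> lead_monoms J}"
        have "Poly_Mapping.keys (c * x) \<subseteq> lead_monoms J"
        proof
          fix e assume "e \<in> Poly_Mapping.keys (c * x)"
          then obtain a b where e: "e = a + b" "b \<in> Poly_Mapping.keys x" using keys_mult[of c x] by blast
          then have "b \<in> lead_monoms J" using x by auto
          from lead_monoms_upward[OF assms this, of a] show "e \<in> lead_monoms J"
            by (simp add: e(1) add.commute)
        qed
        then show ?thesis by simp
      qed
    next
      fix x y :: "('k, 'n) mpoly"
      assume "x \<in> {f. Poly_Mapping.keys f \<subseteq> lead_monoms J}"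
        "y \<in> {f. Poly_Mapping.keys f \<subseteq> lead_monoms J}"
      then show "x + y \<in> {f. Poly_Mapping.keys f \<subseteq> lead_monoms J}"
        using keys_add[of x y] by auto
    qed auto
  qed (auto simp: lead_monoms_def)
  then show "mon a \<in> initial_ideal J \<Longrightarrow> a \<in> lead_monoms J" by force
qed

lemma initial_ideal_eq: "initial_ideal J = ideal_gen (mon ` lead_monoms J)"
  unfolding initial_ideal_def lead_monoms_def by (rule arg_cong[of _ _ ideal_gen]) auto

text \<open>The point of such a set: a polynomial is supported in it as soon as its leading monomial
  belongs to it.\<close>

definition revlex_closed :: "'n::{finite,linorder} monom set \<Rightarrow> bool" where
  "revlex_closed D \<longleftrightarrow> (\<forall>a\<in>D. \<forall>b. revlex_gt a b \<longrightarrow> b \<in> D)"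

text \<open>Polynomials \<open>F a\<close> in \<open>J\<close>, one for each leading monomial
  \<open>a\<close> in \<open>D\<close>, form a basis of the space on the right: distinct leading
  monomials give independence, and reduction gives spanning.\<close>

lemma card_lead_monoms:
  fixes J :: "('k::field, 'n::{finite,linorder}) mpoly set"
  assumes "mpoly_space.subspace J" "finite D" "revlex_closed D"
  shows "card (lead_monoms J \<inter> D) = mpoly_space.dim (J \<inter> polys_on D)"
proof -
  let ?K = "lead_monoms J \<inter> D" and ?W = "J \<inter> polys_on D"
  have "\<forall>a\<in>?K. \<exists>f. f \<in> J \<and> f \<noteq> 0 \<and> lead_monom f = a"
    by (auto simp: lead_monoms_def)
  then obtain F where F: "\<And>a. a \<in> ?K \<Longrightarrow> F a \<in> J \<and> F a \<noteq> 0 \<and> lead_monom (F a) = a"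
    by metis
  have FW: "F ` ?K \<subseteq> ?W"
  proof
    fix f assume "f \<in> F ` ?K"
    then obtain a where a: "a \<in> ?K" "f = F a" by auto
    have "Poly_Mapping.keys f \<subseteq> D"
      using a lead_monom(2)[of f] F[OF a(1)] assms(3) unfolding revlex_closed_def by fastforce
    then show "f \<in> ?W" using F[OF a(1)] a(2) by (simp add: polys_on_def)
  qed
  have sW: "mpoly_space.subspace ?W"
    using assms(1) subspace_polys_on by (rule mpoly_space.subspace_inter)
  have z: "mpoly_space.subspace {0}" by (simp add: mpoly_space.subspace_single_0)
  have d0: "mpoly_space.dim {0::('k,'n) mpoly} = 0"
    using mpoly_space.dim_le_card[of "{0}" "{}"] by simp
  have Wspan: "?W \<subseteq> mpoly_space.span (mon ` D)" using polys_on_subset_span by blast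
  have fD: "finite (mon ` D)" "finite ?K" using assms(2) by auto
  have "mpoly_space.dim {0::('k,'n) mpoly} + card ?K \<le> mpoly_space.dim ?W"
  proof (rule mpoly_space.dim_add_card_le[OF z _ Wspan fD FW])
    show "{0} \<subseteq> ?W" using sW mpoly_space.subspace_0 by blast
    show "independent_mod scl {0} ?K F"
      unfolding independent_mod_def
    proof (intro allI impI, rule ccontr)
      fix c assume s: "(\<Sum>a\<in>?K. scl (c a) (F a)) \<in> {0}" and "\<not> (\<forall>a\<in>?K. c a = 0)"
      then have C: "finite {a\<in>?K. c a \<noteq> 0}" "{a\<in>?K. c a \<noteq> 0} \<noteq> {}"
        using finite_subset[OF _ fD(2), of "{a\<in>?K. c a \<noteq> 0}"] by auto
      \<comment> \<open>Among the terms with nonzero coefficient, the largest index \<open>m\<close>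
        occurs as a monomial of \<open>F m\<close> only, the others having smaller leading
        monomials.\<close>
      define m where "m = revlex.Max {a\<in>?K. c a \<noteq> 0}"
      have m: "m \<in> ?K" "c m \<noteq> 0" using revlex.Max_in[OF C] by (auto simp: m_def)
      have "c a * Poly_Mapping.lookup (F a) m = 0" if "a \<in> ?K - {m}" for a
      proof (cases "c a = 0")
        case False
        then have "a = m \<or> revlex_gt m a"
          using revlex.Max_ge[OF C(1), of a] that by (auto simp: m_def)
        then have "revlex_gt m a" using that by auto
        then have "\<not> revlex_gt a m" "m \<noteq> a" using revlex.less_asym revlex_gt_irrefl by blast+
        then have "m \<notin> Poly_Mapping.keys (F a)"
          using lead_monom(2)[of "F a" m] F[of a] that by auto
        then show ?thesis by (simp add: in_keys_iff)
      qed simp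
      then have "(\<Sum>a\<in>?K - {m}. c a * Poly_Mapping.lookup (F a) m) = 0"
        by (intro sum.neutral) blast
      then have "Poly_Mapping.lookup (\<Sum>a\<in>?K. scl (c a) (F a)) m = c m * Poly_Mapping.lookup (F m) m"
        unfolding lookup_sum lookup_scl using m(1) fD(2) by (simp add: sum.remove[of _ m])
      also have "\<dots> \<noteq> 0" using m lead_monom(1)[of "F m"] F[OF m(1)] by (simp add: in_keys_iff)
      finally show False using s by simp
    qed
  qed
  moreover have "mpoly_space.dim ?W \<le> mpoly_space.dim {0::('k,'n) mpoly} + card ?K"
  proof (rule mpoly_space.dim_le_add_card[OF z _ _ fD(2), of "{}" _ F])
    show "?W \<subseteq> mpoly_space.span ({0} \<union> F ` ?K)"
    proof
      fix f assume "f \<in> ?W"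
      then show "f \<in> mpoly_space.span ({0} \<union> F ` ?K)"
      \<comment> \<open>Subtracting a multiple of some \<open>F a\<close> lowers the leading
        monomial; the measure counts the monomials below it and reserves the value 0 for the zero
        polynomial.\<close>
      proof (induction "if f = 0 then 0 else Suc (card {b. revlex_gt (lead_monom f) b})"
          arbitrary: f rule: less_induct)
        case less
        show ?case
        proof (cases "f = 0")
          case False
          define a where "a = lead_monom f"
          note lf = lead_monom[OF False, folded a_def]
          have a: "a \<in> ?K" using less.prems False lf(1) by (auto simp: a_def lead_monoms_def polys_on_def)
          note Fa = F[OF a] and lF = lead_monom[of "F a"]
          define h where "h = f - scl (Poly_Mapping.lookup f a / Poly_Mapping.lookup (F a) a) (F a)"
          have hW: "h \<in> ?W" unfolding h_def
            using less.prems FW a by (intro mpoly_space.subspace_diff[OF sW] mpoly_space.subspace_scale[OF sW]) auto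
          have "Poly_Mapping.lookup (F a) a \<noteq> 0" using Fa lF(1) by (simp add: in_keys_iff)
          then have ha: "a \<notin> Poly_Mapping.keys h" by (simp add: h_def in_keys_iff lookup_minus)
          have hk: "revlex_gt a b" if "b \<in> Poly_Mapping.keys h" for b
          proof -
            have "b \<in> Poly_Mapping.keys f \<or> b \<in> Poly_Mapping.keys (F a)" "b \<noteq> a"
              using that ha by (auto simp: h_def in_keys_iff lookup_minus)
            then show ?thesis using lf(2) lF(2) Fa by auto
          qed
          have "h \<in> mpoly_space.span ({0} \<union> F ` ?K)"
          proof (rule less.hyps[OF _ hW])
            show "(if h = 0 then 0 else Suc (card {b. revlex_gt (lead_monom h) b})) <
                (if f = 0 then 0 else Suc (card {b. revlex_gt (lead_monom f) b}))"
            proof (cases "h = 0")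
              case h0: False
              have g: "revlex_gt a (lead_monom h)" using hk lead_monom(1)[OF h0] by blast
              have "{b. revlex_gt (lead_monom h) b} \<subset> {b. revlex_gt a b}"
                using g revlex_gt_trans revlex_gt_irrefl by blast
              then show ?thesis
                using False h0 psubset_card_mono[OF finite_revlex_lt] by (simp add: a_def)
            qed (use False in simp)
          qed
          moreover have "f = h + scl (Poly_Mapping.lookup f a / Poly_Mapping.lookup (F a) a) (F a)"
            by (simp add: h_def)
          ultimately show ?thesis
            using a by (metis mpoly_space.span_add mpoly_space.span_scale mpoly_space.span_base UnI2 imageI)
        qed (simp add: mpoly_space.span_zero)
      qed
    qed
  qed auto
  ultimately show ?thesis using d0 by simp
qed

section \<open>Powers of ideals and the Hilbert function of a regular sequence\<close>

lemma mult_scl: "f * scl c x = scl c (f * x)"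
  by (simp add: scl_def mult.left_commute)

lemma is_ideal_power: "is_ideal (ideal_power I n)"
  by (cases n) (auto simp: ideal_mult_def is_ideal_ideal_gen intro: is_idealI)

lemma ideal_power_Suc_subset: "ideal_power I (Suc n) \<subseteq> ideal_power I n"
  by (simp add: ideal_mult_def) (rule ideal_gen_minimal, auto intro: ideal_mult_left is_ideal_power)

lemma ideal_power_antimono: "m \<le> n \<Longrightarrow> ideal_power I n \<subseteq> ideal_power I m"
  by (rule lift_Suc_antimono_le[of "ideal_power I"]) (rule ideal_power_Suc_subset)

lemma ideal_gen_mult_subset:
  assumes "\<And>x. x \<in> S \<Longrightarrow> x * y \<in> M" "is_ideal M" "x \<in> ideal_gen S"
  shows "x * y \<in> M"
proof -
  have "ideal_gen S \<subseteq> {x. x * y \<in> M}"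
    by (rule ideal_gen_minimal, use assms in blast, rule is_idealI)
      (use assms(2) in \<open>auto simp: distrib_right mult.assoc intro: ideal_zero ideal_add ideal_mult_left\<close>)
  then show ?thesis using assms(3) by blast
qed

lemma ideal_power_mult:
  assumes "x \<in> ideal_power I m" "y \<in> ideal_power I n"
  shows "x * y \<in> ideal_power I (m + n)"
  using assms(1)
proof (induction m arbitrary: x)
  case 0
  then show ?case using assms(2) by (simp add: ideal_mult_left is_ideal_power)
next
  case (Suc m)
  have "x \<in> ideal_gen {u * v |u v. u \<in> I \<and> v \<in> ideal_power I m}"
    using Suc.prems by (simp add: ideal_mult_def)
  then show ?case
  proof (rule ideal_gen_mult_subset[OF _ is_ideal_power, rotated])
    fix w assume "w \<in> {u * v |u v. u \<in> I \<and> v \<in> ideal_power I m}"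
    then obtain u v where "u \<in> I" "v \<in> ideal_power I m" "w = u * v" by auto
    then show "w * y \<in> ideal_power I (Suc m + n)"
      using Suc.IH[of v] by (auto simp: ideal_mult_def mult.assoc intro!: ideal_gen_base)
  qed
qed

text \<open>Take components of degree \<open>e\<close> in any representation of \<open>x\<close>.
  The clause for \<open>e < d j\<close> matters because \<open>e - d j\<close> is then truncated to
  0, and homogeneity alone would still allow a nonzero constant.\<close>

lemma homogeneous_split:
  fixes p :: "'i \<Rightarrow> ('k::field, 'n::finite) mpoly"
  assumes "finite A" "\<And>j. j \<in> A \<Longrightarrow> homogeneous (d j) (p j)" "x \<in> ideal_gen (p ` A)"
  obtains q where "hcomp e x = (\<Sum>j\<in>A. p j * q j)" "\<And>j. homogeneous (e - d j) (q j)"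
    "\<And>j. e < d j \<Longrightarrow> q j = 0"
proof -
  obtain r where r: "x = (\<Sum>j\<in>A. p j * r j)"
    using assms(3) unfolding ideal_gen_finite_image[OF assms(1)] by auto
  define q where "q = (\<lambda>j. if d j \<le> e then hcomp (e - d j) (r j) else 0)"
  have "hcomp e x = (\<Sum>j\<in>A. p j * q j)"
    unfolding r hcomp_sum by (rule sum.cong) (auto simp: hcomp_mult[OF assms(2)] q_def)
  then show ?thesis by (rule that) (auto simp: q_def homogeneous_hcomp)
qed

lemma hcomp_in_ideal_gen:
  fixes p :: "'i \<Rightarrow> ('k::field, 'n::finite) mpoly"
  assumes "finite A" "\<And>j. j \<in> A \<Longrightarrow> homogeneous (d j) (p j)" "x \<in> ideal_gen (p ` A)"
  shows "hcomp e x \<in> ideal_gen (p ` A)"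
proof -
  obtain q where "hcomp e x = (\<Sum>j\<in>A. p j * q j)"
    using homogeneous_split[OF assms] by metis
  then show ?thesis unfolding ideal_gen_finite_image[OF assms(1)] by blast
qed

text \<open>Over a finite index type every function has finite support, so this is a total inverse
  of \<open>lookup\<close>.\<close>

definition monom_of :: "('n::finite \<Rightarrow> nat) \<Rightarrow> 'n monom" where
  "monom_of = Poly_Mapping.Abs_poly_mapping"

lemma lookup_monom_of [simp]: "Poly_Mapping.lookup (monom_of h) = h"
  by (simp add: monom_of_def)

abbreviation forms :: "nat \<Rightarrow> ('k::field, 'n::finite) mpoly set" where
  "forms e \<equiv> polys_on {a. mdeg a = e}"

lemma in_forms: "f \<in> forms e \<longleftrightarrow> homogeneous e f"
  by (auto simp: polys_on_def homogeneous_def)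

text \<open>Indexing the forms by the type of the variables encodes that there are as many forms as
  variables.\<close>

locale homogeneous_regular_sequence =
  fixes f :: "'n::{finite,linorder} \<Rightarrow> ('k::field_char_0, 'n) mpoly" and d :: "'n \<Rightarrow> nat"
  assumes regular: "regular_sequence f" and homog: "\<And>i. homogeneous (d i) (f i)"
begin

text \<open>A form of degree 0 is a constant. A nonzero constant generates the unit ideal; if the
  constant is 0, regularity puts 1 into the ideal of its predecessors.\<close>

lemma degree_pos: "0 < d i"
proof (rule ccontr)
  assume "\<not> 0 < d i"
  then have "Poly_Mapping.keys (f i) \<subseteq> {0}"
    using homog[of i] by (auto simp: homogeneous_def mdeg_def intro!: poly_mapping_eqI)
  then have c: "f i = const (Poly_Mapping.lookup (f i) 0)" (is "_ = const ?c")
    by (intro poly_mapping_eqI) (auto simp: const_def lookup_single when_def in_keys_iff)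
  have "1 \<in> ideal_gen (range f)"
  proof (cases "?c = 0")
    case True
    then have "f i * 1 \<in> ideal_gen (f ` {..<i})"
      using c by (simp add: ideal_zero is_ideal_ideal_gen)
    then have "1 \<in> ideal_gen (f ` {..<i})" using regular by (auto simp: regular_sequence_def)
    then show ?thesis using ideal_gen_mono[of "f ` {..<i}" "range f"] by auto
  next
    case False
    then have "const (1 / ?c) * f i = 1"
      by (subst c) (simp flip: const_mult)
    moreover have "const (1 / ?c) * f i \<in> ideal_gen (range f)"
      by (intro ideal_mult_left is_ideal_ideal_gen ideal_gen_base) auto
    ultimately show ?thesis by simp
  qed
  then show False
    using regular ideal_mult_right[OF is_ideal_ideal_gen, of 1 "range f"]
    by (auto simp: regular_sequence_def)
qed

text \<open>The combinatorial counterpart of the recursion for Hilbert functions when a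
  nonzerodivisor of degree \<open>d b\<close> is factored out: the exponents with entry at least
  \<open>d b\<close> at \<open>b\<close> are shifts of exponents of degree
  \<open>e - d b\<close>.\<close>

lemma card_monoms_insert:
  assumes "b \<notin> A" "d b \<le> e"
  shows "card {a. mdeg a = e \<and> (\<forall>j\<in>A. Poly_Mapping.lookup a j < d j)} =
    card {a. mdeg a = e \<and> (\<forall>j\<in>insert b A. Poly_Mapping.lookup a j < d j)} +
    card {a. mdeg a = e - d b \<and> (\<forall>j\<in>A. Poly_Mapping.lookup a j < d j)}" (is "card ?S = card ?T + card ?R")
proof -
  let ?s = "\<lambda>a. a + Poly_Mapping.single b (d b)"
  have "?S = ?T \<union> ?s ` ?R"
  proof (intro equalityI subsetI)
    fix a assume a: "a \<in> ?S"
    show "a \<in> ?T \<union> ?s ` ?R"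
    proof (cases "Poly_Mapping.lookup a b < d b")
      case False
      define c where "c = a - Poly_Mapping.single b (d b)"
      have ac: "a = ?s c"
        by (rule poly_mapping_eqI) (use False in \<open>auto simp: c_def lookup_add lookup_minus lookup_single when_def\<close>)
      have "mdeg c = e - d b" using a arg_cong[OF ac, of mdeg] by auto
      moreover have "\<forall>j\<in>A. Poly_Mapping.lookup c j < d j"
        using a assms(1) by (auto simp: c_def lookup_minus lookup_single when_def)
      ultimately show ?thesis using ac by blast
    qed (use a in auto)
  next
    fix a assume "a \<in> ?T \<union> ?s ` ?R"
    then show "a \<in> ?S"
    proof
      assume "a \<in> ?s ` ?R"
      then obtain c where c: "c \<in> ?R" "a = ?s c" by blast
      have "Poly_Mapping.lookup a j = Poly_Mapping.lookup c j" if "j \<in> A" for j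
        using that assms(1) c(2) by (auto simp: lookup_add lookup_single when_def)
      then show "a \<in> ?S" using c assms(2) by simp
    qed simp
  qed
  moreover have "?T \<inter> ?s ` ?R = {}"
  proof -
    have "\<not> Poly_Mapping.lookup (?s c) b < d b" for c by (simp add: lookup_add)
    then show ?thesis by blast
  qed
  moreover have "finite ?T"
    by (rule finite_subset[OF _ finite_mdeg_eq[of e]]) blast
  moreover have "finite ?R"
    by (rule finite_subset[OF _ finite_mdeg_eq[of "e - d b"]]) blast
  moreover have "card (?s ` ?R) = card ?R"
    by (rule card_image) (simp add: inj_on_def)
  ultimately show ?thesis by (simp add: card_Un_disjoint)
qed

text \<open>Multiplication by \<open>f b\<close> is injective modulo the ideal of the predecessors
  and raises degrees by \<open>d b\<close>. Since \<open>A\<close> is an initial segment, its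
  complement up to the newest index is empty and regularity applies. The additive form avoids
  quotients and subtraction.\<close>

lemma hilbert_function:
  assumes "\<And>i j. i \<in> A \<Longrightarrow> j < i \<Longrightarrow> j \<in> A"
  shows "mpoly_space.dim (ideal_gen (f ` A) \<inter> forms e) +
      card {a. mdeg a = e \<and> (\<forall>j\<in>A. Poly_Mapping.lookup a j < d j)} =
    card {a::'n monom. mdeg a = e}"
  using finite[of A] assms
proof (induction A arbitrary: e rule: finite_linorder_max_induct)
  case empty
  have "ideal_gen (f ` {}) = {0}"
    by (simp add: ideal_gen_def module.span_empty[OF module_times])
  then have "ideal_gen (f ` {}) \<inter> forms e \<subseteq> mpoly_space.span {}" by auto
  then have "mpoly_space.dim (ideal_gen (f ` {}) \<inter> forms e) = 0"
    using mpoly_space.dim_le_card[OF _ finite.emptyI, of "ideal_gen (f ` {}) \<inter> forms e"] by simp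
  then show ?case by simp
next
  case (insert b A)
  have A: "A = {..<b}" using insert.hyps insert.prems by auto
  then have lower: "\<And>i j. i \<in> A \<Longrightarrow> j < i \<Longrightarrow> j \<in> A" by auto
  have IH: "mpoly_space.dim (ideal_gen (f ` A) \<inter> forms e) +
      card {a. mdeg a = e \<and> (\<forall>j\<in>A. Poly_Mapping.lookup a j < d j)} =
    card {a::'n monom. mdeg a = e}" for e
    by (rule insert.IH) (rule lower)
  define J where "J = ideal_gen (f ` A)"
  define J' where "J' = ideal_gen (f ` insert b A)"
  have J: "is_ideal J" "is_ideal J'" by (simp_all add: J_def J'_def is_ideal_ideal_gen)
  have J'_eq: "J' = {y + f b * z |y z. y \<in> J}"
    by (simp add: J_def J'_def ideal_gen_insert)
  have JJ': "J \<subseteq> J'" unfolding J_def J'_def by (rule ideal_gen_mono) auto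
  have hJ: "hcomp e y \<in> J" if "y \<in> J" for e y
    using that hcomp_in_ideal_gen[of A d f y e, OF _ homog] by (auto simp: J_def)
  have split: "\<exists>y z. y \<in> J \<inter> forms e \<and> x = y + (if d b \<le> e then f b * hcomp (e - d b) z else 0)"
    if x: "x \<in> J' \<inter> forms e" for x
  proof -
    obtain y z where yz: "y \<in> J" "x = y + f b * z"
      using x unfolding J'_eq by blast
    have "x = hcomp e x" using x by (simp add: in_forms hcomp_homogeneous)
    also have "\<dots> = hcomp e y + (if d b \<le> e then f b * hcomp (e - d b) z else 0)"
      unfolding yz(2) by (simp add: hcomp_add hcomp_mult[OF homog])
    finally show ?thesis
      using hJ[OF yz(1), of e] homogeneous_hcomp[of e y] by (auto simp: in_forms)
  qed
  show ?case
  proof (cases "d b \<le> e")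
    case False
    \<comment> \<open>Below degree \<open>d b\<close> the new generator contributes nothing, and the
      new bound on the exponent at \<open>b\<close> holds automatically.\<close>
    have "J' \<inter> forms e = J \<inter> forms e" using split False JJ' by fastforce
    moreover have "{a. mdeg a = e \<and> (\<forall>j\<in>insert b A. Poly_Mapping.lookup a j < d j)} =
        {a. mdeg a = e \<and> (\<forall>j\<in>A. Poly_Mapping.lookup a j < d j)}"
      using False by (auto intro: le_less_trans[OF lookup_le_mdeg])
    ultimately show ?thesis using IH[of e] by (simp add: J_def J'_def)
  next
    case True
    let ?U = "J \<inter> forms e" and ?U1 = "J \<inter> forms (e - d b)"
    have sub: "mpoly_space.subspace ?U" "mpoly_space.subspace ?U1"
      by (simp_all add: mpoly_space.subspace_inter subspace_ideal J subspace_polys_on)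
    have fin: "finite (mon ` {a::'n monom. mdeg a = e'} :: ('k, 'n) mpoly set)" for e'
      by (simp add: finite_mdeg_eq)
    \<comment> \<open>\<open>K\<close> represents the quotient by \<open>J\<close> in degree
      \<open>e - d b\<close>; its multiples by \<open>f b\<close> turn out to span the new ideal
      modulo the old one in degree \<open>e\<close>.\<close>
    obtain K where K: "finite K" "K \<subseteq> forms (e - d b)" "independent_mod scl ?U1 K (\<lambda>k. k)"
      "forms (e - d b) = mpoly_space.span (?U1 \<union> K)"
      "mpoly_space.dim (forms (e - d b) :: ('k, 'n) mpoly set) = mpoly_space.dim ?U1 + card K"
      by (rule mpoly_space.complement_exists[OF sub(2) subspace_polys_on _ polys_on_subset_span fin]) auto
    have wK: "(*) (f b) ` K \<subseteq> J' \<inter> forms e"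
    proof
      fix x assume "x \<in> (*) (f b) ` K"
      then obtain k where k: "k \<in> K" "x = f b * k" by auto
      have "homogeneous (d b + (e - d b)) x"
        unfolding k(2) using k(1) K(2) by (intro homogeneous_mult homog) (auto simp: in_forms)
      moreover have "x \<in> J'"
        unfolding J'_def k(2) by (intro ideal_mult_right is_ideal_ideal_gen ideal_gen_base) simp
      ultimately show "x \<in> J' \<inter> forms e" using True by (simp add: in_forms)
    qed
    have "mpoly_space.dim ?U + card K \<le> mpoly_space.dim (J' \<inter> forms e)"
    proof (rule mpoly_space.dim_add_card_le[OF sub(1) _ _ fin K(1) wK])
      show "?U \<subseteq> J' \<inter> forms e" using JJ' by auto
      show "J' \<inter> forms e \<subseteq> mpoly_space.span (mon ` {a. mdeg a = e})"
        using polys_on_subset_span by blast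
      \<comment> \<open>This is where regularity is used: \<open>f b\<close> can be cancelled modulo
        \<open>J\<close>.\<close>
      show "independent_mod scl ?U K ((*) (f b))"
        unfolding independent_mod_def
      proof (intro allI impI)
        fix c assume "(\<Sum>k\<in>K. scl (c k) (f b * k)) \<in> ?U"
        moreover have "(\<Sum>k\<in>K. scl (c k) (f b * k)) = f b * (\<Sum>k\<in>K. scl (c k) k)"
          by (simp add: scl_def sum_distrib_left mult.left_commute)
        ultimately have "(\<Sum>k\<in>K. scl (c k) k) \<in> J"
          using regular by (simp add: regular_sequence_def J_def A)
        moreover have "(\<Sum>k\<in>K. scl (c k) k) \<in> forms (e - d b)"
          using K(2) by (intro mpoly_space.subspace_sum subspace_polys_on mpoly_space.subspace_scale) auto
        ultimately show "\<forall>k\<in>K. c k = 0" using K(3) by (auto simp: independent_mod_def)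
      qed
    qed
    moreover have "mpoly_space.dim (J' \<inter> forms e) \<le> mpoly_space.dim ?U + card K"
    proof (rule mpoly_space.dim_le_add_card[OF sub(1) _ fin K(1)])
      show "?U \<subseteq> mpoly_space.span (mon ` {a. mdeg a = e})" using polys_on_subset_span by blast
      let ?S = "mpoly_space.span (?U \<union> (*) (f b) ` K)"
      have "mpoly_space.span (?U1 \<union> K) \<subseteq> {z. f b * z \<in> ?S}"
      proof (rule mpoly_space.span_minimal)
        show "mpoly_space.subspace {z. f b * z \<in> ?S}"
          by (auto simp: mpoly_space.subspace_def distrib_left mult_scl
            intro: mpoly_space.span_zero mpoly_space.span_add mpoly_space.span_scale)
        show "?U1 \<union> K \<subseteq> {z. f b * z \<in> ?S}"
        proof
          fix z assume "z \<in> ?U1 \<union> K"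
          then show "z \<in> {z. f b * z \<in> ?S}"
          proof
            assume z: "z \<in> ?U1"
            have "homogeneous (d b + (e - d b)) (f b * z)"
              using z by (intro homogeneous_mult homog) (auto simp: in_forms)
            then have "f b * z \<in> ?U" using z True J by (auto simp: in_forms ideal_mult_left)
            then show ?thesis by (auto intro: mpoly_space.span_base)
          qed (auto intro: mpoly_space.span_base)
        qed
      qed
      then have m: "f b * z \<in> ?S" if "z \<in> forms (e - d b)" for z using that K(4) by blast
      show "J' \<inter> forms e \<subseteq> ?S"
      proof
        fix x assume "x \<in> J' \<inter> forms e"
        then obtain y z where "y \<in> ?U" "x = y + f b * hcomp (e - d b) z"
          using split True by force
        moreover have "f b * hcomp (e - d b) z \<in> ?S" by (rule m) (simp add: in_forms homogeneous_hcomp)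
        ultimately show "x \<in> ?S" by (simp add: mpoly_space.span_add mpoly_space.span_base)
      qed
    qed
    ultimately have "mpoly_space.dim (J' \<inter> forms e) = mpoly_space.dim ?U + card K" by simp
    moreover have "card {a::'n monom. mdeg a = e - d b} = mpoly_space.dim ?U1 + card K"
      using K(5) by (simp add: dim_polys_on finite_mdeg_eq)
    moreover have "b \<notin> A" using insert.hyps by auto
    ultimately show ?thesis
      using IH[of e] IH[of "e - d b"] card_monoms_insert[of b A e] True by (simp add: J_def J'_def)
  qed
qed

end

section \<open>The filtration by powers of a complete intersection\<close>

lemma is_ideal_mat_act_image:
  assumes "invertible g" "is_ideal J"
  shows "is_ideal (mat_act g ` J)"
proof (rule is_idealI)
  show "0 \<in> mat_act g ` J"
    using ideal_zero[OF assms(2)] mat_act.map_zero[of g] by (metis imageI)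
next
  fix x y assume "x \<in> mat_act g ` J" "y \<in> mat_act g ` J"
  then show "x + y \<in> mat_act g ` J"
    using ideal_add[OF assms(2)] by (auto simp flip: mat_act.map_add)
next
  fix c x assume "x \<in> mat_act g ` J"
  moreover obtain c' where "c = mat_act g c'" using surj_mat_act[OF assms(1)] by (metis surjD)
  ultimately show "c * x \<in> mat_act g ` J"
    using ideal_mult_left[OF assms(2)] by (auto simp flip: mat_act.map_mult)
qed

text \<open>The inverse matrix does not raise degrees either.\<close>

lemma mat_act_image_inter_polys_on_le:
  assumes "invertible g"
  shows "mat_act g ` J \<inter> polys_on {a. mdeg a \<le> E} = mat_act g ` (J \<inter> polys_on {a. mdeg a \<le> E})"
proof -
  obtain h where h: "\<And>f. mat_act h (mat_act g f) = f"
    using invertible_mat_act[OF assms] by metis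
  show ?thesis
  proof (intro equalityI subsetI)
    fix x assume "x \<in> mat_act g ` J \<inter> polys_on {a. mdeg a \<le> E}"
    then obtain y where y: "y \<in> J" "x = mat_act g y" "x \<in> polys_on {a. mdeg a \<le> E}" by auto
    then have "y \<in> polys_on {a. mdeg a \<le> E}" using mat_act_polys_on_le[OF y(3), of h] h by simp
    then show "x \<in> mat_act g ` (J \<inter> polys_on {a. mdeg a \<le> E})" using y by auto
  qed (auto intro: mat_act_polys_on_le)
qed

lemma revlex_closed_mdeg_le: "revlex_closed {a. mdeg a \<le> E}"
  by (auto simp: revlex_closed_def dest: mdeg_le_of_revlex_gt)

lemma mat_act_span: "mat_act g ` mpoly_space.span S = mpoly_space.span (mat_act g ` S)"
proof -
  have "module_hom scl scl (mat_act g)"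
    by unfold_locales (auto simp: mat_act.map_add mat_act_scl)
  then show ?thesis by (rule module_hom.span_image[symmetric])
qed

context homogeneous_regular_sequence
begin

abbreviation I where "I \<equiv> ideal_gen (range f)"

text \<open>By \<open>hilbert_function\<close> the quotient by \<open>I\<close> vanishes in these
  degrees, as an exponent with all entries below \<open>d j\<close> cannot be that large. Thus
  \<open>I\<close> is primary to the maximal ideal.\<close>

lemma forms_subset_ideal:
  assumes "(\<Sum>j\<in>UNIV. d j) < e"
  shows "forms e \<subseteq> I"
proof -
  have "\<not> (\<forall>j. Poly_Mapping.lookup a j < d j)" if "mdeg a = e" for a :: "'n monom"
  proof
    assume "\<forall>j. Poly_Mapping.lookup a j < d j"
    then have "mdeg a \<le> (\<Sum>j\<in>UNIV. d j)" unfolding mdeg_def by (intro sum_mono) (simp add: less_imp_le)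
    then show False using assms that by simp
  qed
  then have z: "card {a::'n monom. mdeg a = e \<and> (\<forall>j\<in>UNIV. Poly_Mapping.lookup a j < d j)} = 0"
    by (intro card_eq_0_iff[THEN iffD2] disjI1) blast
  have fin: "finite (mon ` {a::'n monom. mdeg a = e} :: ('k, 'n) mpoly set)"
    by (simp add: finite_mdeg_eq)
  have sub: "mpoly_space.subspace (I \<inter> forms e)"
    by (simp add: mpoly_space.subspace_inter subspace_ideal is_ideal_ideal_gen subspace_polys_on)
  obtain K where K: "finite K" "forms e = mpoly_space.span (I \<inter> forms e \<union> K)"
    "mpoly_space.dim (forms e :: ('k, 'n) mpoly set) = mpoly_space.dim (I \<inter> forms e) + card K"
    by (rule mpoly_space.complement_exists[OF sub subspace_polys_on _ polys_on_subset_span fin]) auto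
  have "card K = 0"
    using K(3)[unfolded dim_polys_on[OF finite_mdeg_eq]] z hilbert_function[of UNIV e, OF UNIV_I]
    by linarith
  then have "K = {}" using K(1) by simp
  then have "forms e = mpoly_space.span (I \<inter> forms e)" using K(2) by simp
  also have "\<dots> = I \<inter> forms e" by (rule mpoly_space.span_eq_iff[THEN iffD2, OF sub])
  finally show ?thesis by blast
qed

text \<open>The monomial basis in degree \<open>e\<close> of the quotient by the powers
  \<open>x_j^(d j)\<close>, which has the same Hilbert function as the quotient by
  \<open>I\<close>.\<close>

definition residues :: "nat \<Rightarrow> 'n monom set" where
  "residues e = {a. mdeg a = e \<and> (\<forall>j. Poly_Mapping.lookup a j < d j)}"

text \<open>By \<open>hilbert_function\<close> a complement of \<open>I\<close> in degree
  \<open>e\<close> has as many basis elements as there are residues of that degree, so any bijection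
  serves as labelling.\<close>

lemma residue_basis_exists:
  "\<exists>\<beta>. \<forall>e. \<beta> ` residues e \<subseteq> forms e \<and> forms e = mpoly_space.span (I \<inter> forms e \<union> \<beta> ` residues e)"
proof -
  have "\<exists>b. b ` residues e \<subseteq> forms e \<and> forms e = mpoly_space.span (I \<inter> forms e \<union> b ` residues e)" for e
  proof -
    have fin: "finite (mon ` {a::'n monom. mdeg a = e} :: ('k, 'n) mpoly set)"
      by (simp add: finite_mdeg_eq)
    have sub: "mpoly_space.subspace (I \<inter> forms e)"
      by (simp add: mpoly_space.subspace_inter subspace_ideal is_ideal_ideal_gen subspace_polys_on)
    obtain K where K: "finite K" "K \<subseteq> forms e" "forms e = mpoly_space.span (I \<inter> forms e \<union> K)"
      "mpoly_space.dim (forms e :: ('k, 'n) mpoly set) = mpoly_space.dim (I \<inter> forms e) + card K"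
      by (rule mpoly_space.complement_exists[OF sub subspace_polys_on _ polys_on_subset_span fin]) auto
    have "card K = card (residues e)"
      using K(4) hilbert_function[of UNIV e] by (simp add: dim_polys_on finite_mdeg_eq residues_def)
    moreover have "finite (residues e)"
      unfolding residues_def by (rule finite_subset[OF _ finite_mdeg_eq[of e]]) blast
    ultimately obtain b where "bij_betw b (residues e) K"
      using K(1) finite_same_card_bij by metis
    then have "b ` residues e = K" by (simp add: bij_betw_def)
    then show ?thesis using K by blast
  qed
  then obtain b where b: "\<And>e. b e ` residues e \<subseteq> forms e"
    "\<And>e. forms e = mpoly_space.span (I \<inter> forms e \<union> b e ` residues e)" by metis
  \<comment> \<open>A residue determines its degree, so the labellings of the various degrees
    combine into one function.\<close>
  have "(\<lambda>a. b (mdeg a) a) ` residues e = b e ` residues e" for e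
    by (rule image_cong) (auto simp: residues_def)
  then show ?thesis using b by (intro exI[of _ "\<lambda>a. b (mdeg a) a"]) simp
qed

definition \<beta> :: "'n monom \<Rightarrow> ('k, 'n) mpoly" where
  "\<beta> = (SOME \<beta>. \<forall>e. \<beta> ` residues e \<subseteq> forms e \<and>
    forms e = mpoly_space.span (I \<inter> forms e \<union> \<beta> ` residues e))"

lemma residue_basis:
  "\<beta> ` residues e \<subseteq> forms e" "forms e = mpoly_space.span (I \<inter> forms e \<union> \<beta> ` residues e)"
  using someI_ex[OF residue_basis_exists] unfolding \<beta>_def[symmetric] by blast+

text \<open>The number of factors \<open>f j\<close>, with multiplicity, in the form attached to
  \<open>c\<close> below.\<close>

definition level :: "'n monom \<Rightarrow> nat" where
  "level c = (\<Sum>j\<in>UNIV. Poly_Mapping.lookup c j div d j)"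

text \<open>Division with remainder by the \<open>d j\<close> splits an exponent into a residue and
  the exponent of a monomial in the \<open>f j\<close>. The degree is preserved, so these forms can
  be counted like ordinary monomials.\<close>

definition basis_form :: "'n monom \<Rightarrow> ('k, 'n) mpoly" where
  "basis_form c = \<beta> (monom_of (\<lambda>j. Poly_Mapping.lookup c j mod d j)) *
    (\<Prod>j\<in>UNIV. f j ^ (Poly_Mapping.lookup c j div d j))"

text \<open>A linear span, shown below to be an ideal containing the \<open>N\<close>-th power of
  \<open>I\<close>; its generators are labelled by exponents and hence can be counted.\<close>

definition filtration :: "nat \<Rightarrow> ('k, 'n) mpoly set" where
  "filtration N = mpoly_space.span (basis_form ` {c. N \<le> level c})"

lemma subspace_filtration: "mpoly_space.subspace (filtration N)"
  by (simp add: filtration_def)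

lemma filtration_antimono: "M \<le> N \<Longrightarrow> filtration N \<subseteq> filtration M"
  unfolding filtration_def by (rule mpoly_space.span_mono) auto

lemma homogeneous_basis_form: "homogeneous (mdeg c) (basis_form c)"
proof -
  let ?m = "monom_of (\<lambda>j. Poly_Mapping.lookup c j mod d j)"
  have "?m \<in> residues (mdeg ?m)" using degree_pos by (simp add: residues_def)
  then have "homogeneous (mdeg ?m) (\<beta> ?m)" using residue_basis(1) by (auto simp flip: in_forms)
  then have "homogeneous (mdeg ?m + (\<Sum>j\<in>UNIV. (Poly_Mapping.lookup c j div d j) * d j)) (basis_form c)"
    unfolding basis_form_def by (intro homogeneous_mult homogeneous_prod homogeneous_power homog)
  moreover have "mdeg ?m + (\<Sum>j\<in>UNIV. (Poly_Mapping.lookup c j div d j) * d j) = mdeg c"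
    by (simp add: mdeg_def flip: sum.distrib)
  ultimately show ?thesis by simp
qed

lemma mult_basis_form: "f j * basis_form c = basis_form (c + Poly_Mapping.single j (d j))"
proof -
  let ?c = "c + Poly_Mapping.single j (d j)"
  have "(\<lambda>i. Poly_Mapping.lookup ?c i mod d i) = (\<lambda>i. Poly_Mapping.lookup c i mod d i)"
    by (auto simp: lookup_add lookup_single when_def)
  moreover have "(\<Prod>i\<in>UNIV. f i ^ (Poly_Mapping.lookup ?c i div d i)) =
      f j * (\<Prod>i\<in>UNIV. f i ^ (Poly_Mapping.lookup c i div d i))"
  proof -
    have "(\<Prod>i\<in>UNIV - {j}. f i ^ (Poly_Mapping.lookup ?c i div d i)) =
        (\<Prod>i\<in>UNIV - {j}. f i ^ (Poly_Mapping.lookup c i div d i))"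
      by (rule prod.cong) (auto simp: lookup_add lookup_single)
    moreover have "Poly_Mapping.lookup ?c j div d j = Suc (Poly_Mapping.lookup c j div d j)"
      using degree_pos[of j] by (simp add: lookup_add)
    ultimately show ?thesis by (simp add: prod.remove[of UNIV j] mult.assoc)
  qed
  ultimately show ?thesis by (simp add: basis_form_def mult.left_commute)
qed

lemma level_add_single: "level (c + Poly_Mapping.single j (d j)) = Suc (level c)"
proof -
  let ?c = "c + Poly_Mapping.single j (d j)"
  have "(\<Sum>i\<in>UNIV - {j}. Poly_Mapping.lookup ?c i div d i) =
      (\<Sum>i\<in>UNIV - {j}. Poly_Mapping.lookup c i div d i)"
    by (rule sum.cong) (auto simp: lookup_add lookup_single)
  moreover have "Poly_Mapping.lookup ?c j div d j = Suc (Poly_Mapping.lookup c j div d j)"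
    using degree_pos[of j] by (simp add: lookup_add)
  ultimately show ?thesis by (simp add: level_def sum.remove[of UNIV j])
qed

lemma filtration_closed:
  assumes "\<And>c. N \<le> level c \<Longrightarrow> h * basis_form c \<in> filtration M" "x \<in> filtration N"
  shows "h * x \<in> filtration M"
proof -
  have "filtration N \<subseteq> {x. h * x \<in> filtration M}"
    unfolding filtration_def[of N]
  proof (rule mpoly_space.span_minimal)
    show "mpoly_space.subspace {x. h * x \<in> filtration M}"
      using subspace_filtration[of M]
      by (auto simp: mpoly_space.subspace_def distrib_left mult_scl)
  qed (use assms(1) in auto)
  then show ?thesis using assms(2) by blast
qed

lemma mult_filtration: "x \<in> filtration N \<Longrightarrow> f j * x \<in> filtration (Suc N)"
  by (rule filtration_closed)
    (auto simp: mult_basis_form level_add_single filtration_def intro!: mpoly_space.span_base)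

lemma power_mult_filtration: "x \<in> filtration N \<Longrightarrow> f j ^ n * x \<in> filtration (n + N)"
  by (induction n) (auto simp: mult.assoc intro: mult_filtration)

lemma prod_mult_filtration:
  assumes "finite A" "x \<in> filtration N"
  shows "(\<Prod>j\<in>A. f j ^ q j) * x \<in> filtration (sum q A + N)"
  using assms
  by (induction A rule: finite_induct)
    (auto simp: mult.assoc add.assoc intro: power_mult_filtration)

text \<open>Induction on the degree: a form is a combination of elements \<beta> \<open>a\<close>
  modulo \<open>I\<close>, and an element of \<open>I\<close> has cofactors of smaller degree
  because every \<open>d j\<close> is positive.\<close>

lemma forms_subset_filtration_0: "forms e \<subseteq> filtration 0"
proof (induction e rule: less_induct)
  case (less e)
  have "I \<inter> forms e \<union> \<beta> ` residues e \<subseteq> filtration 0"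
  proof
    fix x assume "x \<in> I \<inter> forms e \<union> \<beta> ` residues e"
    then show "x \<in> filtration 0"
    proof
      assume x: "x \<in> I \<inter> forms e"
      obtain q where q: "hcomp e x = (\<Sum>j\<in>UNIV. f j * q j)" "\<And>j. homogeneous (e - d j) (q j)"
        "\<And>j. e < d j \<Longrightarrow> q j = 0"
        using homogeneous_split[of UNIV d f x e, OF finite homog] x by auto
      have "f j * q j \<in> filtration 0" for j
      proof (cases "d j \<le> e")
        case True
        then have "q j \<in> filtration 0"
          using less[of "e - d j"] degree_pos[of j] q(2)[of j] by (auto simp: in_forms subset_iff)
        then show ?thesis using mult_filtration filtration_antimono[of 0 1] by auto
      next
        case False
        then show ?thesis using q(3)[of j] subspace_filtration mpoly_space.subspace_0 by force
      qed
      then have "(\<Sum>j\<in>UNIV. f j * q j) \<in> filtration 0"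
        by (intro mpoly_space.subspace_sum subspace_filtration)
      then show ?thesis using x q(1) by (simp add: in_forms hcomp_homogeneous)
    next
      assume "x \<in> \<beta> ` residues e"
      then obtain a where a: "a \<in> residues e" "x = \<beta> a" by auto
      have "monom_of (\<lambda>j. Poly_Mapping.lookup a j mod d j) = a"
        using a(1) by (intro poly_mapping_eqI) (simp add: residues_def)
      moreover have "\<forall>j. Poly_Mapping.lookup a j div d j = 0"
        using a(1) by (simp add: residues_def)
      ultimately have "basis_form a = x" by (simp add: basis_form_def a(2))
      then show ?thesis unfolding filtration_def by (auto intro: mpoly_space.span_base)
    qed
  qed
  then show ?case
    using residue_basis(2)[of e] mpoly_space.span_minimal[OF _ subspace_filtration] by metis
qed

lemma filtration_0: "filtration 0 = UNIV"
proof -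
  have "x \<in> filtration 0" for x
  proof -
    have "scl (Poly_Mapping.lookup x a) (mon a) \<in> filtration 0" for a
      using forms_subset_filtration_0[of "mdeg a"] homogeneous_mon[of a]
      by (intro mpoly_space.subspace_scale subspace_filtration) (auto simp: in_forms subset_iff)
    then have "(\<Sum>a\<in>Poly_Mapping.keys x. scl (Poly_Mapping.lookup x a) (mon a)) \<in> filtration 0"
      by (intro mpoly_space.subspace_sum subspace_filtration)
    then show ?thesis
      using mpoly_eq_sum[OF finite_keys order_refl, of x] by (simp add: scl_def)
  qed
  then show ?thesis by auto
qed

text \<open>In \<open>h * basis_form c\<close> the factor \<open>h\<close> is first multiplied with
  the residue part. That product is expanded using \<open>filtration 0 = UNIV\<close>, and the
  monomial in the \<open>f j\<close> then raises the level by \<open>level c\<close>.\<close>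

lemma is_ideal_filtration: "is_ideal (filtration N)"
proof (rule is_idealI)
  fix h x assume "x \<in> filtration N"
  then show "h * x \<in> filtration N"
  proof (rule filtration_closed[rotated])
    fix c assume c: "N \<le> level c"
    let ?r = "\<beta> (monom_of (\<lambda>j. Poly_Mapping.lookup c j mod d j))"
    have "(\<Prod>j\<in>UNIV. f j ^ (Poly_Mapping.lookup c j div d j)) * (h * ?r) \<in> filtration (level c + 0)"
      unfolding level_def by (rule prod_mult_filtration) (simp_all add: filtration_0)
    then show "h * basis_form c \<in> filtration N"
      using filtration_antimono[OF c] by (auto simp: basis_form_def mult_ac)
  qed
qed (use subspace_filtration[of N] in \<open>auto simp: mpoly_space.subspace_def\<close>)

lemma ideal_power_subset_filtration: "ideal_power I N \<subseteq> filtration N"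
proof (induction N)
  case (Suc N)
  show ?case
    unfolding ideal_power.simps ideal_mult_def
  proof (rule ideal_gen_minimal[OF _ is_ideal_filtration], safe)
    fix x y assume x: "x \<in> I" and y: "y \<in> ideal_power I N"
    obtain q where "x = (\<Sum>j\<in>UNIV. f j * q j)"
      using x unfolding ideal_gen_finite_image[OF finite] by auto
    then have "x * y = (\<Sum>j\<in>UNIV. f j * (q j * y))" by (simp add: sum_distrib_right mult.assoc)
    also have "\<dots> \<in> filtration (Suc N)"
      using Suc y by (intro ideal_sum[OF is_ideal_filtration] mult_filtration
        ideal_mult_left[OF is_ideal_filtration]) auto
    finally show "x * y \<in> filtration (Suc N)" .
  qed
qed (simp add: filtration_0)

text \<open>The leading monomials up to degree \<open>E\<close> are counted by a dimension, which is
  bounded by the number of basis forms that span the part of the power up to degree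
  \<open>E\<close>.\<close>

lemma card_lead_monoms_power_le:
  assumes "invertible g"
  shows "card (lead_monoms (mat_act g ` ideal_power I N) \<inter> {a. mdeg a \<le> E}) \<le>
    card {c. mdeg c \<le> E \<and> N \<le> (\<Sum>j\<in>UNIV. Poly_Mapping.lookup c j div d j)}"
proof -
  let ?J = "ideal_power I N" and ?P = "polys_on {a::'n monom. mdeg a \<le> E} :: ('k, 'n) mpoly set"
  let ?C = "{c. mdeg c \<le> E \<and> N \<le> level c}"
  have C: "finite ?C" by (rule finite_subset[OF _ finite_mdeg_le[of E]]) blast
  have "card (lead_monoms (mat_act g ` ?J) \<inter> {a. mdeg a \<le> E}) =
      mpoly_space.dim (mat_act g ` ?J \<inter> ?P)"
    by (intro card_lead_monoms subspace_ideal is_ideal_mat_act_image assms is_ideal_power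
      finite_mdeg_le revlex_closed_mdeg_le)
  also have "\<dots> \<le> card (mat_act g ` basis_form ` ?C)"
  proof (rule mpoly_space.dim_le_card)
    have "?J \<inter> ?P \<subseteq> mpoly_space.span (basis_form ` ?C)"
    proof
      fix x assume x: "x \<in> ?J \<inter> ?P"
      \<comment> \<open>Truncation to degrees at most \<open>E\<close> fixes a basis form or kills
        it, basis forms being homogeneous. Applied to a combination that represents
        \<open>x\<close>, it removes all terms of larger degree.\<close>
      let ?t = "\<lambda>x. \<Sum>e\<le>E. hcomp e x"
      have lt: "Poly_Mapping.lookup (?t x) a = (if mdeg a \<le> E then Poly_Mapping.lookup x a else 0)"
        for x :: "('k, 'n) mpoly" and a
        by (simp add: lookup_sum lookup_hcomp)
      have "filtration N \<subseteq> {x. ?t x \<in> mpoly_space.span (basis_form ` ?C)}"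
        unfolding filtration_def
      proof (rule mpoly_space.span_minimal)
        have "?t (x + y) = ?t x + ?t y" "?t (scl c x) = scl c (?t x)" "?t (0 :: ('k, 'n) mpoly) = 0"
          for x y :: "('k, 'n) mpoly" and c
          by (rule poly_mapping_eqI; simp add: lookup_sum lookup_hcomp lookup_add)+
        then show "mpoly_space.subspace {x. ?t x \<in> mpoly_space.span (basis_form ` ?C)}"
          by (auto simp: mpoly_space.subspace_def
            intro: mpoly_space.span_zero mpoly_space.span_add mpoly_space.span_scale)
        show "basis_form ` {c. N \<le> level c} \<subseteq> {x. ?t x \<in> mpoly_space.span (basis_form ` ?C)}"
        proof clarify
          fix c assume c: "N \<le> level c"
          have "?t (basis_form c) = (if mdeg c \<le> E then basis_form c else 0)"
          proof (rule poly_mapping_eqI)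
            fix a
            have "mdeg a \<noteq> mdeg c \<Longrightarrow> Poly_Mapping.lookup (basis_form c) a = 0"
              using homogeneous_basis_form[of c] by (auto simp: homogeneous_def in_keys_iff)
            then show "Poly_Mapping.lookup (?t (basis_form c)) a =
                Poly_Mapping.lookup (if mdeg c \<le> E then basis_form c else 0) a"
              by (cases "mdeg a = mdeg c") (auto simp: lt)
          qed
          then show "?t (basis_form c) \<in> mpoly_space.span (basis_form ` ?C)"
            using c by (auto intro: mpoly_space.span_base mpoly_space.span_zero)
        qed
      qed
      then have "?t x \<in> mpoly_space.span (basis_form ` ?C)"
        using x ideal_power_subset_filtration by blast
      moreover have "?t x = x"
        using x by (intro poly_mapping_eqI) (auto simp: lt polys_on_def in_keys_iff)
      ultimately show "x \<in> mpoly_space.span (basis_form ` ?C)" by simp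
    qed
    then show "mat_act g ` ?J \<inter> ?P \<subseteq> mpoly_space.span (mat_act g ` basis_form ` ?C)"
      unfolding mat_act_image_inter_polys_on_le[OF assms] mat_act_span[symmetric] by (rule image_mono)
  qed (use C in simp)
  also have "\<dots> \<le> card ?C"
    using C by (meson card_image_le finite_imageI le_trans)
  finally show ?thesis by (simp add: level_def)
qed

end

section \<open>Generic matrices and generic initial ideals\<close>

text \<open>Polynomial functions of the matrix entries, given by closure rules so that membership
  follows the shape of a formula; the next lemmas relate them to evaluated polynomials.\<close>

inductive_set polyfun :: "('k::field^'n^'n \<Rightarrow> 'k) set" where
  polyfun_const: "(\<lambda>_. c) \<in> polyfun"
| polyfun_entry: "(\<lambda>g. g $ i $ j) \<in> polyfun"
| polyfun_add: "p \<in> polyfun \<Longrightarrow> q \<in> polyfun \<Longrightarrow> (\<lambda>g. p g + q g) \<in> polyfun"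
| polyfun_mult: "p \<in> polyfun \<Longrightarrow> q \<in> polyfun \<Longrightarrow> (\<lambda>g. p g * q g) \<in> polyfun"

lemma polyfun_minus: "p \<in> polyfun \<Longrightarrow> q \<in> polyfun \<Longrightarrow> (\<lambda>g. p g - q g) \<in> polyfun"
  using polyfun_add[of p "\<lambda>g. - 1 * q g"] polyfun_mult[OF polyfun_const[of "- 1"], of q] by simp

lemma polyfun_sum: "(\<And>x. x \<in> A \<Longrightarrow> (\<lambda>g. p g x) \<in> polyfun) \<Longrightarrow> (\<lambda>g. \<Sum>x\<in>A. p g x) \<in> polyfun"
  by (induction A rule: infinite_finite_induct) (auto intro: polyfun_const polyfun_add)

lemma polyfun_prod: "(\<And>x. x \<in> A \<Longrightarrow> (\<lambda>g. p g x) \<in> polyfun) \<Longrightarrow> (\<lambda>g. \<Prod>x\<in>A. p g x) \<in> polyfun"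
  by (induction A rule: infinite_finite_induct) (auto intro: polyfun_const polyfun_mult)

lemma polyfun_power: "p \<in> polyfun \<Longrightarrow> (\<lambda>g. p g ^ n) \<in> polyfun"
  by (induction n) (auto intro: polyfun_const polyfun_mult)

lemma polyfun_det: "det \<in> polyfun"
  unfolding det_def[abs_def]
  by (intro polyfun_sum polyfun_mult polyfun_const polyfun_prod polyfun_entry)

lemma comm_ring_map_id: "comm_ring_map id"
  by unfold_locales auto

lemma polyfun_eval_with: "(\<lambda>g. eval_with id (\<lambda>(i, j). g $ i $ j) q) \<in> polyfun"
proof -
  have "(\<lambda>g. (case k of (i, j) \<Rightarrow> g $ i $ j) ^ n) \<in> polyfun" for k :: "'b \<times> 'b" and n
    by (cases k) (simp add: polyfun_power polyfun_entry)
  then show ?thesis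
    unfolding eval_with_def by (intro polyfun_sum polyfun_mult polyfun_const polyfun_prod)
qed

lemma eval_with_id_const: "eval_with id v (const c) = c"
  by (rule trans[OF comm_ring_map.eval_with_const[OF comm_ring_map_id]]) (rule id_apply)

lemmas eval_with_id_var = comm_ring_map.eval_with_var[OF comm_ring_map_id]
  and eval_with_id_add = comm_ring_map.eval_with_add[OF comm_ring_map_id]
  and eval_with_id_mult = comm_ring_map.eval_with_mult[OF comm_ring_map_id]

lemma polyfun_is_eval_with:
  assumes "p \<in> polyfun"
  shows "\<exists>q. \<forall>g. eval_with id (\<lambda>(i, j). g $ i $ j) q = p g"
  using assms
proof induction
  case (polyfun_const c)
  then show ?case
    by (intro exI[of _ "const c"] allI) (simp only: eval_with_id_const prod.case)
next
  case (polyfun_entry i j)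
  then show ?case
    by (intro exI[of _ "var (i, j)"] allI) (simp only: eval_with_id_var prod.case)
next
  case (polyfun_add p q)
  from polyfun_add.IH obtain u v where "\<forall>g. eval_with id (\<lambda>(i, j). g $ i $ j) u = p g"
    "\<forall>g. eval_with id (\<lambda>(i, j). g $ i $ j) v = q g" by blast
  then show ?case
    by (intro exI[of _ "u + v"] allI) (simp only: eval_with_id_add)
next
  case (polyfun_mult p q)
  from polyfun_mult.IH obtain u v where "\<forall>g. eval_with id (\<lambda>(i, j). g $ i $ j) u = p g"
    "\<forall>g. eval_with id (\<lambda>(i, j). g $ i $ j) v = q g" by blast
  then show ?case
    by (intro exI[of _ "u * v"] allI) (simp only: eval_with_id_mult prod.case)
qed

text \<open>Restriction to a line reduces questions about common non-zeros to polynomials in one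
  variable.\<close>

lemma polyfun_on_line:
  fixes g h :: "'k::field^'n^'n"
  assumes "p \<in> polyfun"
  shows "\<exists>q. \<forall>t. poly q t = p (\<chi> i j. g $ i $ j + t * h $ i $ j)"
  using assms
proof induction
  case (polyfun_const c)
  then show ?case by (intro exI[of _ "[:c:]"]) simp
next
  case (polyfun_entry i j)
  then show ?case by (intro exI[of _ "[:g $ i $ j, h $ i $ j:]"]) simp
next
  case (polyfun_add p q)
  then obtain u v where "\<forall>t. poly u t = p (\<chi> i j. g $ i $ j + t * h $ i $ j)"
    "\<forall>t. poly v t = q (\<chi> i j. g $ i $ j + t * h $ i $ j)" by auto
  then show ?case by (intro exI[of _ "u + v"]) simp
next
  case (polyfun_mult p q)
  then obtain u v where "\<forall>t. poly u t = p (\<chi> i j. g $ i $ j + t * h $ i $ j)"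
    "\<forall>t. poly v t = q (\<chi> i j. g $ i $ j + t * h $ i $ j)" by auto
  then show ?case by (intro exI[of _ "u * v"]) simp
qed

text \<open>Irreducibility of the space of matrices. On the line through \<open>g\<close> and
  \<open>h\<close> both restrictions are nonzero polynomials, so their product has finitely many
  roots, while a field of characteristic 0 is infinite.\<close>

lemma polyfun_common_nonzero:
  fixes p q :: "'k::field_char_0^'n^'n \<Rightarrow> 'k"
  assumes "p \<in> polyfun" "q \<in> polyfun" "p g \<noteq> 0" "q h \<noteq> 0"
  shows "\<exists>g. p g \<noteq> 0 \<and> q g \<noteq> 0"
proof -
  define l where "l = (\<lambda>t. \<chi> i j. g $ i $ j + t * (h - g) $ i $ j)"
  have l: "l 0 = g" "l 1 = h" by (simp_all add: l_def vec_eq_iff)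
  obtain u v where uv: "\<And>t. poly u t = p (l t)" "\<And>t. poly v t = q (l t)"
    unfolding l_def using polyfun_on_line[OF assms(1), of g "h - g"]
      polyfun_on_line[OF assms(2), of g "h - g"] by metis
  have "poly u 0 \<noteq> 0" "poly v 1 \<noteq> 0" using l uv assms by auto
  then have "u * v \<noteq> 0" by auto
  then have "finite {t. poly (u * v) t = 0}" by (rule poly_roots_finite)
  then obtain t where "poly (u * v) t \<noteq> 0"
    using infinite_UNIV_char_0[where 'a = 'k] by (metis (mono_tags, lifting) UNIV_eq_I mem_Collect_eq)
  then show ?thesis using uv by auto
qed

text \<open>A single principal open set replaces arbitrary nonempty Zariski open sets;
  \<open>generic_iff_zariski\<close> shows that nothing changes.\<close>

definition generic :: "('k::field^'n^'n \<Rightarrow> bool) \<Rightarrow> bool" where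
  "generic P \<longleftrightarrow> (\<exists>p\<in>polyfun. (\<exists>g. p g \<noteq> 0) \<and> (\<forall>g. p g \<noteq> 0 \<longrightarrow> P g))"

lemma generic_mono: "generic P \<Longrightarrow> (\<And>g. P g \<Longrightarrow> Q g) \<Longrightarrow> generic Q"
  unfolding generic_def by blast

lemma generic_conj:
  fixes P Q :: "'k::field_char_0^'n^'n \<Rightarrow> bool"
  assumes "generic P" "generic Q"
  shows "generic (\<lambda>g. P g \<and> Q g)"
proof -
  obtain p q g h where pq: "p \<in> polyfun" "q \<in> polyfun" "p g \<noteq> 0" "q h \<noteq> 0"
    "\<And>g. p g \<noteq> 0 \<Longrightarrow> P g" "\<And>g. q g \<noteq> 0 \<Longrightarrow> Q g"
    using assms unfolding generic_def by metis
  then show ?thesis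
    unfolding generic_def using polyfun_common_nonzero[OF pq(1-4)] polyfun_mult[OF pq(1,2)]
    by (intro bexI[of _ "\<lambda>g. p g * q g"]) auto
qed

lemma generic_True: "generic (\<lambda>_. True)"
  unfolding generic_def by (rule bexI[OF _ polyfun_const[of 1]]) simp

lemma generic_ball:
  fixes P :: "'i \<Rightarrow> 'k::field_char_0^'n^'n \<Rightarrow> bool"
  assumes "finite A" "\<And>x. x \<in> A \<Longrightarrow> generic (P x)"
  shows "generic (\<lambda>g. \<forall>x\<in>A. P x g)"
  using assms by (induction A rule: finite_induct) (auto intro: generic_True generic_conj)

lemma generic_ex: "generic P \<Longrightarrow> \<exists>g. P g"
  unfolding generic_def by blast

lemma generic_invertible: "generic invertible"
  unfolding generic_def
  by (rule bexI[OF _ polyfun_det]) (auto simp: invertible_det_nz intro: exI[of _ "mat 1"])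

text \<open>In one direction a nonvanishing member of the family is multiplied by the determinant;
  in the other, irreducibility gives an invertible matrix outside the zero set.\<close>

lemma generic_iff_zariski:
  fixes P :: "'k::field_char_0^'n^'n \<Rightarrow> bool"
  shows "(\<exists>U. zariski_open_GL U \<and> U \<noteq> {} \<and> (\<forall>g\<in>U. P g)) \<longleftrightarrow> generic P"
proof
  assume "\<exists>U. zariski_open_GL U \<and> U \<noteq> {} \<and> (\<forall>g\<in>U. P g)"
  then obtain U S where U: "U \<noteq> {}" "\<And>g. g \<in> U \<Longrightarrow> P g"
    "U = {g. invertible g \<and> (\<exists>p\<in>S. eval_with id (\<lambda>(i, j). g $ i $ j) p \<noteq> 0)}"
    unfolding zariski_open_GL_def by auto
  then obtain g q where g: "invertible g" "q \<in> S" "eval_with id (\<lambda>(i, j). g $ i $ j) q \<noteq> 0"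
    by auto
  show "generic P"
    unfolding generic_def
  proof (rule bexI)
    show "(\<lambda>g. det g * eval_with id (\<lambda>(i, j). g $ i $ j) q) \<in> polyfun"
      by (intro polyfun_mult polyfun_det polyfun_eval_with)
    show "(\<exists>g. det g * eval_with id (\<lambda>(i, j). g $ i $ j) q \<noteq> 0) \<and>
        (\<forall>g. det g * eval_with id (\<lambda>(i, j). g $ i $ j) q \<noteq> 0 \<longrightarrow> P g)"
      using g U by (auto simp: invertible_det_nz)
  qed
next
  assume "generic P"
  then obtain p g where p: "p \<in> polyfun" "p g \<noteq> 0" "\<And>g. p g \<noteq> 0 \<Longrightarrow> P g"
    unfolding generic_def by metis
  obtain q where q: "\<And>g. eval_with id (\<lambda>(i, j). g $ i $ j) q = p g"
    using polyfun_is_eval_with[OF p(1)] by metis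
  obtain h where h: "p h \<noteq> 0" "det h \<noteq> 0"
    using polyfun_common_nonzero[OF p(1) polyfun_det p(2), of "mat 1"] by auto
  let ?U = "{g. invertible g \<and> (\<exists>p\<in>{q}. eval_with id (\<lambda>(i, j). g $ i $ j) p \<noteq> 0)}"
  show "\<exists>U. zariski_open_GL U \<and> U \<noteq> {} \<and> (\<forall>g\<in>U. P g)"
  proof (intro exI conjI)
    show "zariski_open_GL ?U" unfolding zariski_open_GL_def by blast
    have "h \<in> ?U" using h q by (simp add: invertible_det_nz)
    then show "?U \<noteq> {}" by blast
    show "\<forall>g\<in>?U. P g" using p(3) q by simp
  qed
qed

text \<open>Two generic conditions hold at a common matrix, so the value is unique and the definite
  description in \<open>gin\<close> is justified.\<close>

lemma gin_eqI:
  fixes J :: "('k::field_char_0, 'n::{finite,linorder}) mpoly set"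
  assumes "generic (\<lambda>g. initial_ideal (mat_act g ` J) = G)"
  shows "gin J = G"
  unfolding gin_def generic_iff_zariski
proof (rule the_equality[where P = "\<lambda>G. generic (\<lambda>g. initial_ideal (mat_act g ` J) = G)"])
  fix G' assume "generic (\<lambda>g. initial_ideal (mat_act g ` J) = G')"
  then show "G' = G" using generic_ex[OF generic_conj[OF assms]] by blast
qed (rule assms)

lemma independent_mod_zeroD:
  "independent_mod scl {0} K w \<Longrightarrow> (\<Sum>k\<in>K. scl (c k) (w k)) = 0 \<Longrightarrow> k \<in> K \<Longrightarrow> c k = 0"
  by (auto simp: independent_mod_def)

text \<open>Fraction-free Gaussian elimination: the pivot coefficients multiply up to the function \<open>p\<close>.\<close>

lemma independent_generically:
  fixes w :: "'k::field^'n^'n \<Rightarrow> 'i \<Rightarrow> ('k, 'm) mpoly"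
  assumes "finite K" "\<And>k a. k \<in> K \<Longrightarrow> (\<lambda>g. Poly_Mapping.lookup (w g k) a) \<in> polyfun"
    and "independent_mod scl {0} K (w h)"
  shows "\<exists>p\<in>polyfun. p h \<noteq> 0 \<and> (\<forall>g. p g \<noteq> 0 \<longrightarrow> independent_mod scl {0} K (w g))"
  using assms
proof (induction K arbitrary: w rule: finite_induct)
  case empty
  then show ?case by (intro bexI[OF _ polyfun_const[of 1]]) (auto simp: independent_mod_def)
next
  case (insert k K)
  have "w h k \<noteq> 0"
  proof
    assume "w h k = 0"
    then have "(\<Sum>j\<in>insert k K. scl (if j = k then 1 else 0) (w h j)) = 0"
      by (intro sum.neutral) auto
    from independent_mod_zeroD[OF insert.prems(2) this, of k] show False by simp
  qed
  then obtain a where a: "Poly_Mapping.lookup (w h k) a \<noteq> 0"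
    using poly_mapping_eqI[of "w h k" 0] by auto
  define \<alpha> where "\<alpha> = (\<lambda>g j. Poly_Mapping.lookup (w g j) a)"
  define w' where "w' = (\<lambda>g j. scl (\<alpha> g k) (w g j) - scl (\<alpha> g j) (w g k))"
  have w'_sum: "(\<Sum>j\<in>K. scl (c j) (w' g j)) =
      scl (\<alpha> g k) (\<Sum>j\<in>K. scl (c j) (w g j)) - scl (\<Sum>j\<in>K. c j * \<alpha> g j) (w g k)" for c g
    by (rule poly_mapping_eqI)
      (simp add: w'_def lookup_sum lookup_minus sum_subtractf sum_distrib_left sum_distrib_right
        right_diff_distrib mult_ac)
  have "\<exists>p\<in>polyfun. p h \<noteq> 0 \<and> (\<forall>g. p g \<noteq> 0 \<longrightarrow> independent_mod scl {0} K (w' g))"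
  proof (rule insert.IH)
    fix j b assume "j \<in> K"
    then show "(\<lambda>g. Poly_Mapping.lookup (w' g j) b) \<in> polyfun"
      unfolding w'_def \<alpha>_def lookup_minus lookup_scl
      by (intro polyfun_minus polyfun_mult insert.prems(1)) auto
  next
    show "independent_mod scl {0} K (w' h)"
      unfolding independent_mod_def
    proof (intro allI impI ballI)
      fix c j assume s: "(\<Sum>j\<in>K. scl (c j) (w' h j)) \<in> {0}" and j: "j \<in> K"
      \<comment> \<open>Undoes the elimination: the coefficients of the given relation, rewritten in
        terms of the original family.\<close>
      define C where "C = (\<lambda>j. if j = k then - (\<Sum>j\<in>K. c j * \<alpha> h j) else \<alpha> h k * c j)"
      have "(\<Sum>j\<in>insert k K. scl (C j) (w h j)) =
          scl (C k) (w h k) + (\<Sum>j\<in>K. scl (\<alpha> h k * c j) (w h j))"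
        using insert.hyps by (auto simp: C_def intro!: sum.cong)
      also have "\<dots> = (\<Sum>j\<in>K. scl (c j) (w' h j))"
        unfolding w'_sum
        by (simp add: C_def mpoly_space.scale_minus_left mpoly_space.scale_sum_right)
      finally have "(\<Sum>j\<in>insert k K. scl (C j) (w h j)) = 0" using s by simp
      then have "C j = 0" using independent_mod_zeroD[OF insert.prems(2), of C j] j by simp
      then show "c j = 0" using j insert.hyps a by (auto simp: C_def \<alpha>_def split: if_splits)
    qed
  qed
  then obtain p where p: "p \<in> polyfun" "p h \<noteq> 0"
    "\<And>g. p g \<noteq> 0 \<Longrightarrow> independent_mod scl {0} K (w' g)" by blast
  show ?case
  proof (intro bexI[of _ "\<lambda>g. \<alpha> g k * p g"] conjI allI impI)
    show "(\<lambda>g. \<alpha> g k * p g) \<in> polyfun"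
      unfolding \<alpha>_def by (intro polyfun_mult insert.prems(1) p(1)) simp
    show "\<alpha> h k * p h \<noteq> 0" using a p(2) by (simp add: \<alpha>_def)
    fix g assume g: "\<alpha> g k * p g \<noteq> 0"
    show "independent_mod scl {0} (insert k K) (w g)"
      unfolding independent_mod_def
    proof (intro allI impI)
      fix c assume "(\<Sum>j\<in>insert k K. scl (c j) (w g j)) \<in> {0}"
      then have s: "scl (c k) (w g k) + (\<Sum>j\<in>K. scl (c j) (w g j)) = 0"
        using insert.hyps by simp
      have e: "c k * \<alpha> g k + (\<Sum>j\<in>K. c j * \<alpha> g j) = 0"
        using arg_cong[OF s, of "\<lambda>f. Poly_Mapping.lookup f a"]
        by (simp add: lookup_add lookup_sum \<alpha>_def)
      have s': "(\<Sum>j\<in>K. scl (c j) (w g j)) = - scl (c k) (w g k)"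
        using s by (simp add: eq_neg_iff_add_eq_0 add.commute)
      have e': "(\<Sum>j\<in>K. c j * \<alpha> g j) = - (c k * \<alpha> g k)"
        using e by (simp add: eq_neg_iff_add_eq_0 add.commute)
      have "(\<Sum>j\<in>K. scl (c j) (w' g j)) = 0"
        unfolding w'_sum s' e' by (rule poly_mapping_eqI) (simp add: lookup_minus)
      then have K0: "\<forall>j\<in>K. c j = 0"
        using independent_mod_zeroD[OF p(3)[of g]] g by auto
      then have "c k * \<alpha> g k = 0" using e by simp
      then show "\<forall>j\<in>insert k K. c j = 0" using K0 g by auto
    qed
  qed
qed

section \<open>Semicontinuity of dimensions under the matrix action\<close>

lemma polyfun_lookup_mult:
  fixes F G :: "'k::field^'n^'n \<Rightarrow> ('k, 'm::finite) mpoly"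
  assumes "\<And>a. (\<lambda>g. Poly_Mapping.lookup (F g) a) \<in> polyfun"
    "\<And>a. (\<lambda>g. Poly_Mapping.lookup (G g) a) \<in> polyfun"
  shows "(\<lambda>g. Poly_Mapping.lookup (F g * G g) a) \<in> polyfun"
  unfolding lookup_mult_finite case_prod_beta by (intro polyfun_sum polyfun_mult assms)

lemma polyfun_lookup_power:
  fixes F :: "'k::field^'n^'n \<Rightarrow> ('k, 'm::finite) mpoly"
  assumes "\<And>a. (\<lambda>g. Poly_Mapping.lookup (F g) a) \<in> polyfun"
  shows "(\<lambda>g. Poly_Mapping.lookup (F g ^ n) a) \<in> polyfun"
  by (induction n arbitrary: a) (auto simp: lookup_one polyfun_const intro: polyfun_lookup_mult assms)

lemma polyfun_lookup_prod:
  fixes F :: "'i \<Rightarrow> 'k::field^'n^'n \<Rightarrow> ('k, 'm::finite) mpoly"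
  assumes "\<And>x a. (\<lambda>g. Poly_Mapping.lookup (F x g) a) \<in> polyfun"
  shows "(\<lambda>g. Poly_Mapping.lookup (\<Prod>x\<in>A. F x g) a) \<in> polyfun"
  by (induction A arbitrary: a rule: infinite_finite_induct)
    (auto simp: lookup_one polyfun_const intro: polyfun_lookup_mult assms)

lemma polyfun_lookup_mat_act: "(\<lambda>g. Poly_Mapping.lookup (mat_act g f) a) \<in> polyfun"
  unfolding mat_act_def eval_with_def lookup_sum
  by (intro polyfun_sum polyfun_lookup_mult polyfun_lookup_prod polyfun_lookup_power polyfun_const)
    (simp add: lookup_sum polyfun_sum polyfun_mult polyfun_entry polyfun_const)

text \<open>Let \<open>K\<close> be a complement of the intersection at \<open>h\<close>.
  Independence of \<open>K\<close> together with the image of a basis of a truncation of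
  \<open>J\<close> is an open condition that holds at \<open>h\<close>. Where it holds,
  \<open>K\<close> is still independent modulo the intersection, which therefore cannot be larger
  than at \<open>h\<close>.\<close>

lemma dim_mat_act_generically_le:
  fixes J :: "('k::field_char_0, 'n::{finite,linorder}) mpoly set"
  assumes "mpoly_space.subspace J" "finite D" "invertible h"
  shows "generic (\<lambda>g. invertible g \<and> mpoly_space.dim (mat_act g ` J \<inter> polys_on D) \<le>
    mpoly_space.dim (mat_act h ` J \<inter> polys_on D))"
proof -
  \<comment> \<open>The part of \<open>J\<close> of degree at most \<open>E\<close> is
    finite-dimensional, and invertible matrices map it onto the same part of the image; this fails
    for the part supported in \<open>D\<close>.\<close>
  obtain E where E: "D \<subseteq> {a. mdeg a \<le> E}"
    using finite_imageI[OF assms(2), of mdeg] by (auto simp: finite_nat_set_iff_bounded_le)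
  let ?P = "polys_on {a::'n monom. mdeg a \<le> E} :: ('k, 'n) mpoly set"
  have DP: "polys_on D \<subseteq> ?P" using E by (auto simp: polys_on_def)
  have fin: "finite (mon ` {a::'n monom. mdeg a \<le> E} :: ('k, 'n) mpoly set)"
    "finite (mon ` D :: ('k, 'n) mpoly set)"
    by (simp_all add: finite_mdeg_le assms(2))
  have "mpoly_space.subspace (J \<inter> ?P)"
    by (intro mpoly_space.subspace_inter assms(1) subspace_polys_on)
  then obtain X where X: "finite X" "mpoly_space.independent X" "mpoly_space.span X = J \<inter> ?P"
    by (rule mpoly_space.finite_basis_in_span[OF _ _ fin(1)]) (use polys_on_subset_span in blast)+
  have sub: "mpoly_space.subspace (mat_act g ` J \<inter> polys_on D)" for g
  proof -
    have "mpoly_space.span (mat_act g ` J) = mat_act g ` J"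
      using mat_act_span[of g J, symmetric] mpoly_space.span_eq_iff[THEN iffD2, OF assms(1)] by simp
    then show ?thesis
      by (intro mpoly_space.subspace_inter subspace_polys_on) (metis mpoly_space.subspace_span)
  qed
  let ?U = "mat_act h ` J \<inter> polys_on D"
  obtain K where K: "finite K" "K \<subseteq> polys_on D" "independent_mod scl ?U K (\<lambda>k. k)"
    "mpoly_space.dim (polys_on D :: ('k, 'n) mpoly set) = mpoly_space.dim ?U + card K"
    by (rule mpoly_space.complement_exists[OF sub subspace_polys_on _ polys_on_subset_span fin(2)]) auto
  \<comment> \<open>The disjoint sum as index set keeps the fixed vectors \<open>K\<close> and the
    moving vectors from \<open>X\<close> apart even where they coincide.\<close>
  define w where
    "w = (\<lambda>g. case_sum (\<lambda>k. k) (mat_act g :: ('k, 'n) mpoly \<Rightarrow> ('k, 'n) mpoly))"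
  have sumw: "(\<Sum>i\<in>K <+> X. scl (c i) (w g i)) =
      (\<Sum>k\<in>K. scl (c (Inl k)) k) + mat_act g (\<Sum>x\<in>X. scl (c (Inr x)) x)" for c g
    using K(1) X(1) by (simp add: sum.Plus w_def mat_act.map_sum mat_act_scl)
  have XJ: "(\<Sum>x\<in>X. scl (c x) x) \<in> J" for c
    using X(3) mpoly_space.span_sum[of X "\<lambda>x. scl (c x) x" X]
      mpoly_space.span_scale mpoly_space.span_base by blast
  have Kc: "(\<Sum>k\<in>K. scl (c k) k) \<in> polys_on D" for c
    using K(2) by (intro mpoly_space.subspace_sum subspace_polys_on mpoly_space.subspace_scale) auto
  have "\<exists>p\<in>polyfun. p h \<noteq> 0 \<and> (\<forall>g. p g \<noteq> 0 \<longrightarrow> independent_mod scl {0} (K <+> X) (w g))"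
  proof (rule independent_generically)
    show "finite (K <+> X)" using K X by simp
    show "(\<lambda>g. Poly_Mapping.lookup (w g i) a) \<in> polyfun" for i a
      by (cases i) (simp_all add: w_def polyfun_const polyfun_lookup_mat_act)
    show "independent_mod scl {0} (K <+> X) (w h)"
      unfolding independent_mod_def
    proof (intro allI impI)
      fix c assume "(\<Sum>i\<in>K <+> X. scl (c i) (w h i)) \<in> {0}"
      then have s: "(\<Sum>k\<in>K. scl (c (Inl k)) k) + mat_act h (\<Sum>x\<in>X. scl (c (Inr x)) x) = 0"
        by (simp add: sumw)
      then have "(\<Sum>k\<in>K. scl (c (Inl k)) k) = mat_act h (- (\<Sum>x\<in>X. scl (c (Inr x)) x))"
        using mat_act.map_minus[of h 0 "\<Sum>x\<in>X. scl (c (Inr x)) x"]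
        by (simp add: mat_act.map_zero) (simp add: eq_neg_iff_add_eq_0)
      moreover have "- (\<Sum>x\<in>X. scl (c (Inr x)) x) \<in> J"
        by (rule mpoly_space.subspace_neg[OF assms(1) XJ])
      ultimately have "(\<Sum>k\<in>K. scl (c (Inl k)) k) \<in> mat_act h ` J" by (rule image_eqI)
      with Kc have "(\<Sum>k\<in>K. scl (c (Inl k)) k) \<in> ?U" by (rule IntI[rotated])
      then have c1: "\<forall>k\<in>K. c (Inl k) = 0"
        using mpoly_space.independent_modD[OF K(3), of "\<lambda>k. c (Inl k)"] by blast
      then have "mat_act h (\<Sum>x\<in>X. scl (c (Inr x)) x) = mat_act h 0"
        using s by (simp add: mat_act.map_zero)
      then have "(\<Sum>x\<in>X. scl (c (Inr x)) x) = 0"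
        by (rule injD[OF inj_mat_act[OF assms(3)]])
      then have "\<forall>x\<in>X. c (Inr x) = 0"
        using X mpoly_space.independent_explicit_finite_subsets[of X]
        by (auto dest!: spec[of _ X] spec[of _ "\<lambda>x. c (Inr x)"])
      then show "\<forall>i\<in>K <+> X. c i = 0" using c1 by auto
    qed
  qed
  then obtain p where p: "p \<in> polyfun" "p h \<noteq> 0"
    "\<And>g. p g \<noteq> 0 \<Longrightarrow> independent_mod scl {0} (K <+> X) (w g)" by blast
  then have "generic (\<lambda>g. independent_mod scl {0} (K <+> X) (w g))"
    unfolding generic_def by blast
  then show ?thesis
  proof (rule generic_mono[OF generic_conj[OF generic_invertible]], elim conjE)
    fix g
    assume g: "invertible g" and ind: "independent_mod scl {0} (K <+> X) (w g)"
    let ?V = "mat_act g ` J \<inter> polys_on D"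
    have "mpoly_space.dim ?V + card K \<le> mpoly_space.dim (polys_on D :: ('k, 'n) mpoly set)"
    proof (rule mpoly_space.dim_add_card_le[where w = "\<lambda>k. k", OF sub _ polys_on_subset_span fin(2) K(1)])
      show "independent_mod scl ?V K (\<lambda>k. k)"
        unfolding independent_mod_def
      proof (intro allI impI ballI)
        fix c k assume s: "(\<Sum>k\<in>K. scl (c k) k) \<in> ?V" and k: "k \<in> K"
        then have "(\<Sum>k\<in>K. scl (c k) k) \<in> mat_act g ` mpoly_space.span X"
          using mat_act_image_inter_polys_on_le[OF g, of J E] X(3) DP by blast
        then obtain d where d: "(\<Sum>k\<in>K. scl (c k) k) = mat_act g (\<Sum>x\<in>X. scl (d x) x)"
          unfolding mpoly_space.span_finite[OF X(1)] by auto
        have "(\<Sum>i\<in>K <+> X. scl (case_sum c (\<lambda>x. - d x) i) (w g i)) = 0"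
          unfolding sumw old.sum.simps
          using d mat_act.map_minus[of g 0 "\<Sum>x\<in>X. scl (d x) x"]
          by (simp add: mpoly_space.scale_minus_left sum_negf mat_act.map_zero)
        from independent_mod_zeroD[OF ind this, of "Inl k"] show "c k = 0" using k by auto
      qed
    qed (use K(2) in auto)
    then show "invertible g \<and> mpoly_space.dim ?V \<le> mpoly_space.dim ?U" using g K(4) by simp
  qed
qed

lemma dim_mat_act_generically_least:
  fixes J :: "('k::field_char_0, 'n::{finite,linorder}) mpoly set"
  assumes "mpoly_space.subspace J" "finite D"
  shows "generic (\<lambda>g. invertible g \<and> (\<forall>h. invertible h \<longrightarrow>
    mpoly_space.dim (mat_act g ` J \<inter> polys_on D) \<le> mpoly_space.dim (mat_act h ` J \<inter> polys_on D)))"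
proof -
  obtain h where h: "invertible h" "\<And>g. invertible g \<Longrightarrow>
      mpoly_space.dim (mat_act h ` J \<inter> polys_on D) \<le> mpoly_space.dim (mat_act g ` J \<inter> polys_on D)"
    using ex_has_least_nat[of invertible "mat 1"
        "\<lambda>h. mpoly_space.dim (mat_act h ` J \<inter> polys_on D)"]
    by (auto simp: invertible_det_nz)
  show ?thesis
    by (rule generic_mono[OF dim_mat_act_generically_le[OF assms h(1)]]) (use h(2) le_trans in blast)
qed

lemma forms_subset_mat_act_image:
  fixes J :: "('k::field, 'n::finite) mpoly set"
  assumes "invertible g" "forms e \<subseteq> J"
  shows "forms e \<subseteq> mat_act g ` J"
proof
  fix x :: "('k, 'n) mpoly" assume "x \<in> forms e"
  then have "homogeneous e (mat_act h x)" for h by (simp add: in_forms homogeneous_mat_act)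
  then show "x \<in> mat_act g ` J"
    using invertible_mat_act[OF assms(1)] assms(2) by (metis imageI in_forms subset_iff)
qed

text \<open>Galligo's theorem for ideals containing all forms of large degree, with the minimality
  that characterizes generic matrices. The degree \<open>E\<close> is free because minimality will
  be applied in degrees that grow with the exponent of a pure power.\<close>

lemma gin_generic:
  fixes J :: "('k::field_char_0, 'n::{finite,linorder}) mpoly set"
  assumes J: "is_ideal J" and s: "\<And>e. s \<le> e \<Longrightarrow> forms e \<subseteq> J"
  shows "generic (\<lambda>g. invertible g \<and> initial_ideal (mat_act g ` J) = gin J \<and>
    (\<forall>D h. D \<subseteq> {a. mdeg a \<le> E} \<longrightarrow> revlex_closed D \<longrightarrow> invertible h \<longrightarrow>
      card (lead_monoms (mat_act g ` J) \<inter> D) \<le> card (lead_monoms (mat_act h ` J) \<inter> D)))"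
proof -
  \<comment> \<open>Above degree \<open>s\<close> all monomials are leading, so finitely many lower
    sets suffice and one generic condition covers them all.\<close>
  define \<D> where "\<D> = {D. D \<subseteq> {a::'n monom. mdeg a \<le> max E s} \<and> revlex_closed D}"
  have fin\<D>: "finite \<D>" unfolding \<D>_def
    by (rule finite_subset[of _ "Pow {a. mdeg a \<le> max E s}"]) (auto simp: finite_mdeg_le)
  have fD: "finite D" if "D \<in> \<D>" for D
    using that finite_subset[OF _ finite_mdeg_le] by (auto simp: \<D>_def)
  have cD: "card (lead_monoms (mat_act g ` J) \<inter> D) = mpoly_space.dim (mat_act g ` J \<inter> polys_on D)"
    if "invertible g" "D \<in> \<D>" for g D
    using that fD by (intro card_lead_monoms subspace_ideal is_ideal_mat_act_image J) (auto simp: \<D>_def)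
  define Q where "Q = (\<lambda>g. invertible g \<and> (\<forall>D\<in>\<D>. \<forall>h. invertible h \<longrightarrow>
    card (lead_monoms (mat_act g ` J) \<inter> D) \<le> card (lead_monoms (mat_act h ` J) \<inter> D)))"
  have genQ: "generic Q"
  proof -
    have "generic (\<lambda>g. invertible g \<and> (\<forall>D\<in>\<D>. invertible g \<and> (\<forall>h. invertible h \<longrightarrow>
      mpoly_space.dim (mat_act g ` J \<inter> polys_on D) \<le> mpoly_space.dim (mat_act h ` J \<inter> polys_on D))))"
      by (intro generic_conj generic_invertible generic_ball fin\<D> dim_mat_act_generically_least
        subspace_ideal J fD)
    then show ?thesis by (rule generic_mono) (simp add: Q_def cD)
  qed
  have eq: "lead_monoms (mat_act g ` J) = lead_monoms (mat_act h ` J)" if "Q g" "Q h" for g h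
  proof (rule set_eqI)
    fix a
    note inv = that[unfolded Q_def, THEN conjunct1]
    show "a \<in> lead_monoms (mat_act g ` J) \<longleftrightarrow> a \<in> lead_monoms (mat_act h ` J)"
    proof (cases "s \<le> mdeg a")
      case True
      have "mon a \<in> mat_act g ` J" if "invertible g" for g
        using forms_subset_mat_act_image[OF that s[OF True]] homogeneous_mon[of a]
        by (auto simp: in_forms subset_iff)
      then show ?thesis using inv mon_in_lead_monoms by blast
    next
      case False
      let ?D = "{b. revlex_gt a b}"
      have "mdeg b \<le> max E s" if "revlex_gt a b \<or> b = a" for b
        using that False mdeg_le_of_revlex_gt[of a b] by auto
      then have D: "?D \<in> \<D>" "insert a ?D \<in> \<D>"
        using revlex_gt_trans by (auto simp: \<D>_def revlex_closed_def)
      have eqc: "card (lead_monoms (mat_act g ` J) \<inter> D) = card (lead_monoms (mat_act h ` J) \<inter> D)"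
        if "D \<in> \<D>" for D
        using \<open>Q g\<close> \<open>Q h\<close> that unfolding Q_def by (meson antisym)
      \<comment> \<open>Membership of \<open>a\<close> is the jump between two counts, each of which
        takes the same least value for \<open>g\<close> and \<open>h\<close>.\<close>
      have "a \<in> L \<longleftrightarrow> card (L \<inter> insert a ?D) = Suc (card (L \<inter> ?D))" for L
      proof (cases "a \<in> L")
        case True
        then have "L \<inter> insert a ?D = insert a (L \<inter> ?D)" by auto
        then show ?thesis using True finite_revlex_lt[of a] revlex_gt_irrefl[of a] by simp
      next
        case False
        then have "L \<inter> insert a ?D = L \<inter> ?D" by auto
        then show ?thesis using False by simp
      qed
      then show ?thesis using eqc[OF D(1)] eqc[OF D(2)] by metis
    qed
  qed
  obtain h where h: "Q h" using generic_ex[OF genQ] by blast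
  have i: "initial_ideal (mat_act g ` J) = initial_ideal (mat_act h ` J)" if "Q g" for g
    unfolding initial_ideal_eq eq[OF that h] ..
  have gin: "gin J = initial_ideal (mat_act h ` J)"
    by (rule gin_eqI[OF generic_mono[OF genQ]]) (rule i)
  have "D \<in> \<D>" if "D \<subseteq> {a. mdeg a \<le> E}" "revlex_closed D" for D
    using that by (auto simp: \<D>_def)
  then show ?thesis
    by (intro generic_mono[OF genQ]) (auto simp: gin i Q_def)
qed

section \<open>Noether normalization\<close>

text \<open>Induction on the set \<open>A\<close> of variables, with exponents that are separated by
  their entries in \<open>A\<close>. As a polynomial in the variable \<open>k\<close>, the sum has a
  coefficient that involves only the exponents agreeing with \<open>a\<close> at \<open>k\<close>;
  these are separated by the remaining variables.\<close>

lemma nonzero_value_exists: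
  fixes c :: "'n::finite monom \<Rightarrow> 'k::field_char_0"
  assumes "finite A" "finite T" "a \<in> T" "c a \<noteq> 0"
    and "\<And>a b. a \<in> T \<Longrightarrow> b \<in> T \<Longrightarrow> (\<And>j. j \<in> A \<Longrightarrow> Poly_Mapping.lookup a j = Poly_Mapping.lookup b j) \<Longrightarrow> a = b"
  shows "\<exists>v. (\<Sum>a\<in>T. c a * (\<Prod>j\<in>A. v j ^ Poly_Mapping.lookup a j)) \<noteq> 0"
  using assms
proof (induction A arbitrary: T rule: finite_induct)
  case empty
  then have "T = {a}" by blast
  then show ?case using empty by simp
next
  case (insert k A)
  let ?t = "Poly_Mapping.lookup a k"
  let ?T = "{b \<in> T. Poly_Mapping.lookup b k = ?t}"
  have "\<exists>v. (\<Sum>a\<in>?T. c a * (\<Prod>j\<in>A. v j ^ Poly_Mapping.lookup a j)) \<noteq> 0"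
  proof (rule insert.IH)
    fix b b' assume b: "b \<in> ?T" "b' \<in> ?T"
      and e: "\<And>j. j \<in> A \<Longrightarrow> Poly_Mapping.lookup b j = Poly_Mapping.lookup b' j"
    show "b = b'"
    proof (rule insert.prems(4))
      fix j assume "j \<in> insert k A"
      then show "Poly_Mapping.lookup b j = Poly_Mapping.lookup b' j" using b e by auto
    qed (use b in auto)
  qed (use insert.prems in auto)
  then obtain v where v: "(\<Sum>a\<in>?T. c a * (\<Prod>j\<in>A. v j ^ Poly_Mapping.lookup a j)) \<noteq> 0" by blast
  define q where
    "q = (\<Sum>a\<in>T. monom (c a * (\<Prod>j\<in>A. v j ^ Poly_Mapping.lookup a j)) (Poly_Mapping.lookup a k))"
  have "coeff q ?t = (\<Sum>a\<in>?T. c a * (\<Prod>j\<in>A. v j ^ Poly_Mapping.lookup a j))"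
    unfolding q_def coeff_sum coeff_monom
    by (subst sum.inter_filter[OF insert.prems(1)]) (rule sum.cong, auto)
  then have "q \<noteq> 0" using v by auto
  then have "finite {x. poly q x = 0}" by (rule poly_roots_finite)
  then obtain x where x: "poly q x \<noteq> 0"
    using infinite_UNIV_char_0[where 'a = 'k] by (metis (mono_tags, lifting) UNIV_eq_I mem_Collect_eq)
  have "poly q x = (\<Sum>a\<in>T. c a * (\<Prod>j\<in>insert k A. (v(k := x)) j ^ Poly_Mapping.lookup a j))"
    unfolding q_def poly_sum
  proof (rule sum.cong)
    fix a
    have "(\<Prod>j\<in>A. (v(k := x)) j ^ Poly_Mapping.lookup a j) = (\<Prod>j\<in>A. v j ^ Poly_Mapping.lookup a j)"
      using insert.hyps by (intro prod.cong) auto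
    then show "poly (monom (c a * (\<Prod>j\<in>A. v j ^ Poly_Mapping.lookup a j)) (Poly_Mapping.lookup a k)) x =
        c a * (\<Prod>j\<in>insert k A. (v(k := x)) j ^ Poly_Mapping.lookup a j)"
      using insert.hyps by (simp add: poly_monom)
  qed simp
  then show ?case using x by metis
qed

lemma eval_nonzero_exists:
  fixes F :: "('k::field_char_0, 'n::{finite,linorder}) mpoly"
  assumes "F \<noteq> 0"
  shows "\<exists>v. eval_with id v F \<noteq> 0"
proof -
  have "\<exists>v. (\<Sum>a\<in>Poly_Mapping.keys F. Poly_Mapping.lookup F a *
      (\<Prod>j\<in>UNIV. v j ^ Poly_Mapping.lookup a j)) \<noteq> 0"
    by (rule nonzero_value_exists[where a = "lead_monom F"])
      (use lead_monom(1)[OF assms] in \<open>auto simp: in_keys_iff intro: poly_mapping_eqI\<close>)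
  then show ?thesis by (simp only: eval_with_def id_apply)
qed

text \<open>The substitution \<open>x_k \<mapsto> s x_k\<close> and
  \<open>x_i \<mapsto> x_i + w_i x_k\<close> for the other variables.\<close>

definition shear :: "'n \<Rightarrow> 'k \<Rightarrow> ('n \<Rightarrow> 'k) \<Rightarrow> 'k::field^'n^'n" where
  "shear k s w = (\<chi> i j. if i = k then (if j = k then s else 0)
    else (if i = j then 1 else 0) + (if j = k then w i else 0))"

lemma shear_sum:
  "(\<Sum>j\<in>UNIV. shear k s w $ i $ j * x j) = (if i = k then s * x k else x i + w i * x k)"
  by (simp add: shear_def distrib_right sum.distrib if_distrib[of "\<lambda>y. y * _"] cong: if_cong)

lemma mat_act_shear_var:
  "mat_act (shear k s w) (var i) =
    (if i = k then const s * var k else var i + const (w i) * var k)"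
proof -
  have "(\<Sum>j\<in>UNIV. const (shear k s w $ i $ j) * var j) = (\<Sum>j\<in>UNIV.
      if i = k then (if j = k then const s * var j else 0)
      else (if i = j then var j else 0) + (if j = k then const (w i) * var j else 0))"
    by (rule sum.cong) (auto simp: shear_def const_add distrib_right)
  then show ?thesis by (simp add: mat_act_var sum.distrib)
qed

lemma shear_mult_shear:
  fixes w :: "'n::finite \<Rightarrow> 'k::field"
  assumes "s \<noteq> 0"
  shows "shear k s w ** shear k (1 / s) (\<lambda>i. - w i / s) = mat 1"
  using assms
  by (simp add: matrix_matrix_mult_def vec_eq_iff shear_sum)
    (auto simp: shear_def mat_def)

lemma invertible_shear:
  fixes w :: "'n::finite \<Rightarrow> 'k::field"
  assumes "s \<noteq> 0"
  shows "invertible (shear k s w)"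
proof -
  have "shear k (1 / s) (\<lambda>i. - w i / s) ** shear k s w = mat 1"
    using shear_mult_shear[of "1 / s" k "\<lambda>i. - w i / s"] assms by simp
  then show ?thesis unfolding invertible_def using shear_mult_shear[OF assms] by blast
qed

lemma ideal_cong_mult:
  assumes "is_ideal R" "x - y \<in> R" "u - v \<in> R"
  shows "x * u - y * v \<in> R"
proof -
  have "x * u - y * v = (x - y) * u + y * (u - v)" by (simp add: algebra_simps)
  then show ?thesis using assms by (simp add: ideal_add ideal_mult_left ideal_mult_right)
qed

lemma ideal_cong_power: "is_ideal R \<Longrightarrow> x - y \<in> R \<Longrightarrow> x ^ n - y ^ n \<in> R"
  by (induction n) (auto simp: ideal_zero intro: ideal_cong_mult)

lemma ideal_cong_prod:
  assumes "is_ideal R" "\<And>j. j \<in> A \<Longrightarrow> x j - y j \<in> R"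
  shows "(\<Prod>j\<in>A. x j) - (\<Prod>j\<in>A. y j) \<in> R"
  using assms
  by (induction A rule: infinite_finite_induct) (auto simp: ideal_zero intro: ideal_cong_mult)

lemma ideal_const_cancel:
  fixes c :: "'k::field"
  assumes "is_ideal R" "c \<noteq> 0" "const c * x \<in> R"
  shows "x \<in> R"
proof -
  have "const (1 / c) * (const c * x) = x"
    using assms(2) by (simp flip: mult.assoc const_mult)
  then show ?thesis using ideal_mult_left[OF assms(1,3), of "const (1 / c)"] by simp
qed

lemma monom_split:
  fixes a :: "'n::finite monom"
  assumes "n \<le> mdeg a"
  obtains b c where "a = b + c" "mdeg b = n"
proof -
  have "\<exists>b c. a = b + c \<and> mdeg b = n" using assms
  proof (induction n)
    case 0
    then show ?case by (intro exI[of _ 0] exI[of _ a]) simp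
  next
    case (Suc n)
    then obtain b c where bc: "a = b + c" "mdeg b = n" by auto
    then have "mdeg c \<noteq> 0" using Suc.prems by auto
    then obtain i where i: "Poly_Mapping.lookup c i \<noteq> 0" by (auto simp: mdeg_def)
    have "c = Poly_Mapping.single i 1 + (c - Poly_Mapping.single i 1)"
      by (rule poly_mapping_eqI) (use i in \<open>auto simp: lookup_add lookup_minus lookup_single when_def\<close>)
    then have "a = (b + Poly_Mapping.single i 1) + (c - Poly_Mapping.single i 1)"
      using bc(1) by (simp add: add.assoc)
    moreover have "mdeg (b + Poly_Mapping.single i 1) = Suc n" using bc(2) by simp
    ultimately show ?case by blast
  qed
  then show ?thesis using that by blast
qed

lemma forms_subsetI:
  assumes "mpoly_space.subspace M" "\<And>a. mdeg a = e \<Longrightarrow> mon a \<in> M"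
  shows "forms e \<subseteq> M"
proof -
  have "mpoly_space.span (mon ` {a. mdeg a = e}) \<subseteq> M"
    by (rule mpoly_space.span_minimal[OF _ assms(1)]) (use assms(2) in auto)
  then show ?thesis using polys_on_subset_span by blast
qed

text \<open>
  The inductive step of Noether normalization: the shear turns the relation \<open>F\<close> into an equation
  making \<open>x\<^sub>k\<close> nilpotent modulo the remaining variables.
\<close>

lemma eliminate_variable:
  fixes J :: "('k::field_char_0, 'n::{finite,linorder}) mpoly set"
  assumes mon: "\<And>a. s \<le> mdeg a \<Longrightarrow> mon a \<in> ideal_gen (J \<union> var ` insert k A)" and k: "k \<notin> A"
    and F: "F \<in> J" "F \<noteq> 0" "homogeneous e F"
    and supp: "\<And>a j. a \<in> Poly_Mapping.keys F \<Longrightarrow> j \<notin> insert k A \<Longrightarrow> Poly_Mapping.lookup a j = 0"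
  shows "\<exists>h. invertible h \<and>
    (\<forall>a. e * s \<le> mdeg a \<longrightarrow> mon a \<in> ideal_gen (mat_act h ` J \<union> var ` A))"
proof -
  \<comment> \<open>The additional factor provides a point where \<open>F\<close> does not vanish
    and the coordinate \<open>v k\<close> is nonzero as well, so that the shear is
    invertible.\<close>
  have "F * var k \<noteq> 0" unfolding var_def by (rule lead_monom_mult(1)[OF F(2) mon_nonzero])
  then obtain v where "eval_with id v (F * var k) \<noteq> 0" using eval_nonzero_exists by blast
  then have v: "eval_with id v F \<noteq> 0" "v k \<noteq> 0"
    unfolding eval_with_id_mult eval_with_id_var by auto
  \<comment> \<open>Only the variables in \<open>A\<close> are sheared. They lie in
    \<open>R\<close>, so modulo \<open>R\<close> every variable in \<open>insert k A\<close> becomes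
    a multiple \<open>v j\<close> of \<open>x_k\<close>, and \<open>F\<close> becomes its value at
    \<open>v\<close> times \<open>x_k^e\<close>.\<close>
  define h where "h = shear k (v k) (\<lambda>i. if i \<in> A then v i else 0)"
  have h: "invertible h" unfolding h_def by (rule invertible_shear[OF v(2)])
  define R where "R = ideal_gen (mat_act h ` J \<union> var ` A)"
  have R: "is_ideal R" by (simp add: R_def is_ideal_ideal_gen)
  have varR: "var j \<in> R" if "j \<in> A" for j unfolding R_def using that by (intro ideal_gen_base) auto
  have cv: "mat_act h (var j) - const (v j) * var k \<in> R" if "j \<in> insert k A" for j
    using that k varR ideal_zero[OF R] by (auto simp: h_def mat_act_shear_var)
  have cm: "mat_act h (mon a) - const (\<Prod>j\<in>UNIV. v j ^ Poly_Mapping.lookup a j) * var k ^ e \<in> R"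
    if a: "a \<in> Poly_Mapping.keys F" for a
  proof -
    have e: "e = (\<Sum>j\<in>UNIV. Poly_Mapping.lookup a j)"
      using F(3) a by (auto simp: homogeneous_def mdeg_def)
    have "(\<Prod>j\<in>UNIV. mat_act h (var j) ^ Poly_Mapping.lookup a j) -
        (\<Prod>j\<in>UNIV. (const (v j) * var k) ^ Poly_Mapping.lookup a j) \<in> R"
    proof (rule ideal_cong_prod[OF R])
      fix j
      show "mat_act h (var j) ^ Poly_Mapping.lookup a j - (const (v j) * var k) ^ Poly_Mapping.lookup a j \<in> R"
      proof (cases "j \<in> insert k A")
        case True
        then show ?thesis by (intro ideal_cong_power R cv)
      next
        case False
        then show ?thesis using supp[OF a] ideal_zero[OF R] by simp
      qed
    qed
    moreover have "(\<Prod>j\<in>UNIV. (const (v j) * var k) ^ Poly_Mapping.lookup a j) =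
        const (\<Prod>j\<in>UNIV. v j ^ Poly_Mapping.lookup a j) * var k ^ e"
      by (simp add: power_mult_distrib prod.distrib e power_sum
        comm_ring_map.map_prod[OF comm_ring_map_const] comm_ring_map.map_power[OF comm_ring_map_const])
    ultimately show ?thesis by (simp add: mon_eq_prod mat_act.map_prod mat_act.map_power)
  qed
  have pk: "var k ^ e \<in> R"
  proof -
    let ?c = "\<lambda>a. Poly_Mapping.lookup F a" and ?v = "\<lambda>a. \<Prod>j\<in>UNIV. v j ^ Poly_Mapping.lookup a j"
    have "mat_act h F - const (eval_with id v F) * var k ^ e =
        (\<Sum>a\<in>Poly_Mapping.keys F. const (?c a) * (mat_act h (mon a) - const (?v a) * var k ^ e))"
    proof -
      have "mat_act h F = (\<Sum>a\<in>Poly_Mapping.keys F. const (?c a) * mat_act h (mon a))"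
        by (subst mpoly_eq_sum[of "Poly_Mapping.keys F" F])
          (auto simp: mat_act.map_sum mat_act.map_mult)
      moreover have "const (eval_with id v F) * var k ^ e =
          (\<Sum>a\<in>Poly_Mapping.keys F. const (?c a) * (const (?v a) * var k ^ e))"
        unfolding eval_with_def id_apply comm_ring_map.map_sum[OF comm_ring_map_const]
        by (simp add: const_mult sum_distrib_right mult.assoc)
      ultimately show ?thesis by (simp add: right_diff_distrib sum_subtractf)
    qed
    also have "\<dots> \<in> R" by (intro ideal_sum[OF R] ideal_mult_left[OF R] cm)
    finally have "mat_act h F - const (eval_with id v F) * var k ^ e \<in> R" .
    moreover have "mat_act h F \<in> R" unfolding R_def using F(1) by (intro ideal_gen_base) auto
    ultimately have "mat_act h F - (mat_act h F - const (eval_with id v F) * var k ^ e) \<in> R"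
      by (rule ideal_diff[OF R, rotated])
    then have "const (eval_with id v F) * var k ^ e \<in> R" by simp
    then show ?thesis by (rule ideal_const_cancel[OF R v(1)])
  qed
  \<comment> \<open>\<open>R\<close> enlarged by \<open>x_k\<close> contains the image of the ideal
    in the hypothesis. As \<open>h\<close> maps the forms of each degree onto themselves, monomials
    of degree at least \<open>s\<close> lie in \<open>R'\<close>.\<close>
  define R' where "R' = ideal_gen (mat_act h ` J \<union> var ` insert k A)"
  have R': "is_ideal R'" by (simp add: R'_def is_ideal_ideal_gen)
  have R'_eq: "R' = {y + var k * z |y z. y \<in> R}"
    by (simp add: R'_def R_def ideal_gen_insert)
  have RR': "R \<subseteq> R'" unfolding R_def R'_def by (rule ideal_gen_mono) auto
  have mR': "mon a \<in> R'" if a: "s \<le> mdeg a" for a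
  proof -
    let ?M = "{x. mat_act h x \<in> R'}"
    have M: "is_ideal ?M"
      by (rule is_idealI)
        (auto simp: mat_act.map_zero mat_act.map_add mat_act.map_mult ideal_zero[OF R']
          ideal_add[OF R'] ideal_mult_left[OF R'])
    have kR': "var k \<in> R'" unfolding R'_def by (rule ideal_gen_base) auto
    have sub: "ideal_gen (J \<union> var ` insert k A) \<subseteq> ?M"
    proof (rule ideal_gen_minimal[OF _ M])
      have "mat_act h (var j) \<in> R'" if "j \<in> insert k A" for j
      proof -
        have "(mat_act h (var j) - const (v j) * var k) + const (v j) * var k \<in> R'"
          using cv[OF that] RR' by (intro ideal_add[OF R'] ideal_mult_left[OF R'] kR') auto
        then show ?thesis by simp
      qed
      moreover have "mat_act h x \<in> R'" if "x \<in> J" for x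
        unfolding R'_def using that by (intro ideal_gen_base) auto
      ultimately show "J \<union> var ` insert k A \<subseteq> ?M" by auto
    qed
    have "forms (mdeg a) \<subseteq> ?M"
      by (rule forms_subsetI[OF subspace_ideal[OF M]], rule subsetD[OF sub], rule mon) (simp add: a)
    moreover obtain h' where "\<And>f. mat_act h (mat_act h' f) = f"
      using invertible_mat_act[OF h] by metis
    moreover have "mat_act h' (mon a) \<in> forms (mdeg a)" for h'
      by (simp add: in_forms homogeneous_mat_act_mon)
    ultimately show ?thesis by (metis (mono_tags, lifting) mem_Collect_eq subset_iff)
  qed
  \<comment> \<open>A monomial of degree at least \<open>t * s\<close> has \<open>t\<close> factors
    of degree \<open>s\<close>, each lying in \<open>R\<close> up to a multiple of
    \<open>x_k\<close>. Their product lies in \<open>R\<close> up to a multiple of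
    \<open>x_k^t\<close>, and \<open>t = e\<close> suffices.\<close>
  have power: "\<exists>y z. y \<in> R \<and> mon a = y + var k ^ t * z" if "t * s \<le> mdeg a" for t a
    using that
  proof (induction t arbitrary: a)
    case 0
    then show ?case using ideal_zero[OF R] by (intro exI[of _ 0] exI[of _ "mon a"]) simp
  next
    case (Suc t)
    then have "s \<le> mdeg a" by simp
    then obtain b c where bc: "a = b + c" "mdeg b = s" by (rule monom_split)
    then have "t * s \<le> mdeg c" using Suc.prems by simp
    then obtain y z where yz: "y \<in> R" "mon c = y + var k ^ t * z" using Suc.IH by blast
    have "mon b \<in> R'" by (rule mR') (simp add: bc(2))
    then obtain y' z' where yz': "y' \<in> R" "mon b = y' + var k * z'" unfolding R'_eq by blast
    have "mon a = (y' * mon c + var k * z' * y) + var k ^ Suc t * (z' * z)"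
      unfolding bc(1) mon_add yz(2) yz'(2) by (simp add: algebra_simps)
    moreover have "y' * mon c + var k * z' * y \<in> R"
      by (intro ideal_add[OF R] ideal_mult_left[OF R] ideal_mult_right[OF R] yz(1) yz'(1))
    ultimately show ?case by blast
  qed
  have "mon a \<in> R" if a: "e * s \<le> mdeg a" for a
  proof -
    obtain y z where "y \<in> R" "mon a = y + var k ^ e * z" using power[OF a] by blast
    then show ?thesis by (simp add: ideal_add[OF R] ideal_mult_right[OF R pk])
  qed
  then show ?thesis using h unfolding R_def by blast
qed

section \<open>Counting monomials and producing relations\<close>

lemma card_monom_box:
  fixes S :: "'n::finite \<Rightarrow> nat set"
  assumes "\<And>j. finite (S j)"
  shows "finite {a::'n monom. \<forall>j. Poly_Mapping.lookup a j \<in> S j}"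
    and "card {a. \<forall>j. Poly_Mapping.lookup a j \<in> S j} = (\<Prod>j\<in>UNIV. card (S j))"
proof -
  have e: "{a. \<forall>j. Poly_Mapping.lookup a j \<in> S j} = monom_of ` PiE UNIV S"
  proof (intro equalityI subsetI)
    fix a assume a: "a \<in> {a. \<forall>j. Poly_Mapping.lookup a j \<in> S j}"
    have "a = monom_of (Poly_Mapping.lookup a)" by (rule poly_mapping_eqI) simp
    then show "a \<in> monom_of ` PiE UNIV S" using a by (intro image_eqI) auto
  qed auto
  show "finite {a. \<forall>j. Poly_Mapping.lookup a j \<in> S j}"
    unfolding e by (intro finite_imageI finite_PiE assms) simp
  have "inj_on monom_of (PiE UNIV S)"
    by (rule inj_onI) (metis lookup_monom_of)
  then show "card {a. \<forall>j. Poly_Mapping.lookup a j \<in> S j} = (\<Prod>j\<in>UNIV. card (S j))"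
    unfolding e by (simp add: card_image card_PiE)
qed

lemma card_mdeg_le_eq_sum:
  "card {a::'n::finite monom. mdeg a \<le> E \<and> Q a} = (\<Sum>e\<le>E. card {a. mdeg a = e \<and> Q a})"
proof -
  have "{a::'n monom. mdeg a \<le> E \<and> Q a} = (\<Union>e\<in>{..E}. {a. mdeg a = e \<and> Q a})" by auto
  moreover have "finite {a::'n monom. mdeg a = e \<and> Q a}" for e
    by (rule finite_subset[OF _ finite_mdeg_eq[of e]]) blast
  ultimately show ?thesis by (simp only:) (subst card_UN_disjoint, auto)
qed

text \<open>Summed over degrees up to a bound, the right-hand count grows with exponent
  \<open>card A\<close> and the left-hand one with exponent \<open>card (- B)\<close>. The reverse
  inequality in every degree would contradict this.\<close>

lemma more_monoms_than_residues:
  fixes d :: "'n::finite \<Rightarrow> nat" and A B :: "'n set"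
  assumes "card (- B) < card A"
  shows "\<exists>e. card {a. mdeg a = e \<and> (\<forall>j\<in>B. Poly_Mapping.lookup a j < d j)} <
    card {a. mdeg a = e \<and> (\<forall>j. j \<notin> A \<longrightarrow> Poly_Mapping.lookup a j = 0)}"
proof (rule ccontr)
  assume contra: "\<not> ?thesis"
  define t where "t = card (- B)"
  define c where "c = card A"
  define P where "P = (\<Prod>j\<in>B. d j)"
  \<comment> \<open>Chosen so that the final bound \<open>P * (c * (u + 1)) ^ t\<close> equals
    \<open>u * (u + 1) ^ t\<close>, which is less than \<open>(u + 1) ^ (t + 1)\<close>.\<close>
  define u where "u = P * c ^ t"
  have "(u + 1) ^ (t + 1) \<le> (u + 1) ^ c"
    using assms by (intro power_increasing) (auto simp: t_def c_def)
  also have "(u + 1) ^ c = card {a::'n monom. \<forall>j. Poly_Mapping.lookup a j \<in> (if j \<in> A then {..u} else {0})}"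
    by (subst card_monom_box) (auto simp: c_def if_distrib[of card] prod.If_cases)
  also have "\<dots> \<le> card {a::'n monom. mdeg a \<le> c * u \<and> (\<forall>j. j \<notin> A \<longrightarrow> Poly_Mapping.lookup a j = 0)}"
  proof (rule card_mono)
    show "finite {a::'n monom. mdeg a \<le> c * u \<and> (\<forall>j. j \<notin> A \<longrightarrow> Poly_Mapping.lookup a j = 0)}"
      by (rule finite_subset[OF _ finite_mdeg_le[of "c * u"]]) blast
    show "{a::'n monom. \<forall>j. Poly_Mapping.lookup a j \<in> (if j \<in> A then {..u} else {0})} \<subseteq>
        {a. mdeg a \<le> c * u \<and> (\<forall>j. j \<notin> A \<longrightarrow> Poly_Mapping.lookup a j = 0)}"
    proof clarify
      fix a :: "'n monom" assume a: "\<forall>j. Poly_Mapping.lookup a j \<in> (if j \<in> A then {..u} else {0})"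
      then have z: "\<forall>j. j \<notin> A \<longrightarrow> Poly_Mapping.lookup a j = 0" by (metis singletonD)
      have "\<forall>j\<in>A. Poly_Mapping.lookup a j \<le> u" using a by (metis atMost_iff)
      then have "(\<Sum>j\<in>A. Poly_Mapping.lookup a j) \<le> c * u"
        unfolding c_def using sum_bounded_above[of A "Poly_Mapping.lookup a" u] by simp
      moreover have "mdeg a = (\<Sum>j\<in>A. Poly_Mapping.lookup a j)"
        unfolding mdeg_def by (rule sum.mono_neutral_right) (use z in auto)
      ultimately show "mdeg a \<le> c * u \<and> (\<forall>j. j \<notin> A \<longrightarrow> Poly_Mapping.lookup a j = 0)"
        using z by simp
    qed
  qed
  also have "\<dots> \<le> card {a::'n monom. mdeg a \<le> c * u \<and> (\<forall>j\<in>B. Poly_Mapping.lookup a j < d j)}"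
    unfolding card_mdeg_le_eq_sum using contra by (intro sum_mono) (simp add: not_less)
  also have "\<dots> \<le> card {a. \<forall>j. Poly_Mapping.lookup a j \<in> (if j \<in> B then {..<d j} else {..c * u})}"
    by (rule card_mono, rule card_monom_box) (auto intro: le_trans[OF lookup_le_mdeg])
  also have "\<dots> = P * (c * u + 1) ^ t"
    by (subst card_monom_box) (auto simp: P_def t_def if_distrib[of card] prod.If_cases)
  also have "\<dots> \<le> P * (c * (u + 1)) ^ t"
    using assms by (intro mult_left_mono power_mono) (auto simp: c_def)
  also have "\<dots> = u * (u + 1) ^ t"
    unfolding power_mult_distrib by (simp only: u_def mult.assoc)
  finally show False by simp
qed

context homogeneous_regular_sequence
begin

text \<open>By \<open>hilbert_function\<close> there is a degree in which the monomials in the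
  variables of \<open>A\<close> outnumber the dimension of the forms modulo the \<open>f j\<close>
  with \<open>j\<close> in \<open>B\<close>. Their preimages under \<open>g\<close> are dependent
  modulo these \<open>f j\<close>, and \<open>g\<close> carries the dependency to
  \<open>F\<close>.\<close>

lemma relation_exists:
  assumes "is_ideal J" "invertible g" "\<And>j. j \<in> B \<Longrightarrow> f j \<in> J"
    and B: "\<And>i j. i \<in> B \<Longrightarrow> j < i \<Longrightarrow> j \<in> B" and A: "card (- B) < card A"
  shows "\<exists>F e. F \<in> mat_act g ` J \<and> F \<noteq> 0 \<and> homogeneous e F \<and>
    (\<forall>a\<in>Poly_Mapping.keys F. \<forall>j. j \<notin> A \<longrightarrow> Poly_Mapping.lookup a j = 0)"
proof -
  obtain h where h: "\<And>x. mat_act g (mat_act h x) = x" using invertible_mat_act[OF assms(2)] by metis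
  obtain e where e: "card {a. mdeg a = e \<and> (\<forall>j\<in>B. Poly_Mapping.lookup a j < d j)} <
      card {a. mdeg a = e \<and> (\<forall>j. j \<notin> A \<longrightarrow> Poly_Mapping.lookup a j = 0)}" (is "_ < card ?T")
    using more_monoms_than_residues[OF A, of d] by blast
  have T: "finite ?T" by (rule finite_subset[OF _ finite_mdeg_eq[of e]]) blast
  let ?K = "ideal_gen (f ` B)"
  have K: "is_ideal ?K" "?K \<subseteq> J"
    using is_ideal_ideal_gen ideal_gen_minimal[of "f ` B", OF _ assms(1)] assms(3) by blast+
  let ?w = "\<lambda>a. mat_act h (mon a)"
  have "\<not> independent_mod scl (?K \<inter> forms e) ?T ?w"
  proof
    assume i: "independent_mod scl (?K \<inter> forms e) ?T ?w"
    have "mpoly_space.dim (?K \<inter> forms e) + card ?T \<le> mpoly_space.dim (forms e :: ('k, 'n) mpoly set)"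
    proof (rule mpoly_space.dim_add_card_le[OF _ _ polys_on_subset_span _ T _ i])
      show "mpoly_space.subspace (?K \<inter> forms e)"
        by (intro mpoly_space.subspace_inter subspace_ideal K subspace_polys_on)
      show "?w ` ?T \<subseteq> forms e" by (auto simp: in_forms homogeneous_mat_act_mon)
    qed (simp_all add: finite_mdeg_eq)
    then show False using hilbert_function[of B e] B e by (simp add: dim_polys_on finite_mdeg_eq)
  qed
  then obtain c b where c: "(\<Sum>a\<in>?T. scl (c a) (?w a)) \<in> ?K" "b \<in> ?T" "c b \<noteq> 0"
    unfolding independent_mod_def by blast
  define F where "F = (\<Sum>a\<in>?T. scl (c a) (mon a))"
  have hF: "mat_act h F = (\<Sum>a\<in>?T. scl (c a) (?w a))"
    by (simp add: F_def mat_act.map_sum mat_act_scl)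
  have "F \<in> mat_act g ` J"
  proof (rule image_eqI)
    show "F = mat_act g (mat_act h F)" by (simp add: h)
    show "mat_act h F \<in> J" unfolding hF using c(1) K(2) by blast
  qed
  moreover have "F \<noteq> 0" using lookup_sum_mon[OF T c(2), of c] c(3) by (auto simp: F_def)
  moreover have "F \<in> polys_on ?T"
    unfolding F_def by (intro mpoly_space.subspace_sum subspace_polys_on mpoly_space.subspace_scale)
      (simp add: polys_on_def)
  ultimately show ?thesis by (auto simp: polys_on_def homogeneous_def subset_iff)
qed

text \<open>The linear forms are the variables in an upper set \<open>A\<close>, starting from all
  variables and discarding the smallest remaining one until those above \<open>i\<close> are left.
  Each removal is a use of \<open>eliminate_variable\<close>.\<close>

lemma noether_normalization:
  "\<exists>g s. invertible g \<and>
    (\<forall>a. s \<le> mdeg a \<longrightarrow> mon a \<in> ideal_gen (mat_act g ` ideal_gen (f ` {..i}) \<union> var ` {i<..}))"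
proof -
  let ?J = "ideal_gen (f ` {..i})"
  have "\<exists>g s. invertible g \<and> (\<forall>a. s \<le> mdeg a \<longrightarrow> mon a \<in> ideal_gen (mat_act g ` ?J \<union> var ` A))"
    if "{i<..} \<subseteq> A" "\<And>j k. j \<in> A \<Longrightarrow> j < k \<Longrightarrow> k \<in> A" for A
    using that
  proof (induction "card (- A)" arbitrary: A)
    case 0
    then have "- A = {}" by simp
    then have A: "A = UNIV" by blast
    \<comment> \<open>All variables belong to the ideal, so the identity matrix and the bound 1
      serve.\<close>
    have "mon a \<in> ideal_gen (mat_act (mat 1) ` ?J \<union> var ` A)" if a: "1 \<le> mdeg a" for a
    proof -
      obtain b c where bc: "a = b + c" "mdeg b = 1" using a by (rule monom_split)
      then obtain j where j: "Poly_Mapping.lookup b j \<noteq> 0"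
        by (metis mdeg_def sum.neutral zero_neq_one)
      have "b = Poly_Mapping.single j 1 + (b - Poly_Mapping.single j 1)"
        by (rule poly_mapping_eqI) (use j in \<open>auto simp: lookup_add lookup_minus lookup_single when_def\<close>)
      then have "(mon b :: ('k, 'n) mpoly) = var j * mon (b - Poly_Mapping.single j 1)"
        unfolding var_def by (metis mon_add)
      then have "(mon a :: ('k, 'n) mpoly) = var j * (mon (b - Poly_Mapping.single j 1) * mon c)"
        unfolding bc(1) mon_add by (simp add: mult.assoc)
      moreover have "var j \<in> ideal_gen (mat_act (mat 1) ` ?J \<union> var ` A)"
        by (rule ideal_gen_base) (simp add: A)
      ultimately show ?thesis by (simp only: ideal_mult_right[OF is_ideal_ideal_gen])
    qed
    moreover have "invertible (mat 1 :: 'k^_^_)" by (simp add: invertible_det_nz)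
    ultimately show ?case by blast
  next
    case (Suc n)
    define k where "k = Max (- A)"
    have ne: "- A \<noteq> {}" using Suc.hyps(2) by auto
    have k: "k \<notin> A" using Max_in[OF _ ne] by (simp add: k_def)
    have gk: "j \<in> A" if "k < j" for j
    proof (rule ccontr)
      assume "j \<notin> A"
      then have "j \<le> k" unfolding k_def by (intro Max_ge) auto
      then show False using that by simp
    qed
    have ki: "k \<le> i" using k Suc.prems(1) by (auto simp: not_less[symmetric])
    have "n = card (- insert k A)"
    proof -
      have "- A = insert k (- insert k A)" using k by auto
      then have "card (- A) = Suc (card (- insert k A))" by (metis ComplD card_insert_disjoint finite insertI1)
      then show ?thesis using Suc.hyps(2) by simp
    qed
    then have "\<exists>g s. invertible g \<and>
        (\<forall>a. s \<le> mdeg a \<longrightarrow> mon a \<in> ideal_gen (mat_act g ` ?J \<union> var ` insert k A))"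
      by (rule Suc.hyps(1)) (use Suc.prems gk in auto)
    then obtain g s where g: "invertible g"
      "\<And>a. s \<le> mdeg a \<Longrightarrow> mon a \<in> ideal_gen (mat_act g ` ?J \<union> var ` insert k A)" by blast
    \<comment> \<open>Since \<open>k \<le> i\<close>, the set \<open>insert k A\<close> has more
      elements than there are variables above \<open>i\<close>; this is what forces a
      relation.\<close>
    have card: "card (- {..i}) < card (insert k A)"
    proof (rule psubset_card_mono)
      have "- {..i} \<subseteq> A" "k \<notin> - {..i}" using Suc.prems(1) ki by auto
      then show "- {..i} \<subset> insert k A" by blast
    qed simp
    have "\<exists>F e. F \<in> mat_act g ` ?J \<and> F \<noteq> 0 \<and> homogeneous e F \<and>
        (\<forall>a\<in>Poly_Mapping.keys F. \<forall>j. j \<notin> insert k A \<longrightarrow> Poly_Mapping.lookup a j = 0)"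
      by (rule relation_exists[OF is_ideal_ideal_gen g(1) _ _ card]) (auto intro: ideal_gen_base)
    then obtain F e where F: "F \<in> mat_act g ` ?J" "F \<noteq> 0" "homogeneous e F"
      "\<forall>a\<in>Poly_Mapping.keys F. \<forall>j. j \<notin> insert k A \<longrightarrow> Poly_Mapping.lookup a j = 0" by blast
    obtain h where h: "invertible h"
      "\<And>a. e * s \<le> mdeg a \<Longrightarrow> mon a \<in> ideal_gen (mat_act h ` mat_act g ` ?J \<union> var ` A)"
      using eliminate_variable[OF g(2) k F(1-3)] F(4) by blast
    have "mat_act h ` mat_act g ` ?J = mat_act (g ** h) ` ?J"
      by (simp add: image_image mat_act_mat_act)
    moreover have "invertible (g ** h)" using g(1) h(1) by (rule invertible_mult)
    ultimately show ?case using h(2) by metis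
  qed
  from this[of "{i<..}"] show ?thesis by auto
qed

end

section \<open>Pure powers in the generic initial ideals\<close>

lemma ideal_power_mat_act_subset:
  assumes "invertible g"
  shows "ideal_power (mat_act g ` I) n \<subseteq> mat_act g ` ideal_power I n"
proof (induction n)
  case 0
  then show ?case using surj_mat_act[OF assms] by simp
next
  case (Suc n)
  show ?case
    unfolding ideal_power.simps(2)[of "mat_act g ` I"] ideal_mult_def
  proof (rule ideal_gen_minimal[OF _ is_ideal_mat_act_image[OF assms is_ideal_power]], clarify)
    fix x y assume "x \<in> I" "y \<in> ideal_power (mat_act g ` I) n"
    then obtain z where z: "z \<in> ideal_power I n" "y = mat_act g z" using Suc by blast
    have "x * z \<in> ideal_power I (Suc n)"
      using \<open>x \<in> I\<close> z(1) by (auto simp: ideal_mult_def intro: ideal_gen_base)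
    then show "mat_act g x * y \<in> mat_act g ` ideal_power I (Suc n)"
      unfolding z(2) mat_act.map_mult[symmetric] by (rule imageI)
  qed
qed

lemma dim_mat_act_image_le:
  fixes J :: "('k::field, 'n::finite) mpoly set"
  assumes "invertible g" "mpoly_space.subspace J"
  shows "mpoly_space.dim (mat_act g ` J \<inter> polys_on {a. mdeg a \<le> E}) \<le>
    mpoly_space.dim (J \<inter> polys_on {a. mdeg a \<le> E})"
proof -
  let ?P = "polys_on {a::'n monom. mdeg a \<le> E} :: ('k, 'n) mpoly set"
  have fin: "finite (mon ` {a::'n monom. mdeg a \<le> E} :: ('k, 'n) mpoly set)"
    by (simp add: finite_mdeg_le)
  have "mpoly_space.subspace (J \<inter> ?P)"
    by (intro mpoly_space.subspace_inter assms(2) subspace_polys_on)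
  then obtain X where X: "finite X" "mpoly_space.span X = J \<inter> ?P" "card X = mpoly_space.dim (J \<inter> ?P)"
    by (rule mpoly_space.finite_basis_in_span[OF _ _ fin]) (use polys_on_subset_span in blast)+
  have "mpoly_space.dim (mat_act g ` J \<inter> ?P) \<le> card (mat_act g ` X)"
    by (rule mpoly_space.dim_le_card)
      (use X mat_act_image_inter_polys_on_le[OF assms(1), of J E] mat_act_span[of g X] in auto)
  also have "\<dots> \<le> card X" by (rule card_image_le[OF X(1)])
  finally show ?thesis using X(3) by simp
qed

lemma subspace_mat_act_image:
  "mpoly_space.subspace J \<Longrightarrow> mpoly_space.subspace (mat_act g ` J)"
  using mat_act_span[of g J] mpoly_space.subspace_span[of "mat_act g ` J"]
  by (simp add: mpoly_space.span_eq_iff[THEN iffD2])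

text \<open>A change of coordinates preserves the total count up to a degree, in contrast to the
  counts on smaller lower sets.\<close>

lemma dim_mat_act_image_eq:
  fixes J :: "('k::field, 'n::finite) mpoly set"
  assumes "invertible g" "mpoly_space.subspace J"
  shows "mpoly_space.dim (mat_act g ` J \<inter> polys_on {a. mdeg a \<le> E}) =
    mpoly_space.dim (J \<inter> polys_on {a. mdeg a \<le> E})"
proof -
  obtain h where h: "invertible h" "\<And>f. mat_act h (mat_act g f) = f"
    using invertible_mat_act[OF assms(1)] by metis
  have "mat_act h ` mat_act g ` J = J" by (simp add: image_image h(2))
  then show ?thesis
    using dim_mat_act_image_le[OF assms, of E]
      dim_mat_act_image_le[OF h(1) subspace_mat_act_image[OF assms(2)], of g E] by simp
qed

text \<open>The comparison is decided at the last variable dividing \<open>b\<close>, which lies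
  beyond \<open>i\<close> and does not divide \<open>a\<close>.\<close>

lemma revlex_gt_pure_power:
  fixes a b :: "'n::{finite,linorder} monom"
  assumes "mdeg a = mdeg b" "\<And>j. i < j \<Longrightarrow> Poly_Mapping.lookup a j = 0"
    and "i < j" "0 < Poly_Mapping.lookup b j"
  shows "revlex_gt a b"
proof -
  define k where "k = Max {j. 0 < Poly_Mapping.lookup b j}"
  have k: "0 < Poly_Mapping.lookup b k" "j \<le> k"
    using Max_in[of "{j. 0 < Poly_Mapping.lookup b j}"] Max_ge[of "{j. 0 < Poly_Mapping.lookup b j}" j]
      assms(4) by (auto simp: k_def)
  have "Poly_Mapping.lookup b l = 0" if "k < l" for l
  proof (rule ccontr)
    assume "Poly_Mapping.lookup b l \<noteq> 0"
    then have "l \<le> k" unfolding k_def by (intro Max_ge) auto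
    then show False using that by simp
  qed
  then have "\<forall>l>k. Poly_Mapping.lookup a l = Poly_Mapping.lookup b l"
    using assms(2,3) k(2) by (metis le_less_trans less_trans not_le)
  moreover have "Poly_Mapping.lookup a k < Poly_Mapping.lookup b k"
    using assms(2)[of k] assms(3) k by auto
  ultimately show ?thesis using assms(1) unfolding revlex_gt_def by blast
qed

context homogeneous_regular_sequence
begin

lemma forms_subset_ideal_power:
  assumes "n * Suc (\<Sum>j\<in>UNIV. d j) \<le> e"
  shows "forms e \<subseteq> ideal_power I n"
proof -
  have "mon a \<in> ideal_power I n" if "n * Suc (\<Sum>j\<in>UNIV. d j) \<le> mdeg a" for a
    using that
  proof (induction n arbitrary: a)
    case (Suc n)
    have "Suc (\<Sum>j\<in>UNIV. d j) \<le> mdeg a" using Suc.prems by simp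
    then obtain b c where bc: "a = b + c" "mdeg b = Suc (\<Sum>j\<in>UNIV. d j)" by (rule monom_split)
    have "mon b \<in> I"
      using forms_subset_ideal[of "mdeg b"] homogeneous_mon[of b] bc(2) by (auto simp: in_forms subset_iff)
    moreover have "mon c \<in> ideal_power I n" using Suc.prems bc by (intro Suc.IH) simp
    ultimately show ?case
      unfolding bc(1) mon_add by (auto simp: ideal_mult_def intro: ideal_gen_base)
  qed simp
  then show ?thesis using assms by (intro forms_subsetI subspace_ideal is_ideal_power) auto
qed

text \<open>Each step writes a form by the images of the \<open>f j\<close> with
  \<open>j \<le> i\<close> and the later variables. The cofactors of the former lose degree
  \<open>d j\<close>, at most \<open>d i\<close>, and so remain large enough for the induction on
  \<open>n\<close>.\<close>

lemma form_in_power_mod_variables: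
  assumes g: "invertible g" and d: "\<And>j. j \<le> i \<Longrightarrow> d j \<le> d i"
    and s: "\<And>a. s \<le> mdeg a \<Longrightarrow> mon a \<in> ideal_gen (mat_act g ` ideal_gen (f ` {..i}) \<union> var ` {i<..})"
    and x: "homogeneous e x" and e: "s + n * d i \<le> e"
  shows "\<exists>l. homogeneous e l \<and> (\<forall>b\<in>Poly_Mapping.keys l. \<exists>j>i. 0 < Poly_Mapping.lookup b j) \<and>
    x - l \<in> ideal_power (mat_act g ` I) n"
  using x e
proof (induction n arbitrary: e x)
  case 0
  then show ?case by (intro exI[of _ 0]) simp
next
  case (Suc n)
  \<comment> \<open>The two kinds of generators are merged into one family indexed by the variables,
    with degrees \<delta>, so that \<open>homogeneous_split\<close> applies.\<close>
  define p where "p = (\<lambda>j. if j \<le> i then mat_act g (f j) else var j)"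
  define \<delta> where "\<delta> = (\<lambda>j. if j \<le> i then d j else 1)"
  let ?K = "ideal_power (mat_act g ` I)"
  define L where "L = {l :: ('k, 'n) mpoly. \<forall>b\<in>Poly_Mapping.keys l. \<exists>j>i. 0 < Poly_Mapping.lookup b j}"
  have L: "is_ideal L"
  proof (rule is_idealI)
    fix c y assume y: "y \<in> L"
    have "\<exists>j>i. 0 < Poly_Mapping.lookup b j" if b: "b \<in> Poly_Mapping.keys (c * y)" for b
    proof -
      obtain a a' where "b = a + a'" "a' \<in> Poly_Mapping.keys y" using keys_mult[of c y] b by blast
      then show ?thesis using y by (fastforce simp: L_def lookup_add)
    qed
    then show "c * y \<in> L" by (simp add: L_def)
  next
    fix y z assume "y \<in> L" "z \<in> L"
    then show "y + z \<in> L" using keys_add[of y z] by (auto simp: L_def)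
  qed (simp add: L_def)
  have hom: "homogeneous (\<delta> j) (p j)" for j
    using homogeneous_mat_act[OF homog] homogeneous_var by (auto simp: p_def \<delta>_def)
  have pI: "p j \<in> mat_act g ` I" if "j \<le> i" for j
    using that by (auto simp: p_def intro: ideal_gen_base)
  have pL: "p j \<in> L" if "\<not> j \<le> i" for j
    using that by (auto simp: p_def L_def var_def lookup_single intro!: exI[of _ j])
  have sub: "ideal_gen (mat_act g ` ideal_gen (f ` {..i}) \<union> var ` {i<..}) \<subseteq> ideal_gen (range p)"
  proof (rule ideal_gen_minimal[OF _ is_ideal_ideal_gen], rule Un_least)
    let ?M = "{y. mat_act g y \<in> ideal_gen (range p)}"
    have "ideal_gen (f ` {..i}) \<subseteq> ?M"
    proof (rule ideal_gen_minimal)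
      show "is_ideal ?M"
        by (rule is_idealI)
          (auto simp: mat_act.map_zero mat_act.map_add mat_act.map_mult ideal_zero[OF is_ideal_ideal_gen]
            ideal_add[OF is_ideal_ideal_gen] ideal_mult_left[OF is_ideal_ideal_gen])
      show "f ` {..i} \<subseteq> ?M"
      proof clarify
        fix j assume "j \<le> i"
        then have "mat_act g (f j) = p j" by (simp add: p_def)
        then show "mat_act g (f j) \<in> ideal_gen (range p)" by (simp add: ideal_gen_base)
      qed
    qed
    then show "mat_act g ` ideal_gen (f ` {..i}) \<subseteq> ideal_gen (range p)" by auto
    show "var ` {i<..} \<subseteq> ideal_gen (range p)"
    proof clarify
      fix j assume "i < j"
      then have "var j = p j" by (auto simp: p_def)
      then show "var j \<in> ideal_gen (range p)" by (simp add: ideal_gen_base)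
    qed
  qed
  have "forms e \<subseteq> ideal_gen (range p)"
  proof (rule forms_subsetI[OF subspace_ideal[OF is_ideal_ideal_gen]], rule subsetD[OF sub], rule s)
    fix a :: "'n monom" assume "mdeg a = e"
    then show "s \<le> mdeg a" using Suc.prems(2) by simp
  qed
  then have "x \<in> ideal_gen (range p)" using Suc.prems(1) by (auto simp: in_forms subset_iff)
  then obtain q where q: "hcomp e x = (\<Sum>j\<in>UNIV. p j * q j)" "\<And>j. homogeneous (e - \<delta> j) (q j)"
    "\<And>j. e < \<delta> j \<Longrightarrow> q j = 0"
    using homogeneous_split[of UNIV \<delta> p x e, OF finite hom] by auto
  have "\<exists>l. homogeneous (e - d j) l \<and> l \<in> L \<and> q j - l \<in> ?K n" if j: "j \<le> i" for j
    unfolding L_def mem_Collect_eq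
    by (rule Suc.IH) (use q(2)[of j] j d[OF j] Suc.prems(2) in \<open>auto simp: \<delta>_def\<close>)
  then obtain m where m: "\<And>j. j \<le> i \<Longrightarrow> homogeneous (e - d j) (m j)" "\<And>j. j \<le> i \<Longrightarrow> m j \<in> L"
    "\<And>j. j \<le> i \<Longrightarrow> q j - m j \<in> ?K n" by metis
  \<comment> \<open>For \<open>j \<le> i\<close> only the part of the cofactor outside the power is
    kept. For the other \<open>j\<close> the whole term is, as \<open>p j\<close> is then a later
    variable.\<close>
  define l where "l = (\<Sum>j\<in>UNIV. p j * (if j \<le> i then m j else q j))"
  have "homogeneous e (p j * (if j \<le> i then m j else q j))" for j
  proof (cases "\<delta> j \<le> e")
    case True
    have "homogeneous (\<delta> j + (e - \<delta> j)) (p j * (if j \<le> i then m j else q j))"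
      using m(1)[of j] q(2)[of j] by (intro homogeneous_mult hom) (auto simp: \<delta>_def)
    then show ?thesis using True by simp
  next
    case False
    then have "\<not> j \<le> i" using d[of j] Suc.prems(2) by (auto simp: \<delta>_def)
    then show ?thesis using q(3)[of j] False by simp
  qed
  then have "homogeneous e l" unfolding l_def by (intro homogeneous_sum)
  moreover have "l \<in> L"
    unfolding l_def using m(2) pL
    by (intro ideal_sum[OF L]) (auto intro: ideal_mult_left[OF L] ideal_mult_right[OF L])
  moreover have "x - l \<in> ?K (Suc n)"
  proof -
    have "x - l = (\<Sum>j\<in>UNIV. p j * (q j - (if j \<le> i then m j else q j)))"
      using q(1) Suc.prems(1) by (simp add: hcomp_homogeneous l_def sum_subtractf right_diff_distrib)
    also have "\<dots> \<in> ?K (Suc n)"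
    proof (rule ideal_sum[OF is_ideal_power])
      fix j
      show "p j * (q j - (if j \<le> i then m j else q j)) \<in> ?K (Suc n)"
        using pI[of j] m(3)[of j] ideal_zero[OF is_ideal_power[of "mat_act g ` I" "Suc n"]]
        by (auto simp: ideal_mult_def intro: ideal_gen_base)
    qed
    finally show ?thesis .
  qed
  ultimately show ?case unfolding L_def by blast
qed

lemma gin_power_generic:
  "generic (\<lambda>g. invertible g \<and> initial_ideal (mat_act g ` ideal_power I n) = gin (ideal_power I n) \<and>
    (\<forall>D h. D \<subseteq> {a. mdeg a \<le> E} \<longrightarrow> revlex_closed D \<longrightarrow> invertible h \<longrightarrow>
      card (lead_monoms (mat_act g ` ideal_power I n) \<inter> D) \<le>
      card (lead_monoms (mat_act h ` ideal_power I n) \<inter> D)))"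
  by (rule gin_generic[OF is_ideal_power forms_subset_ideal_power])

text \<open>At the matrix \<open>h\<close> of the normalization every monomial not below
  \<open>x_i^m\<close> in degree \<open>m\<close> is leading. Minimality on the lower part transfers
  this to a generic matrix.\<close>

lemma pure_power_in_gin:
  assumes "\<And>j. j \<le> i \<Longrightarrow> d j \<le> d i"
  shows "\<exists>s. \<forall>n m. s + n * d i \<le> m \<longrightarrow> mon (Poly_Mapping.single i m) \<in> gin (ideal_power I n)"
proof -
  obtain h s where h: "invertible h"
    "\<And>a. s \<le> mdeg a \<Longrightarrow> mon a \<in> ideal_gen (mat_act h ` ideal_gen (f ` {..i}) \<union> var ` {i<..})"
    using noether_normalization[of i] by blast
  have "mon (Poly_Mapping.single i m) \<in> gin (ideal_power I n)" if m: "s + n * d i \<le> m" for n m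
  proof -
    let ?J = "ideal_power I n" and ?a = "Poly_Mapping.single i m"
    let ?D = "{b::'n monom. mdeg b \<le> m}" and ?D' = "{b. revlex_gt ?a b}"
    have J: "is_ideal ?J" by (rule is_ideal_power)
    obtain g where g: "invertible g" "initial_ideal (mat_act g ` ?J) = gin ?J"
      and least: "\<And>D. D \<subseteq> ?D \<Longrightarrow> revlex_closed D \<Longrightarrow>
        card (lead_monoms (mat_act g ` ?J) \<inter> D) \<le> card (lead_monoms (mat_act h ` ?J) \<inter> D)"
      using generic_ex[OF gin_power_generic[of n m]] h(1) by blast
    let ?Lg = "lead_monoms (mat_act g ` ?J)" and ?Lh = "lead_monoms (mat_act h ` ?J)"
    have D: "finite ?D" "?D' \<subseteq> ?D" "revlex_closed ?D'"
      using finite_mdeg_le mdeg_le_of_revlex_gt[of ?a] revlex_gt_trans by (auto simp: revlex_closed_def)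
    have dim: "card (lead_monoms (mat_act g ` ?J) \<inter> ?D) = mpoly_space.dim (?J \<inter> polys_on ?D)"
      if "invertible g" for g
      using dim_mat_act_image_eq[OF that subspace_ideal[OF J], of m]
      by (subst card_lead_monoms)
        (auto simp: finite_mdeg_le revlex_closed_mdeg_le intro: subspace_mat_act_image subspace_ideal J)
    \<comment> \<open>These monomials have degree \<open>m\<close> and involve no variable after
      \<open>i\<close>. Subtracting a suitable \<open>l\<close>, all of whose monomials contain a
      later variable and are thus smaller, puts such a monomial at the head of an element of the
      power.\<close>
    have "?D - ?D' \<subseteq> ?Lh"
    proof
      fix a assume a: "a \<in> ?D - ?D'"
      then have a_ge: "a = ?a \<or> revlex_gt a ?a" using revlex_gt_total[of a ?a] by blast
      then have deg: "mdeg a = m" using a mdeg_le_of_revlex_gt[of a ?a] by auto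
      have z: "Poly_Mapping.lookup a j = 0" if j: "i < j" for j
      proof (rule ccontr)
        assume "Poly_Mapping.lookup a j \<noteq> 0"
        then have "revlex_gt ?a a"
          using j deg by (intro revlex_gt_pure_power[of _ _ i j]) (auto simp: lookup_single when_def)
        then show False using a by simp
      qed
      have "homogeneous m (mon a :: ('k, 'n) mpoly)" using homogeneous_mon[of a] deg by simp
      then obtain l where l: "homogeneous m l"
        "\<forall>b\<in>Poly_Mapping.keys l. \<exists>j>i. 0 < Poly_Mapping.lookup b j"
        "mon a - l \<in> ideal_power (mat_act h ` I) n"
        using form_in_power_mod_variables[OF h(1) assms h(2) _ m] by metis
      have al: "a \<notin> Poly_Mapping.keys l" using l(2) z by fastforce
      show "a \<in> ?Lh"
      proof (rule lead_monomsI)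
        show "mon a - l \<in> mat_act h ` ?J" using l(3) ideal_power_mat_act_subset[OF h(1)] by blast
        show "a \<in> Poly_Mapping.keys (mon a - l)"
          using al by (simp add: in_keys_iff lookup_minus lookup_mon)
        fix b assume b: "b \<in> Poly_Mapping.keys (mon a - l)" "b \<noteq> a"
        then have bl: "b \<in> Poly_Mapping.keys l" by (simp add: in_keys_iff lookup_minus lookup_mon)
        then obtain j where "i < j" "0 < Poly_Mapping.lookup b j" using l(2) by blast
        moreover have "mdeg b = m" using bl l(1) by (simp add: homogeneous_def)
        ultimately show "revlex_gt a b" using z deg by (intro revlex_gt_pure_power[of a b i j]) auto
      qed
    qed
    then have h_top: "?Lh \<inter> (?D - ?D') = ?D - ?D'" by blast
    have split: "card (L \<inter> ?D) = card (L \<inter> ?D') + card (L \<inter> (?D - ?D'))" for L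
    proof -
      have "L \<inter> ?D = (L \<inter> ?D') \<union> (L \<inter> (?D - ?D'))" using D(2) by blast
      moreover have "card ((L \<inter> ?D') \<union> (L \<inter> (?D - ?D'))) = card (L \<inter> ?D') + card (L \<inter> (?D - ?D'))"
        using D(1,2) by (intro card_Un_disjoint) (auto intro: finite_subset)
      ultimately show ?thesis by simp
    qed
    \<comment> \<open>The totals in \<open>?D\<close> agree for \<open>g\<close> and
      \<open>h\<close>, and \<open>g\<close> has at most as many leading monomials in
      \<open>?D'\<close>; it must make up for this in the upper part, which is full for
      \<open>h\<close>.\<close>
    have "card (?D - ?D') \<le> card (?Lg \<inter> (?D - ?D'))"
      using split[of ?Lg] split[of ?Lh] least[OF D(2,3)] dim[OF g(1)] dim[OF h(1)]
      unfolding h_top by linarith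
    then have "?Lg \<inter> (?D - ?D') = ?D - ?D'"
      using D(1) by (intro card_seteq) auto
    moreover have "?a \<in> ?D - ?D'" using revlex_gt_irrefl by simp
    ultimately have "?a \<in> ?Lg" by blast
    then show ?thesis
      using mon_in_initial_ideal[OF is_ideal_mat_act_image[OF g(1) J]] g(2) by metis
  qed
  then show ?thesis by blast
qed

definition gin_exponents :: "nat \<Rightarrow> 'n monom set" where
  "gin_exponents n = {a. mon a \<in> gin (ideal_power I n)}"

text \<open>The initial ideals of different powers come from different open sets. Finitely many of
  them meet, and a common matrix is what allows leading monomials of different powers to be
  multiplied.\<close>

lemma gin_exponents_lead_monoms:
  assumes "finite Q"
  obtains g where "invertible g" "\<And>n. n \<in> Q \<Longrightarrow> gin_exponents n = lead_monoms (mat_act g ` ideal_power I n)"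
proof -
  have "generic (\<lambda>g. invertible g \<and> (\<forall>n\<in>Q. initial_ideal (mat_act g ` ideal_power I n) = gin (ideal_power I n)))"
    by (intro generic_conj generic_invertible generic_ball assms generic_mono[OF gin_power_generic[of _ 0]])
      blast
  then obtain g where g: "invertible g"
    "\<And>n. n \<in> Q \<Longrightarrow> initial_ideal (mat_act g ` ideal_power I n) = gin (ideal_power I n)"
    using generic_ex by blast
  show ?thesis
  proof (rule that[OF g(1)])
    fix n assume "n \<in> Q"
    then show "gin_exponents n = lead_monoms (mat_act g ` ideal_power I n)"
      using mon_in_initial_ideal[where J = "mat_act g ` ideal_power I n",
          OF is_ideal_mat_act_image[OF g(1) is_ideal_power]] g(2)[of n]
      by (auto simp: gin_exponents_def)
  qed
qed

lemma gin_exponents_0: "gin_exponents 0 = UNIV"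
proof -
  obtain g where "invertible g" "gin_exponents 0 = lead_monoms (mat_act g ` ideal_power I 0)"
    using gin_exponents_lead_monoms[of "{0}"] by auto
  then show ?thesis using surj_mat_act[of g] mon_in_lead_monoms[of _ UNIV] by auto
qed

lemma gin_exponents_add:
  assumes "a \<in> gin_exponents p" "b \<in> gin_exponents q" "n \<le> p + q"
  shows "a + b \<in> gin_exponents n"
proof -
  obtain g where g: "invertible g"
    "\<And>m. m \<in> {p, q, n} \<Longrightarrow> gin_exponents m = lead_monoms (mat_act g ` ideal_power I m)"
    using gin_exponents_lead_monoms[of "{p, q, n}"] by blast
  have "a + b \<in> lead_monoms (mat_act g ` ideal_power I n)"
  proof (rule lead_monoms_mult)
    show "a \<in> lead_monoms (mat_act g ` ideal_power I p)" "b \<in> lead_monoms (mat_act g ` ideal_power I q)"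
      using assms g(2) by auto
    fix x y assume "x \<in> mat_act g ` ideal_power I p" "y \<in> mat_act g ` ideal_power I q"
    then obtain u v where "u \<in> ideal_power I p" "v \<in> ideal_power I q" "x = mat_act g u" "y = mat_act g v"
      by auto
    then show "x * y \<in> mat_act g ` ideal_power I n"
      using ideal_power_mult[of u I p v q] ideal_power_antimono[OF assms(3), of I]
      by (auto simp flip: mat_act.map_mult)
  qed
  then show ?thesis using g(2) by simp
qed

lemma card_gin_exponents_le:
  "card (gin_exponents n \<inter> {a. mdeg a \<le> E}) \<le>
    card {c. mdeg c \<le> E \<and> n \<le> (\<Sum>j\<in>UNIV. Poly_Mapping.lookup c j div d j)}"
proof -
  obtain g where "invertible g" "gin_exponents n = lead_monoms (mat_act g ` ideal_power I n)"
    using gin_exponents_lead_monoms[of "{n}"] by auto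
  then show ?thesis using card_lead_monoms_power_le[of g n E] by simp
qed

lemma pure_power_in_gin_exponents:
  assumes "mono d"
  shows "\<exists>s. \<forall>i n. Poly_Mapping.single i (n * d i + s) \<in> gin_exponents n"
proof -
  have "\<exists>s. \<forall>n m. s + n * d i \<le> m \<longrightarrow> Poly_Mapping.single i m \<in> gin_exponents n" for i
    using pure_power_in_gin[of i] assms by (simp add: gin_exponents_def monoD)
  then obtain s where s: "\<And>i n m. s i + n * d i \<le> m \<Longrightarrow> Poly_Mapping.single i m \<in> gin_exponents n"
    by metis
  \<comment> \<open>The statement for \<open>i\<close> covers all larger exponents, so the sum of
    the individual shifts serves for every variable.\<close>
  have "s i + n * d i \<le> n * d i + (\<Sum>i\<in>UNIV. s i)" for i n
    using member_le_sum[of i UNIV s] by simp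
  then show ?thesis using s by blast
qed

end

section \<open>Counting exponents and the limiting polytope\<close>

text \<open>Forgetting one entry is injective in a fixed degree, the degree determining that
  entry.\<close>

lemma card_mdeg_eq_le: "card {c::'n::finite monom. mdeg c = e} \<le> (e + 1) ^ (CARD('n) - 1)"
proof -
  fix k :: 'n
  let ?r = "\<lambda>c. c - Poly_Mapping.single k (Poly_Mapping.lookup c k)"
  let ?S = "\<lambda>j. if j = k then {0} else {..e}"
  have r: "c = ?r c + Poly_Mapping.single k (e - mdeg (?r c))" if "mdeg c = e" for c :: "'n monom"
  proof -
    have c: "c = ?r c + Poly_Mapping.single k (Poly_Mapping.lookup c k)"
      by (rule poly_mapping_eqI) (auto simp: lookup_add lookup_minus lookup_single when_def)
    then have "mdeg c = mdeg (?r c) + Poly_Mapping.lookup c k" by (metis mdeg_add mdeg_single)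
    then have "e - mdeg (?r c) = Poly_Mapping.lookup c k" using that by simp
    then show ?thesis using c by simp
  qed
  have "inj_on ?r {c. mdeg c = e}"
  proof (rule inj_onI)
    fix c c' :: "'n monom"
    assume "c \<in> {c. mdeg c = e}" "c' \<in> {c. mdeg c = e}" "?r c = ?r c'"
    then show "c = c'" using r[of c] r[of c'] by simp
  qed
  then have "card {c::'n monom. mdeg c = e} = card (?r ` {c. mdeg c = e})"
    by (simp add: card_image)
  also have "\<dots> \<le> card {c. \<forall>j. Poly_Mapping.lookup c j \<in> ?S j}"
  proof (rule card_mono)
    show "finite {c. \<forall>j. Poly_Mapping.lookup c j \<in> ?S j}" by (rule card_monom_box) auto
    show "?r ` {c. mdeg c = e} \<subseteq> {c. \<forall>j. Poly_Mapping.lookup c j \<in> ?S j}"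
      using lookup_le_mdeg by (auto simp: lookup_minus lookup_single when_def intro: le_trans diff_le_self)
  qed
  also have "\<dots> = (e + 1) ^ (CARD('n) - 1)"
    by (subst card_monom_box) (auto simp: if_distrib[of card] prod.If_cases Compl_eq_Diff_UNIV card_Diff_singleton)
  finally show ?thesis .
qed

text \<open>
  The sets \<open>G n\<close> are the exponents of a graded system of monomial ideals. The shift of
  \<open>Q = {c. n \<le> (\<Sum>j. c\<^sub>j div d\<^sub>j)}\<close> by \<open>(s, \<dots>, s)\<close> lies in \<open>G n\<close> and already exhausts the cardinality
  allowed by the last assumption up to the order \<open>E\<^sup>r\<^sup>-\<^sup>1\<close>. An exponent \<open>a\<close> below the hyperplane would
  give, by translating by multiples of \<open>a\<close>, of the order \<open>E\<^sup>r\<close> additional elements.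
\<close>

locale graded_exponents =
  fixes G :: "nat \<Rightarrow> 'n::finite monom set" and d :: "'n \<Rightarrow> nat" and s :: nat
  assumes d_pos: "\<And>j. 0 < d j"
    and G_0: "G 0 = UNIV"
    and G_add: "\<And>a b p q n. a \<in> G p \<Longrightarrow> b \<in> G q \<Longrightarrow> n \<le> p + q \<Longrightarrow> a + b \<in> G n"
    and G_pure: "\<And>i n. Poly_Mapping.single i (n * d i + s) \<in> G n"
    and G_card: "\<And>n E. card (G n \<inter> {a. mdeg a \<le> E}) \<le>
      card {c. mdeg c \<le> E \<and> n \<le> (\<Sum>j\<in>UNIV. Poly_Mapping.lookup c j div d j)}"
begin

lemma G_sum_pure:
  "finite A \<Longrightarrow> (\<Sum>j\<in>A. Poly_Mapping.single j (k j * d j + s)) \<in> G (\<Sum>j\<in>A. k j)"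
  by (induction A rule: finite_induct) (auto simp: G_0 intro: G_add[OF G_pure])

lemma G_multiple: "a \<in> G p \<Longrightarrow> monom_of (\<lambda>j. t * Poly_Mapping.lookup a j) \<in> G (t * p)"
proof (induction t)
  case (Suc t)
  have "monom_of (\<lambda>j. Suc t * Poly_Mapping.lookup a j) =
      a + monom_of (\<lambda>j. t * Poly_Mapping.lookup a j)"
    by (rule poly_mapping_eqI) (simp add: lookup_add)
  then show ?case using Suc by (auto intro: G_add)
qed (simp add: G_0)

text \<open>After subtracting \<open>s\<close> and rounding down to multiples of the
  \<open>d j\<close>, the exponent dominates a sum of pure powers whose indices add up to at least
  \<open>n\<close>.\<close>

lemma G_of_level:
  assumes "\<And>j. s \<le> Poly_Mapping.lookup b j"
    and "n \<le> (\<Sum>j\<in>UNIV. (Poly_Mapping.lookup b j - s) div d j)"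
  shows "b \<in> G n"
proof -
  let ?k = "\<lambda>j. (Poly_Mapping.lookup b j - s) div d j"
  let ?c = "\<Sum>j\<in>UNIV. Poly_Mapping.single j (?k j * d j + s)"
  have c: "Poly_Mapping.lookup ?c j = ?k j * d j + s" for j
    by (simp add: lookup_sum lookup_single when_def)
  have "?k j * d j + s \<le> Poly_Mapping.lookup b j" for j
    using div_times_less_eq_dividend[of "Poly_Mapping.lookup b j - s" "d j"] assms(1)[of j] by linarith
  then have "b = ?c + (b - ?c)"
    by (intro poly_mapping_eqI) (simp only: lookup_add lookup_minus c le_add_diff_inverse)
  then show ?thesis using G_add[OF G_sum_pure[of UNIV ?k] _ , of "b - ?c" 0 n] assms(2) G_0 by simp
qed

text \<open>The cardinality bound \<open>G_card\<close> enters here, at one pair \<open>n\<close>,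
  \<open>E\<close> expressed through the side length \<open>y\<close> of a box of
  translations.\<close>

lemma exponent_above_hyperplane:
  assumes a: "a \<in> G p"
  shows "real p \<le> (\<Sum>j\<in>UNIV. Poly_Mapping.lookup a j / d j)"
proof (rule ccontr)
  define r where "r = CARD('n)"
  have r: "0 < r" by (simp add: r_def)
  define \<sigma> where "\<sigma> = (\<Sum>j\<in>UNIV. Poly_Mapping.lookup a j / d j)"
  assume "\<not> ?thesis"
  then have "0 < p - \<sigma>" by (simp add: \<sigma>_def)
  \<comment> \<open>With \<open>t = r * m * y\<close> this gives \<open>r * y = t / m\<close>, less
    than \<open>t * (p - \<sigma>)\<close>: the deficiency of \<open>t\<close> copies of
    \<open>a\<close> leaves room for a box of side \<open>y\<close>.\<close>
  then obtain m :: nat where m: "0 < m" "1 / m < p - \<sigma>"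
    using reals_Archimedean by (metis inverse_eq_divide zero_less_Suc)
  \<comment> \<open>Collects the terms in the degree estimate for \<open>b w\<close>, so that all
    these exponents have degree below \<open>C * y\<close>; it does not depend on
    \<open>y\<close>.\<close>
  define C where "C = r * s + r * m * mdeg a + (\<Sum>j\<in>UNIV. d j) * (p * m + 1) + r * s + 1"
  \<comment> \<open>One more than the bound to which the comparison of cardinalities reduces at the
    end.\<close>
  define y where "y = r * s * C ^ (r - 1) + 1"
  define v where "v = m * y"
  define t where "t = r * v"
  \<comment> \<open>The \<open>t\<close> copies of \<open>a\<close> contribute \<open>p * t\<close>,
    and the summands \<open>d j * (p * v)\<close> of \<open>b w\<close> contribute
    \<open>r * (p * v)\<close>, which is again \<open>p * t\<close>.\<close>
  define n where "n = 2 * (p * t)"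
  define E where "E = C * y - 1"
  have "1 \<le> C" "1 \<le> y" by (simp_all add: C_def y_def)
  then have CyE: "E + 1 = C * y" by (simp add: E_def)
  define level where "level = (\<lambda>c::'n monom. \<Sum>j\<in>UNIV. Poly_Mapping.lookup c j div d j)"
  define W where "W = {w::'n monom. \<forall>j. Poly_Mapping.lookup w j \<in> {..<y}}"
  define b where "b = (\<lambda>w. monom_of (\<lambda>j. s + t * Poly_Mapping.lookup a j + d j * (p * v + Poly_Mapping.lookup w j)))"
  have lb: "Poly_Mapping.lookup (b w) j = s + t * Poly_Mapping.lookup a j + d j * (p * v + Poly_Mapping.lookup w j)"
    for w j by (simp add: b_def)
  define shift where "shift = (\<lambda>c::'n monom. c + monom_of (\<lambda>_. s))"
  have ls: "Poly_Mapping.lookup (shift c) j = Poly_Mapping.lookup c j + s" for c j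
    by (simp add: shift_def lookup_add)
  have deg_s: "mdeg (monom_of (\<lambda>_. s) :: 'n monom) = r * s" by (simp add: mdeg_def r_def)
  let ?Q = "\<lambda>E. {c. mdeg c \<le> E \<and> n \<le> level c}"
  have finQ: "finite (?Q E)" for E by (rule finite_subset[OF _ finite_mdeg_le[of E]]) blast
  have finW: "finite W" unfolding W_def by (rule card_monom_box) auto
  have cardW: "card W = y ^ r" unfolding W_def by (subst card_monom_box) (auto simp: r_def)
  have bG: "b w \<in> G n" if "w \<in> W" for w
  proof -
    have "b w = monom_of (\<lambda>j. t * Poly_Mapping.lookup a j) +
        (\<Sum>j\<in>UNIV. Poly_Mapping.single j ((p * v + Poly_Mapping.lookup w j) * d j + s))"
      by (rule poly_mapping_eqI) (simp add: lb lookup_add lookup_sum lookup_single when_def mult.commute)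
    moreover have "n \<le> t * p + (\<Sum>j\<in>UNIV. p * v + Poly_Mapping.lookup w j)"
      by (simp add: n_def t_def sum.distrib r_def mult_ac)
    ultimately show ?thesis using G_add[OF G_multiple[OF a, of t] G_sum_pure[OF finite]] by metis
  qed
  have bE: "mdeg (b w) \<le> E" if "w \<in> W" for w
  proof -
    have "mdeg (b w) = r * s + t * mdeg a + (\<Sum>j\<in>UNIV. d j * (p * v + Poly_Mapping.lookup w j))"
      by (simp add: mdeg_def lb sum.distrib sum_distrib_left r_def)
    also have "(\<Sum>j\<in>UNIV. d j * (p * v + Poly_Mapping.lookup w j)) \<le> (\<Sum>j\<in>UNIV. d j * ((p * m + 1) * y))"
    proof (intro sum_mono mult_left_mono)
      fix j
      have "Poly_Mapping.lookup w j < y" using that by (simp add: W_def)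
      then show "p * v + Poly_Mapping.lookup w j \<le> (p * m + 1) * y" by (simp add: v_def algebra_simps)
    qed simp
    also have "\<dots> = (\<Sum>j\<in>UNIV. d j) * (p * m + 1) * y"
      by (simp only: sum_distrib_right mult.assoc)
    finally have "mdeg (b w) \<le> r * s + t * mdeg a + (\<Sum>j\<in>UNIV. d j) * (p * m + 1) * y" by simp
    also have "\<dots> \<le> r * s * y + r * m * mdeg a * y + (\<Sum>j\<in>UNIV. d j) * (p * m + 1) * y"
      using \<open>1 \<le> y\<close> by (simp add: t_def v_def mult_ac)
    also have "\<dots> + 1 \<le> C * y" using \<open>1 \<le> y\<close> by (simp add: C_def distrib_right)
    finally show ?thesis using CyE by simp
  qed
  have b_notin: "\<not> n \<le> level c" if "w \<in> W" "b w = shift c" for w c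
  proof -
    have "real (Poly_Mapping.lookup c j div d j) \<le>
        t * (Poly_Mapping.lookup a j / d j) + p * v + Poly_Mapping.lookup w j" for j
    proof -
      have "Poly_Mapping.lookup c j = t * Poly_Mapping.lookup a j + d j * (p * v + Poly_Mapping.lookup w j)"
        using ls[of c j] lb[of w j] that(2) by simp
      then have "Poly_Mapping.lookup c j / d j =
          t * (Poly_Mapping.lookup a j / d j) + p * v + Poly_Mapping.lookup w j"
        using d_pos[of j] by (simp add: field_simps)
      moreover have "real (Poly_Mapping.lookup c j div d j) \<le> Poly_Mapping.lookup c j / d j"
        by (rule of_nat_div_le_of_nat)
      ultimately show ?thesis by simp
    qed
    then have "real (level c) \<le>
        (\<Sum>j\<in>UNIV. t * (Poly_Mapping.lookup a j / d j) + p * v + Poly_Mapping.lookup w j)"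
      unfolding level_def of_nat_sum by (intro sum_mono)
    also have "\<dots> = t * \<sigma> + r * (p * v) + (\<Sum>j\<in>UNIV. real (Poly_Mapping.lookup w j))"
      by (simp add: sum.distrib sum_distrib_left \<sigma>_def r_def)
    also have "(\<Sum>j\<in>UNIV. real (Poly_Mapping.lookup w j)) < (\<Sum>j\<in>(UNIV::'n set). real y)"
      using that(1) by (intro sum_strict_mono) (auto simp: W_def)
    also have "(\<Sum>j\<in>(UNIV::'n set). real y) \<le> t * (p - \<sigma>)"
    proof -
      have "real y = v * (1 / m)" using m(1) by (simp add: v_def)
      also have "\<dots> \<le> v * (p - \<sigma>)" using m(2) by (intro mult_left_mono) auto
      finally show ?thesis using r by (simp add: r_def[symmetric] t_def mult_left_mono)
    qed
    finally have "real (level c) < t * \<sigma> + r * (p * v) + t * (p - \<sigma>)" by simp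
    also have "\<dots> = n" by (simp add: n_def t_def algebra_simps)
    finally show ?thesis by simp
  qed
  have "inj_on b W"
  proof (rule inj_onI, rule poly_mapping_eqI)
    fix w w' j assume "b w = b w'"
    then have "d j * Poly_Mapping.lookup w j = d j * Poly_Mapping.lookup w' j"
      using lb[of w j] lb[of w' j] by (auto simp: distrib_left)
    then show "Poly_Mapping.lookup w j = Poly_Mapping.lookup w' j" using d_pos[of j] by simp
  qed
  then have "card (b ` W) = y ^ r" using cardW by (simp add: card_image)
  moreover have "card (shift ` ?Q (E - r * s)) = card (?Q (E - r * s))"
    by (rule card_image) (simp add: inj_on_def shift_def)
  moreover have "b ` W \<inter> shift ` ?Q (E - r * s) = {}" using b_notin by force
  ultimately have "y ^ r + card (?Q (E - r * s)) = card (b ` W \<union> shift ` ?Q (E - r * s))"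
    using finW finQ by (simp add: card_Un_disjoint)
  also have "\<dots> \<le> card (G n \<inter> {a. mdeg a \<le> E})"
  proof (rule card_mono)
    show "finite (G n \<inter> {a. mdeg a \<le> E})" using finite_mdeg_le by blast
    have "r * s + 1 \<le> C" by (simp add: C_def)
    also have "C \<le> E + 1" using \<open>1 \<le> y\<close> CyE by simp
    finally have "r * s \<le> E" by simp
    then have "shift c \<in> G n \<inter> {a. mdeg a \<le> E}" if "c \<in> ?Q (E - r * s)" for c
      using that deg_s by (auto simp: ls level_def shift_def lookup_add intro!: G_of_level)
    then show "b ` W \<union> shift ` ?Q (E - r * s) \<subseteq> G n \<inter> {a. mdeg a \<le> E}" using bG bE by auto
  qed
  also have "\<dots> \<le> card (?Q E)" unfolding level_def by (rule G_card)
  \<comment> \<open>The shift by \<open>s\<close> in every coordinate costs \<open>r * s\<close>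
    degrees, each with at most \<open>(E + 1) ^ (r - 1)\<close> exponents. The gain
    \<open>y ^ r\<close> cannot be paid for by these.\<close>
  also have "\<dots> \<le> card (?Q (E - r * s) \<union> (\<Union>e\<in>{E - r * s<..E}. {c. mdeg c = e}))"
    by (rule card_mono) (auto simp: finQ finite_mdeg_eq)
  also have "\<dots> \<le> card (?Q (E - r * s)) + (\<Sum>e\<in>{E - r * s<..E}. card {c::'n monom. mdeg c = e})"
    by (rule order_trans[OF card_Un_le]) (simp add: card_UN_le)
  also have "(\<Sum>e\<in>{E - r * s<..E}. card {c::'n monom. mdeg c = e}) \<le> (\<Sum>e\<in>{E - r * s<..E}. (E + 1) ^ (r - 1))"
    unfolding r_def by (intro sum_mono order_trans[OF card_mdeg_eq_le] power_mono) auto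
  also have "\<dots> \<le> r * s * (C * y) ^ (r - 1)" by (simp add: CyE[symmetric])
  finally have "y ^ r \<le> r * s * C ^ (r - 1) * y ^ (r - 1)"
    by (simp add: power_mult_distrib mult.assoc)
  moreover have "y ^ r = y * y ^ (r - 1)" using r by (cases r) auto
  ultimately have "y \<le> r * s * C ^ (r - 1)" using \<open>1 \<le> y\<close> by simp
  then show False by (simp add: y_def)
qed

text \<open>The right-hand side is closed and its multiples are convex, so one inclusion only
  concerns exponents. For the other, a point is approximated by rounding its multiples.\<close>

lemma closure_scaled_exponents:
  "closure (\<Union>q\<in>{1..}. (*\<^sub>R) (1 / real q) ` (convex hull {\<chi> i. real (Poly_Mapping.lookup a i) |a. a \<in> G q})) =
    {x::real^'n. (\<forall>i. 0 \<le> x $ i) \<and> 1 \<le> (\<Sum>i\<in>UNIV. x $ i / d i)}" (is "closure ?U = ?H")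
proof (intro equalityI closure_minimal)
  show "closed ?H"
    by (intro closed_Collect_conj closed_Collect_all closed_Collect_le continuous_intros)
      (simp add: less_imp_neq[OF d_pos, symmetric])
  show "?U \<subseteq> ?H"
  proof
    fix y assume "y \<in> ?U"
    then obtain q x where q: "1 \<le> q" and y: "y = (1 / real q) *\<^sub>R x"
      and x: "x \<in> convex hull {\<chi> i. real (Poly_Mapping.lookup a i) |a. a \<in> G q}" by auto
    let ?K = "{x::real^'n. (\<forall>i. 0 \<le> x $ i) \<and> q \<le> (\<Sum>i\<in>UNIV. x $ i / d i)}"
    have "convex ?K"
    proof (rule convexI, clarify, intro conjI allI)
      fix x y :: "real^'n" and u v :: real
      assume x: "\<forall>i. 0 \<le> x $ i" "q \<le> (\<Sum>i\<in>UNIV. x $ i / d i)" and y: "\<forall>i. 0 \<le> y $ i"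
        "q \<le> (\<Sum>i\<in>UNIV. y $ i / d i)" and uv: "0 \<le> u" "0 \<le> v" "u + v = 1"
      show "0 \<le> (u *\<^sub>R x + v *\<^sub>R y) $ i" for i using x y uv by simp
      have "q = u * q + v * q" using uv by (simp flip: distrib_right)
      also have "\<dots> \<le> u * (\<Sum>i\<in>UNIV. x $ i / d i) + v * (\<Sum>i\<in>UNIV. y $ i / d i)"
        using x y uv by (intro add_mono mult_left_mono)
      also have "\<dots> = (\<Sum>i\<in>UNIV. (u *\<^sub>R x + v *\<^sub>R y) $ i / d i)"
        by (simp add: sum_distrib_left sum.distrib add_divide_distrib)
      finally show "q \<le> (\<Sum>i\<in>UNIV. (u *\<^sub>R x + v *\<^sub>R y) $ i / d i)" .
    qed
    moreover have "{\<chi> i. real (Poly_Mapping.lookup a i) |a. a \<in> G q} \<subseteq> ?K"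
      using exponent_above_hyperplane by auto
    ultimately have "x \<in> ?K" using x hull_minimal by blast
    moreover have "(\<Sum>i\<in>UNIV. y $ i / d i) = (\<Sum>i\<in>UNIV. x $ i / d i) / q"
      by (simp add: y sum_divide_distrib mult.commute)
    ultimately show "y \<in> ?H" using q by (simp add: y)
  qed
  show "?H \<subseteq> closure ?U"
  proof
    fix x assume x: "x \<in> ?H"
    \<comment> \<open>The summand \<open>s\<close> is what \<open>G_of_level\<close> demands, and
      \<open>d i\<close> makes the later division by \<open>d i\<close> round up. Both disappear in
      the limit after scaling by \<open>1 / q\<close>.\<close>
    define a where "a = (\<lambda>q. monom_of (\<lambda>i. nat \<lfloor>real q * x $ i\<rfloor> + s + d i))"
    define z where "z = (\<lambda>n. (1 / real (Suc n)) *\<^sub>R (\<chi> i. real (Poly_Mapping.lookup (a (Suc n)) i)))"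
    have "z n \<in> ?U" for n
    proof -
      let ?q = "Suc n"
      have "a ?q \<in> G ?q"
      proof (rule G_of_level)
        have "real ?q \<le> ?q * (\<Sum>i\<in>UNIV. x $ i / d i)" using x by simp
        also have "\<dots> = (\<Sum>i\<in>UNIV. ?q * x $ i / d i)" by (simp add: sum_distrib_left)
        also have "\<dots> \<le> (\<Sum>i\<in>UNIV. real ((Poly_Mapping.lookup (a ?q) i - s) div d i))"
        proof (rule sum_mono)
          fix i
          let ?f = "nat \<lfloor>?q * x $ i\<rfloor>"
          have "?q * x $ i < ?f + 1" using x by (simp add: floor_less_cancel)
          moreover have "?f + 1 \<le> d i * (?f div d i + 1)"
            using d_pos[of i] dividend_less_times_div[of "d i" ?f] by simp
          ultimately have "?q * x $ i \<le> d i * real (?f div d i + 1)"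
            by (smt (verit, best) of_nat_le_iff of_nat_mult of_nat_add of_nat_1)
          then have "?q * x $ i / d i \<le> real (?f div d i + 1)"
            using d_pos[of i] by (simp add: field_simps)
          also have "?f div d i + 1 = (Poly_Mapping.lookup (a ?q) i - s) div d i"
            using d_pos[of i] by (simp add: a_def)
          finally show "?q * x $ i / d i \<le> real ((Poly_Mapping.lookup (a ?q) i - s) div d i)" .
        qed
        finally show "?q \<le> (\<Sum>i\<in>UNIV. (Poly_Mapping.lookup (a ?q) i - s) div d i)"
          by (simp only: of_nat_sum[symmetric] of_nat_le_iff)
      qed (simp add: a_def)
      then have "(\<chi> i. real (Poly_Mapping.lookup (a ?q) i)) \<in>
          convex hull {\<chi> i. real (Poly_Mapping.lookup a i) |a. a \<in> G ?q}"
        by (intro hull_inc) auto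
      then show ?thesis unfolding z_def by (intro UN_I[of ?q] imageI) auto
    qed
    moreover have "z \<longlonglongrightarrow> x"
    proof (rule vec_tendstoI)
      fix i
      show "(\<lambda>n. z n $ i) \<longlonglongrightarrow> x $ i"
      proof (rule real_tendsto_sandwich)
        have zi: "z n $ i = (real (nat \<lfloor>real (Suc n) * x $ i\<rfloor>) + s + d i) / Suc n" for n
          by (simp add: z_def a_def)
        have fl: "real (nat \<lfloor>real (Suc n) * x $ i\<rfloor>) = \<lfloor>real (Suc n) * x $ i\<rfloor>" for n
          using x by simp
        have "x $ i \<le> z n $ i" for n
        proof -
          have "1 \<le> d i" using d_pos[of i] by simp
          then have "real (Suc n) * x $ i \<le> real (nat \<lfloor>real (Suc n) * x $ i\<rfloor>) + s + d i"
            unfolding fl by linarith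
          then show ?thesis unfolding zi by (simp add: field_simps)
        qed
        then show "\<forall>\<^sub>F n in sequentially. x $ i \<le> z n $ i" by simp
        have "z n $ i \<le> x $ i + (s + d i) / Suc n" for n
        proof -
          have "real (nat \<lfloor>real (Suc n) * x $ i\<rfloor>) + s + d i \<le> real (Suc n) * x $ i + (s + d i)"
            unfolding fl by linarith
          then have "z n $ i \<le> (real (Suc n) * x $ i + (s + d i)) / Suc n"
            unfolding zi by (intro divide_right_mono) auto
          then show ?thesis by (simp add: add_divide_distrib)
        qed
        then show "\<forall>\<^sub>F n in sequentially. z n $ i \<le> x $ i + (s + d i) / Suc n" by simp
        have "(\<lambda>n. (s + d i) / Suc n) \<longlonglongrightarrow> 0"
          using LIMSEQ_Suc[OF lim_const_over_n[of "real (s + d i)"]] by simp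
        then show "(\<lambda>n. x $ i + (s + d i) / Suc n) \<longlonglongrightarrow> x $ i"
          using tendsto_add[OF tendsto_const[of "x $ i"]] by fastforce
      qed simp
    qed
    ultimately show "x \<in> closure ?U" unfolding closure_sequential by blast
  qed
qed

end

section \<open>The simplex and the closure of its complement\<close>

lemma convex_hull_axes:
  fixes d :: "'n::finite \<Rightarrow> nat"
  assumes "\<And>j. 0 < d j"
  shows "convex hull (insert 0 (range (\<lambda>i. axis i (real (d i))))) =
    {x. (\<forall>i. 0 \<le> x $ i) \<and> (\<Sum>i\<in>UNIV. x $ i / d i) \<le> 1}" (is "?C = ?S")
proof
  have axis_sum: "(\<Sum>j\<in>UNIV. axis i (real (d i)) $ j / d j) = 1" for i
    using assms[of i] by (simp add: axis_def if_distrib[of "\<lambda>y. y / _"] cong: if_cong)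
  show "?C \<subseteq> ?S"
  proof (rule hull_minimal)
    show "insert 0 (range (\<lambda>i. axis i (real (d i)))) \<subseteq> ?S"
      using axis_sum by (auto simp: axis_def)
    show "convex ?S"
    proof (rule convexI, clarify, intro conjI allI)
      fix x y :: "real^'n" and u v :: real
      assume x: "\<forall>i. 0 \<le> x $ i" "(\<Sum>i\<in>UNIV. x $ i / d i) \<le> 1" and y: "\<forall>i. 0 \<le> y $ i"
        "(\<Sum>i\<in>UNIV. y $ i / d i) \<le> 1" and uv: "0 \<le> u" "0 \<le> v" "u + v = 1"
      show "0 \<le> (u *\<^sub>R x + v *\<^sub>R y) $ i" for i using x y uv by simp
      have "(\<Sum>i\<in>UNIV. (u *\<^sub>R x + v *\<^sub>R y) $ i / d i) =
          u * (\<Sum>i\<in>UNIV. x $ i / d i) + v * (\<Sum>i\<in>UNIV. y $ i / d i)"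
        by (simp add: sum_distrib_left sum.distrib add_divide_distrib)
      also have "\<dots> \<le> u * 1 + v * 1" using x y uv by (intro add_mono mult_left_mono)
      finally show "(\<Sum>i\<in>UNIV. (u *\<^sub>R x + v *\<^sub>R y) $ i / d i) \<le> 1" using uv by simp
    qed
  qed
  show "?S \<subseteq> ?C"
  proof clarify
    fix x :: "real^'n" assume x: "\<forall>i. 0 \<le> x $ i" "(\<Sum>i\<in>UNIV. x $ i / d i) \<le> 1"
    define \<sigma> where "\<sigma> = (\<Sum>i\<in>UNIV. x $ i / d i)"
    have \<sigma>: "0 \<le> \<sigma>" "\<sigma> \<le> 1" using x by (auto simp: \<sigma>_def intro: sum_nonneg)
    have xs: "x = (\<Sum>i\<in>UNIV. (x $ i / d i) *\<^sub>R axis i (real (d i)))"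
      using assms by (simp add: vec_eq_iff axis_def if_distrib less_imp_neq[symmetric] cong: if_cong)
    have zero: "0 \<in> ?C" by (rule hull_inc) simp
    \<comment> \<open>The quotients \<open>x $ i / d i\<close> are the barycentric coordinates at
      the nonzero vertices. They are normalized by their sum \<sigma>, whence the separate case
      \<sigma> \<open>= 0\<close>, and the origin takes the remaining weight.\<close>
    show "x \<in> ?C"
    proof (cases "\<sigma> = 0")
      case True
      then have "\<forall>i. x $ i / d i = 0"
        unfolding \<sigma>_def using x(1) by (subst (asm) sum_nonneg_eq_0_iff) auto
      then have "x = 0" using assms by (simp add: vec_eq_iff less_imp_neq[symmetric])
      then show ?thesis using zero by simp
    next
      case False
      then have "0 < \<sigma>" using \<sigma> by simp
      have "(\<Sum>i\<in>UNIV. x $ i / d i / \<sigma>) = 1"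
        using False unfolding sum_divide_distrib[symmetric] \<sigma>_def by simp
      then have "(\<Sum>i\<in>UNIV. (x $ i / d i / \<sigma>) *\<^sub>R axis i (real (d i))) \<in> ?C"
        using x(1) \<sigma> by (intro convex_sum convex_convex_hull hull_inc) auto
      then have "\<sigma> *\<^sub>R (\<Sum>i\<in>UNIV. (x $ i / d i / \<sigma>) *\<^sub>R axis i (real (d i))) + (1 - \<sigma>) *\<^sub>R 0 \<in> ?C"
        using \<sigma> by (intro convexD[OF convex_convex_hull] zero) auto
      moreover have "\<sigma> *\<^sub>R (\<Sum>i\<in>UNIV. (x $ i / d i / \<sigma>) *\<^sub>R axis i (real (d i))) = x"
        using \<open>0 < \<sigma>\<close> by (subst (2) xs) (simp add: scaleR_sum_right)
      ultimately show ?thesis by simp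
    qed
  qed
qed

lemma closure_orthant_minus_simplex:
  fixes d :: "'n::finite \<Rightarrow> nat"
  assumes "\<And>j. 0 < d j"
  shows "closure ({x. \<forall>i. 0 \<le> x $ i} - convex hull (insert 0 (range (\<lambda>i. axis i (real (d i)))))) =
    {x::real^'n. (\<forall>i. 0 \<le> x $ i) \<and> 1 \<le> (\<Sum>i\<in>UNIV. x $ i / d i)}" (is "closure ?D = ?H")
proof (intro equalityI closure_minimal)
  have D: "?D = {x. (\<forall>i. 0 \<le> x $ i) \<and> 1 < (\<Sum>i\<in>UNIV. x $ i / d i)}"
    unfolding convex_hull_axes[OF assms] by auto
  show "closed ?H"
    by (intro closed_Collect_conj closed_Collect_all closed_Collect_le continuous_intros)
      (simp add: less_imp_neq[OF assms, symmetric])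
  show "?D \<subseteq> ?H" unfolding D by auto
  show "?H \<subseteq> closure ?D"
  proof
    fix x assume x: "x \<in> ?H"
    \<comment> \<open>Dilation from the origin moves points of the bounding hyperplane strictly off
      the simplex.\<close>
    define z where "z = (\<lambda>n. (1 + 1 / real (Suc n)) *\<^sub>R x)"
    have "z n \<in> ?D" for n
    proof -
      have "(\<Sum>i\<in>UNIV. z n $ i / d i) = (1 + 1 / real (Suc n)) * (\<Sum>i\<in>UNIV. x $ i / d i)"
        by (simp only: z_def vector_scaleR_component real_scaleR_def sum_distrib_left times_divide_eq_right)
      moreover have "1 * 1 < (1 + 1 / real (Suc n)) * (\<Sum>i\<in>UNIV. x $ i / d i)"
        using x by (intro mult_less_le_imp_less) auto
      moreover have "\<forall>i. 0 \<le> z n $ i" using x by (auto simp: z_def)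
      ultimately show ?thesis unfolding D by simp
    qed
    moreover have "z \<longlonglongrightarrow> x"
    proof -
      have "(\<lambda>n. (1 + 1 / real (Suc n)) *\<^sub>R x) \<longlonglongrightarrow> (1 + 0) *\<^sub>R x"
        by (intro tendsto_intros LIMSEQ_Suc[OF lim_1_over_n])
      then show ?thesis by (simp add: z_def)
    qed
    ultimately show "x \<in> closure ?D" unfolding closure_sequential by blast
  qed
qed

theorem theorem1p1:
  fixes I :: "('k::field_char_0, 'n::{finite,linorder}) mpoly set"
    and d :: "'n \<Rightarrow> nat"
  assumes "complete_intersection d I"
    and "mono d"
  shows "limiting_polytope (\<lambda>n. gin (ideal_power I n)) =
    closure ({x. \<forall>i. 0 \<le> x $ i} -
      convex hull (insert 0 (range (\<lambda>i. axis i (real (d i))))))"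
proof -
  obtain f where f: "I = ideal_gen (range f)" "regular_sequence f" "\<And>i. homogeneous (d i) (f i)"
    using assms(1) unfolding complete_intersection_def by blast
  then interpret f: homogeneous_regular_sequence f d by unfold_locales
  obtain s where "\<And>i n. Poly_Mapping.single i (n * d i + s) \<in> f.gin_exponents n"
    using f.pure_power_in_gin_exponents[OF assms(2)] by blast
  \<comment> \<open>From here on only the exponents matter: pure powers and the cardinality bound
    determine the limit.\<close>
  then interpret graded_exponents f.gin_exponents d s
    using f.degree_pos f.gin_exponents_0 f.gin_exponents_add f.card_gin_exponents_le
    by unfold_locales
  have "newton_polytope (gin (ideal_power I n)) =
      convex hull {\<chi> i. real (Poly_Mapping.lookup a i) |a. a \<in> f.gin_exponents n}" for n
    by (simp add: newton_polytope_def f.gin_exponents_def f(1))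
  then show ?thesis
    unfolding limiting_polytope_def closure_orthant_minus_simplex[OF f.degree_pos]
    using closure_scaled_exponents by simp
qed

end
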